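(* Let $M$ be a manifold endowed with an almost CR quaternionic structure $(E,\iota)$, $\mathrm{rank}\,E=4k$, $\dim M=4k-l$, $(0\leq l\leq 2k-1)$. Let $\nabla$ be a quaternionic connection on $(M,E,\iota)$. If $2k-l\neq2$ then the almost twistorial structure $(Z,M,\pi,\mathcal{C})$ of $(M,E,\iota,\nabla)$ is integrable, that is, the space of sections of $\mathcal{C}$ is closed under the usual bracket.
   Context: A linear quaternionic structure on a vector bundle $E\to M$ is a pair $(A,\rho)$ with $A$ a bundle of associative algebras over $M$ with typical fibre $\mathbb{H}$ and structural group $\mathrm{Aut}(\mathbb{H})=\mathrm{SO}(3)$, and $\rho:A\to\mathrm{End}(E)$ a morphism of bundles of associative algebras; $E$ is then a quaternionic vector bundle. Put $Q=\rho(\mathrm{Im}A)\subset\mathrm{End}(E)$ and let $\pi:Z\to M$ be the sphere bundle of $Q$ (so each $J\in Z$ is a linear complex structure on $E_{\pi(J)}$; these are the admissible linear complex structures). For $J\in Z$, $E^J\subseteq E^{\mathbb{C}}_{\pi(J)}$ is the eigenspace of $J$ for $-\mathrm{i}$. Each fibre $Z_x\cong\mathbb{C}P^1$ has the complex structure for which $J\mapsto E^J$ is holomorphic into the Grassmannian of $E_x^{\mathbb{C}}$. An almost CR quaternionic structure on $M$ is a pair $(E,\iota)$ with $E$ a quaternionic vector bundle on $M$ and $\iota:TM\to E$ an injective morphism of vector bundles such that $\mathrm{im}\,\iota_x+J(\mathrm{im}\,\iota_x)=E_x$ for all $x\in M$ and $J\in Z_x$. An almost quaternionic connection on $(M,E,\iota)$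 is a connection $\nabla$ on $E$ which preserves $Q$; it is a quaternionic connection if, further, it is torsion-free, i.e. $\mathrm{d}^{\nabla}\iota=0$. Given an almost quaternionic connection $\nabla$, for $J\in Z$ let $\mathcal{B}_J\subseteq T_J^{\mathbb{C}}Z$ be the horizontal lift, with respect to $\nabla$, of $\iota^{-1}(E^J)\subseteq T^{\mathbb{C}}_{\pi(J)}M$ ($\iota$ extended complex linearly) and let $\mathcal{C}_J=\mathcal{B}_J\oplus(\ker \mathrm{d}\pi)^{0,1}_J$. This is an almost CR structure on $Z$. The quadruple $(Z,M,\pi,\mathcal{C})$ is called the almost twistorial structure of $(M,E,\iota,\nabla)$. *)

theory Defs
  imports "HOL-Analysis.Analysis"
begin

section \<open>Smooth maps and manifolds\<close>

primrec Ck_on :: "nat \<Rightarrow> 'a::euclidean_space set \<Rightarrow> ('a \<Rightarrow> 'b::real_normed_vector) \<Rightarrow> bool" where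
  "Ck_on 0 S f \<longleftrightarrow> continuous_on S f"
| "Ck_on (Suc k) S f \<longleftrightarrow>
     (\<forall>x\<in>S. f differentiable (at x)) \<and> (\<forall>v. Ck_on k S (\<lambda>x. frechet_derivative f (at x) v))"

text \<open>Only used for open \<open>S\<close>.\<close>

definition Cinf_on :: "'a::euclidean_space set \<Rightarrow> ('a \<Rightarrow> 'b::real_normed_vector) \<Rightarrow> bool" where
  "Cinf_on S f \<longleftrightarrow> (\<forall>k. Ck_on k S f)"

text \<open>The whole type \<open>'m\<close> is the manifold; its Hausdorff and second countable topology comes from
  the type class.  A chart is a pair of an open set and a map which matters on that set only.\<close>

type_synonym ('m, 'n) atlas = "('m set \<times> ('m \<Rightarrow> 'n)) set"

definition smooth_manifold ::
    "('m::{t2_space, second_countable_topology}, 'n::euclidean_space) atlas \<Rightarrow> bool" where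
  "smooth_manifold M \<longleftrightarrow>
     (\<Union>(U, \<phi>)\<in>M. U) = UNIV \<and>
     (\<forall>(U, \<phi>)\<in>M. open U \<and> open (\<phi> ` U) \<and> homeomorphism U (\<phi> ` U) \<phi> (inv_into U \<phi>)) \<and>
     (\<forall>(U, \<phi>)\<in>M. \<forall>(V, \<psi>)\<in>M. Cinf_on (\<phi> ` (U \<inter> V)) (\<psi> \<circ> inv_into U \<phi>))"

definition smooth_map ::
    "('m, 'n::euclidean_space) atlas \<Rightarrow> 'm set \<Rightarrow> ('m \<Rightarrow> 'b::real_normed_vector) \<Rightarrow> bool" where
  "smooth_map M S f \<longleftrightarrow> (\<forall>(U, \<phi>)\<in>M. Cinf_on (\<phi> ` (U \<inter> S)) (f \<circ> inv_into U \<phi>))"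

definition smooth_functions :: "('m, 'n::euclidean_space) atlas \<Rightarrow> ('m \<Rightarrow> real) set" where
  "smooth_functions M = {f. smooth_map M UNIV f}"


section \<open>Tangent vectors, vector fields, brackets\<close>

text \<open>A tangent vector at \<open>p\<close> is a derivation at \<open>p\<close> of the algebra \<open>F\<close> of smooth functions.  The
  last clause only serves to make the derivation unique as a function on the whole type.  When the
  manifold is a proper subset \<open>N\<close> of the type, membership in \<open>F\<close> depends only on the values on \<open>N\<close>;
  derivations at points of \<open>N\<close> then ignore the values off \<open>N\<close>, by the Leibniz rule applied to the
  product with the indicator function of the complement of \<open>N\<close>.\<close>

type_synonym 'a tvec = "('a \<Rightarrow> real) \<Rightarrow> real"

definition tangent_space :: "('a \<Rightarrow> real) set \<Rightarrow> 'a \<Rightarrow> 'a tvec set" where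
  "tangent_space F p = {X.
     (\<forall>f\<in>F. \<forall>g\<in>F. X (\<lambda>q. f q + g q) = X f + X g) \<and>
     (\<forall>f\<in>F. \<forall>c. X (\<lambda>q. c * f q) = c * X f) \<and>
     (\<forall>f\<in>F. \<forall>g\<in>F. X (\<lambda>q. f q * g q) = f p * X g + g p * X f) \<and>
     (\<forall>f. f \<notin> F \<longrightarrow> X f = 0)}"

definition vector_fields :: "('a \<Rightarrow> real) set \<Rightarrow> 'a set \<Rightarrow> ('a \<Rightarrow> 'a tvec) set" where
  "vector_fields F N = {X. (\<forall>p\<in>N. X p \<in> tangent_space F p) \<and> (\<forall>f\<in>F. (\<lambda>p. X p f) \<in> F)}"

definition bracket ::
    "('a \<Rightarrow> real) set \<Rightarrow> ('a \<Rightarrow> 'a tvec) \<Rightarrow> ('a \<Rightarrow> 'a tvec) \<Rightarrow> 'a \<Rightarrow> 'a tvec" where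
  "bracket F X Y p =
     (\<lambda>f. if f \<in> F then X p (\<lambda>q. Y q f) - Y p (\<lambda>q. X q f) else 0)"

text \<open>Complexifications are represented by pairs: \<open>(a, b)\<close> stands for \<open>a + i b\<close>.  So \<open>'v \<times> 'v\<close> is the
  complexification of \<open>'v\<close>, and a complex tangent vector is a pair of real ones.\<close>

definition times_i :: "'v \<times> 'v \<Rightarrow> 'v \<times> 'v::real_vector" where
  "times_i w = (- snd w, fst w)"

text \<open>A complex distribution \<open>D\<close> assigns to each point of \<open>N\<close> a set of complex tangent vectors.\<close>

definition sections_of ::
    "('a \<Rightarrow> real) set \<Rightarrow> 'a set \<Rightarrow> ('a \<Rightarrow> ('a tvec \<times> 'a tvec) set) \<Rightarrow> ('a \<Rightarrow> 'a tvec \<times> 'a tvec) set"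
  where
  "sections_of F N D = {X.
     (\<lambda>p. fst (X p)) \<in> vector_fields F N \<and> (\<lambda>p. snd (X p)) \<in> vector_fields F N \<and>
     (\<forall>p\<in>N. X p \<in> D p)}"

text \<open>The complex bilinear extension of the bracket.\<close>

definition cbracket ::
    "('a \<Rightarrow> real) set \<Rightarrow> ('a \<Rightarrow> 'a tvec \<times> 'a tvec) \<Rightarrow> ('a \<Rightarrow> 'a tvec \<times> 'a tvec)
       \<Rightarrow> 'a \<Rightarrow> 'a tvec \<times> 'a tvec" where
  "cbracket F X Y p =
     (let X1 = \<lambda>q. fst (X q); X2 = \<lambda>q. snd (X q); Y1 = \<lambda>q. fst (Y q); Y2 = \<lambda>q. snd (Y q)
      in (\<lambda>f. bracket F X1 Y1 p f - bracket F X2 Y2 p f,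
          \<lambda>f. bracket F X1 Y2 p f + bracket F X2 Y1 p f))"

definition integrable_structure ::
    "('a \<Rightarrow> real) set \<Rightarrow> 'a set \<Rightarrow> ('a \<Rightarrow> ('a tvec \<times> 'a tvec) set) \<Rightarrow> bool" where
  "integrable_structure F N D \<longleftrightarrow>
     (\<forall>X\<in>sections_of F N D. \<forall>Y\<in>sections_of F N D. cbracket F X Y \<in> sections_of F N D)"


section \<open>Vector bundles\<close>

text \<open>The fibre over each point is the vector space \<open>'v\<close> itself, and the bundle is given by its local
  trivialisations \<open>(W, \<tau>)\<close>, where \<open>\<tau> x\<close> is the linear isomorphism from the fibre over \<open>x \<in> W\<close> onto the
  typical fibre.  No regularity in \<open>x\<close> is required of \<open>\<tau>\<close> itself, only of the transition functions;
  in particular the total space is not the product manifold.  Choosing, separately for each \<open>x\<close>, any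
  linear isomorphism of the fibre over \<open>x\<close> with the typical fibre brings an arbitrary vector bundle
  into this form.\<close>

type_synonym ('m, 'v) vbundle = "('m set \<times> ('m \<Rightarrow> 'v \<Rightarrow> 'v)) set"

definition vector_bundle ::
    "('m::topological_space, 'n::euclidean_space) atlas \<Rightarrow> ('m, 'v::euclidean_space) vbundle \<Rightarrow> bool"
  where
  "vector_bundle M E \<longleftrightarrow>
     (\<Union>(W, \<tau>)\<in>E. W) = UNIV \<and>
     (\<forall>(W, \<tau>)\<in>E. open W \<and> (\<forall>x\<in>W. linear (\<tau> x) \<and> bij (\<tau> x))) \<and>
     (\<forall>(W, \<tau>)\<in>E. \<forall>(W', \<tau>')\<in>E. \<forall>v. smooth_map M (W \<inter> W') (\<lambda>x. \<tau>' x (inv (\<tau> x) v)))"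

definition smooth_sections ::
    "('m, 'n::euclidean_space) atlas \<Rightarrow> ('m, 'v::euclidean_space) vbundle \<Rightarrow> ('m \<Rightarrow> 'v) set" where
  "smooth_sections M E = {s. \<forall>(W, \<tau>)\<in>E. smooth_map M W (\<lambda>x. \<tau> x (s x))}"

text \<open>Smoothness over the open set \<open>S\<close> of a section of the endomorphism bundle of \<open>E\<close>.\<close>

definition smooth_End_section ::
    "('m, 'n::euclidean_space) atlas \<Rightarrow> ('m, 'v::euclidean_space) vbundle \<Rightarrow> 'm set
       \<Rightarrow> ('m \<Rightarrow> ('v \<Rightarrow>\<^sub>L 'v)) \<Rightarrow> bool" where
  "smooth_End_section M E S T \<longleftrightarrow>
     (\<forall>(W, \<tau>)\<in>E. \<forall>v. smooth_map M (S \<inter> W) (\<lambda>x. \<tau> x (blinfun_apply (T x) (inv (\<tau> x) v))))"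


section \<open>Quaternionic vector bundles\<close>

text \<open>The quaternions as real part and imaginary part.\<close>

type_synonym quat = "real \<times> (real ^ 3)"

definition quat_mult :: "quat \<Rightarrow> quat \<Rightarrow> quat" where
  "quat_mult a b =
     (fst a * fst b - snd a \<bullet> snd b, fst a *\<^sub>R snd b + fst b *\<^sub>R snd a + cross3 (snd a) (snd b))"

definition quat_Aut :: "(quat \<Rightarrow> quat) set" where
  "quat_Aut = {\<sigma>. linear \<sigma> \<and> bij \<sigma> \<and> (\<forall>a b. \<sigma> (quat_mult a b) = quat_mult (\<sigma> a) (\<sigma> b))}"

text \<open>As for vector bundles, every fibre of an algebra bundle is the algebra of quaternions itself,
  and the trivialisations are fibrewise algebra isomorphisms.\<close>

definition quat_algebra_bundle ::
    "('m::topological_space, 'n::euclidean_space) atlas \<Rightarrow> ('m, quat) vbundle \<Rightarrow> bool" where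
  "quat_algebra_bundle M A \<longleftrightarrow>
     vector_bundle M A \<and> (\<forall>(W, \<alpha>)\<in>A. \<forall>x\<in>W. \<alpha> x \<in> quat_Aut)"

text \<open>Morphisms of associative algebras preserve the unit.\<close>

definition linear_quaternionic_structure ::
    "('m::topological_space, 'n::euclidean_space) atlas \<Rightarrow> ('m, 'v::euclidean_space) vbundle
       \<Rightarrow> ('m, quat) vbundle \<Rightarrow> ('m \<Rightarrow> quat \<Rightarrow> ('v \<Rightarrow>\<^sub>L 'v)) \<Rightarrow> bool" where
  "linear_quaternionic_structure M E A \<rho> \<longleftrightarrow>
     quat_algebra_bundle M A \<and>
     (\<forall>x. linear (\<rho> x) \<and> \<rho> x (1, 0) = id_blinfun \<and>
          (\<forall>a b. \<rho> x (quat_mult a b) = \<rho> x a o\<^sub>L \<rho> x b)) \<and>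
     (\<forall>(W, \<alpha>)\<in>A. \<forall>a. smooth_End_section M E W (\<lambda>x. \<rho> x (inv (\<alpha> x) a)))"

definition Q_fibre :: "('m \<Rightarrow> quat \<Rightarrow> ('v::euclidean_space \<Rightarrow>\<^sub>L 'v)) \<Rightarrow> 'm \<Rightarrow> ('v \<Rightarrow>\<^sub>L 'v) set" where
  "Q_fibre \<rho> x = {\<rho> x (0, u) | u. True}"

definition Z_fibre :: "('m \<Rightarrow> quat \<Rightarrow> ('v::euclidean_space \<Rightarrow>\<^sub>L 'v)) \<Rightarrow> 'm \<Rightarrow> ('v \<Rightarrow>\<^sub>L 'v) set" where
  "Z_fibre \<rho> x = {\<rho> x (0, u) | u. norm u = 1}"

text \<open>The total space \<open>Z\<close>, with \<open>\<pi> = fst\<close>.\<close>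

definition Z_space ::
    "('m \<Rightarrow> quat \<Rightarrow> ('v::euclidean_space \<Rightarrow>\<^sub>L 'v)) \<Rightarrow> ('m \<times> ('v \<Rightarrow>\<^sub>L 'v)) set" where
  "Z_space \<rho> = {(x, J). J \<in> Z_fibre \<rho> x}"

text \<open>A trivialisation \<open>(W, \<alpha>)\<close> of the algebra bundle induces the trivialisation
  \<open>(x, u) \<mapsto> (x, \<rho>\<^sub>x (\<alpha>\<^sub>x\<inverse> u))\<close> of \<open>Z\<close> over \<open>W\<close> with fibre the unit sphere of the imaginary
  quaternions.  A function on the sphere is smooth iff its radial extension is smooth away from 0.\<close>

definition Z_smooth_functions ::
    "('m, 'n::euclidean_space) atlas \<Rightarrow> ('m, quat) vbundle
       \<Rightarrow> ('m \<Rightarrow> quat \<Rightarrow> ('v::euclidean_space \<Rightarrow>\<^sub>L 'v)) \<Rightarrow> ('m \<times> ('v \<Rightarrow>\<^sub>L 'v) \<Rightarrow> real) set" where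
  "Z_smooth_functions M A \<rho> = {f. \<forall>(U, \<phi>)\<in>M. \<forall>(W, \<alpha>)\<in>A.
     Cinf_on ((\<phi> ` (U \<inter> W)) \<times> (- {0}))
       (\<lambda>(y, u). let x = inv_into U \<phi> y
                 in f (x, \<rho> x (inv (\<alpha> x) (0, u /\<^sub>R norm u))))}"

text \<open>\<open>E\<^sup>J\<close>, the eigenspace of \<open>J\<close> for \<open>-i\<close> in the complexified fibre.\<close>

definition eigenspace_minus_i :: "('v::euclidean_space \<Rightarrow>\<^sub>L 'v) \<Rightarrow> ('v \<times> 'v) set" where
  "eigenspace_minus_i J =
     {w. (blinfun_apply J (fst w), blinfun_apply J (snd w)) = - times_i w}"


section \<open>Almost CR quaternionic structures and quaternionic connections\<close>

definition almost_CR_quaternionic ::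
    "('m::topological_space, 'n::euclidean_space) atlas \<Rightarrow> ('m, 'v::euclidean_space) vbundle
       \<Rightarrow> ('m, quat) vbundle \<Rightarrow> ('m \<Rightarrow> quat \<Rightarrow> ('v \<Rightarrow>\<^sub>L 'v)) \<Rightarrow> ('m \<Rightarrow> 'm tvec \<Rightarrow> 'v) \<Rightarrow> bool" where
  "almost_CR_quaternionic M E A \<rho> \<iota> \<longleftrightarrow>
     vector_bundle M E \<and> linear_quaternionic_structure M E A \<rho> \<and>
     (\<forall>x. \<forall>v\<in>tangent_space (smooth_functions M) x. \<forall>w\<in>tangent_space (smooth_functions M) x. \<forall>a b.
        \<iota> x (\<lambda>f. a * v f + b * w f) = a *\<^sub>R \<iota> x v + b *\<^sub>R \<iota> x w) \<and>
     (\<forall>x. inj_on (\<iota> x) (tangent_space (smooth_functions M) x)) \<and>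
     (\<forall>X\<in>vector_fields (smooth_functions M) UNIV. (\<lambda>x. \<iota> x (X x)) \<in> smooth_sections M E) \<and>
     (\<forall>x. \<forall>J\<in>Z_fibre \<rho> x.
        {a + blinfun_apply J b | a b.
           a \<in> \<iota> x ` tangent_space (smooth_functions M) x \<and>
           b \<in> \<iota> x ` tangent_space (smooth_functions M) x} = UNIV)"

text \<open>\<open>nab x v s\<close> is the covariant derivative of the section \<open>s\<close> along the tangent vector \<open>v\<close> at \<open>x\<close>.\<close>

definition bundle_connection ::
    "('m, 'n::euclidean_space) atlas \<Rightarrow> ('m, 'v::euclidean_space) vbundle
       \<Rightarrow> ('m \<Rightarrow> 'm tvec \<Rightarrow> ('m \<Rightarrow> 'v) \<Rightarrow> 'v) \<Rightarrow> bool" where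
  "bundle_connection M E nab \<longleftrightarrow>
     (\<forall>x. \<forall>v\<in>tangent_space (smooth_functions M) x. \<forall>w\<in>tangent_space (smooth_functions M) x. \<forall>a b.
        \<forall>s\<in>smooth_sections M E.
          nab x (\<lambda>f. a * v f + b * w f) s = a *\<^sub>R nab x v s + b *\<^sub>R nab x w s) \<and>
     (\<forall>x. \<forall>v\<in>tangent_space (smooth_functions M) x.
        \<forall>s\<in>smooth_sections M E. \<forall>t\<in>smooth_sections M E.
          nab x v (\<lambda>y. s y + t y) = nab x v s + nab x v t) \<and>
     (\<forall>x. \<forall>v\<in>tangent_space (smooth_functions M) x.
        \<forall>f\<in>smooth_functions M. \<forall>s\<in>smooth_sections M E.
          nab x v (\<lambda>y. f y *\<^sub>R s y) = v f *\<^sub>R s x + f x *\<^sub>R nab x v s) \<and>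
     (\<forall>X\<in>vector_fields (smooth_functions M) UNIV. \<forall>s\<in>smooth_sections M E.
        (\<lambda>x. nab x (X x) s) \<in> smooth_sections M E)"

text \<open>\<open>q = \<nabla>\<^sub>v T\<close> for the induced connection \<open>(\<nabla>\<^sub>v T) s = \<nabla>\<^sub>v (T s) - T (\<nabla>\<^sub>v s)\<close> on the endomorphism bundle.
  Since \<open>T\<close> may be defined near \<open>x\<close> only, \<open>T s\<close> is represented by any global section agreeing with it
  near \<open>x\<close>.\<close>

definition End_derivative ::
    "('m::topological_space, 'n::euclidean_space) atlas \<Rightarrow> ('m, 'v::euclidean_space) vbundle
       \<Rightarrow> ('m \<Rightarrow> 'm tvec \<Rightarrow> ('m \<Rightarrow> 'v) \<Rightarrow> 'v) \<Rightarrow> 'm \<Rightarrow> 'm tvec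
       \<Rightarrow> ('m \<Rightarrow> ('v \<Rightarrow>\<^sub>L 'v)) \<Rightarrow> ('v \<Rightarrow>\<^sub>L 'v) \<Rightarrow> bool" where
  "End_derivative M E nab x v T q \<longleftrightarrow>
     (\<forall>s\<in>smooth_sections M E. \<forall>s'\<in>smooth_sections M E.
        (\<forall>\<^sub>F y in nhds x. s' y = blinfun_apply (T y) (s y)) \<longrightarrow>
        blinfun_apply q (s x) = nab x v s' - blinfun_apply (T x) (nab x v s))"

definition almost_quaternionic_connection ::
    "('m::topological_space, 'n::euclidean_space) atlas \<Rightarrow> ('m, 'v::euclidean_space) vbundle
       \<Rightarrow> ('m \<Rightarrow> quat \<Rightarrow> ('v \<Rightarrow>\<^sub>L 'v)) \<Rightarrow> ('m \<Rightarrow> 'm tvec \<Rightarrow> ('m \<Rightarrow> 'v) \<Rightarrow> 'v) \<Rightarrow> bool" where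
  "almost_quaternionic_connection M E \<rho> nab \<longleftrightarrow>
     bundle_connection M E nab \<and>
     (\<forall>T. smooth_End_section M E UNIV T \<and> (\<forall>x. T x \<in> Q_fibre \<rho> x) \<longrightarrow>
        (\<forall>x. \<forall>v\<in>tangent_space (smooth_functions M) x.
           \<exists>q\<in>Q_fibre \<rho> x. End_derivative M E nab x v T q))"

definition quaternionic_connection ::
    "('m::topological_space, 'n::euclidean_space) atlas \<Rightarrow> ('m, 'v::euclidean_space) vbundle
       \<Rightarrow> ('m \<Rightarrow> quat \<Rightarrow> ('v \<Rightarrow>\<^sub>L 'v)) \<Rightarrow> ('m \<Rightarrow> 'm tvec \<Rightarrow> 'v)
       \<Rightarrow> ('m \<Rightarrow> 'm tvec \<Rightarrow> ('m \<Rightarrow> 'v) \<Rightarrow> 'v) \<Rightarrow> bool" where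
  "quaternionic_connection M E \<rho> \<iota> nab \<longleftrightarrow>
     almost_quaternionic_connection M E \<rho> nab \<and>
     (\<forall>X\<in>vector_fields (smooth_functions M) UNIV. \<forall>Y\<in>vector_fields (smooth_functions M) UNIV. \<forall>x.
        nab x (X x) (\<lambda>y. \<iota> y (Y y)) - nab x (Y x) (\<lambda>y. \<iota> y (X y))
          - \<iota> x (bracket (smooth_functions M) X Y x) = 0)"


section \<open>The almost twistorial structure\<close>

text \<open>\<open>X\<close> is the horizontal lift of \<open>v\<close> to \<open>(x, J)\<close> iff \<open>X = dT (v)\<close> for a local section \<open>T\<close> of \<open>Z\<close> with
  \<open>T x = J\<close> which is parallel at \<open>x\<close>.  As \<open>f \<circ> T\<close> is defined near \<open>x\<close> only, \<open>v\<close> is applied to global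
  functions \<open>g\<close> with the same germ at \<open>x\<close>.\<close>

definition horizontal_lift ::
    "('m::topological_space, 'n::euclidean_space) atlas \<Rightarrow> ('m, 'v::euclidean_space) vbundle
       \<Rightarrow> ('m, quat) vbundle \<Rightarrow> ('m \<Rightarrow> quat \<Rightarrow> ('v \<Rightarrow>\<^sub>L 'v))
       \<Rightarrow> ('m \<Rightarrow> 'm tvec \<Rightarrow> ('m \<Rightarrow> 'v) \<Rightarrow> 'v)
       \<Rightarrow> 'm \<times> ('v \<Rightarrow>\<^sub>L 'v) \<Rightarrow> 'm tvec \<Rightarrow> ('m \<times> ('v \<Rightarrow>\<^sub>L 'v)) tvec \<Rightarrow> bool" where
  "horizontal_lift M E A \<rho> nab z v X \<longleftrightarrow>
     X \<in> tangent_space (Z_smooth_functions M A \<rho>) z \<and>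
     (\<exists>W T. open W \<and> fst z \<in> W \<and> smooth_End_section M E W T \<and> (\<forall>y\<in>W. T y \<in> Z_fibre \<rho> y) \<and>
        T (fst z) = snd z \<and>
        (\<forall>w\<in>tangent_space (smooth_functions M) (fst z). End_derivative M E nab (fst z) w T 0) \<and>
        (\<forall>f\<in>Z_smooth_functions M A \<rho>. \<forall>g\<in>smooth_functions M.
           (\<forall>\<^sub>F y in nhds (fst z). g y = f (y, T y)) \<longrightarrow> X f = v g))"

definition twistor_B ::
    "('m::topological_space, 'n::euclidean_space) atlas \<Rightarrow> ('m, 'v::euclidean_space) vbundle
       \<Rightarrow> ('m, quat) vbundle \<Rightarrow> ('m \<Rightarrow> quat \<Rightarrow> ('v \<Rightarrow>\<^sub>L 'v)) \<Rightarrow> ('m \<Rightarrow> 'm tvec \<Rightarrow> 'v)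
       \<Rightarrow> ('m \<Rightarrow> 'm tvec \<Rightarrow> ('m \<Rightarrow> 'v) \<Rightarrow> 'v)
       \<Rightarrow> 'm \<times> ('v \<Rightarrow>\<^sub>L 'v) \<Rightarrow> (('m \<times> ('v \<Rightarrow>\<^sub>L 'v)) tvec \<times> ('m \<times> ('v \<Rightarrow>\<^sub>L 'v)) tvec) set" where
  "twistor_B M E A \<rho> \<iota> nab z = {(X1, X2).
     \<exists>v1\<in>tangent_space (smooth_functions M) (fst z).
     \<exists>v2\<in>tangent_space (smooth_functions M) (fst z).
       (\<iota> (fst z) v1, \<iota> (fst z) v2) \<in> eigenspace_minus_i (snd z) \<and>
       horizontal_lift M E A \<rho> nab z v1 X1 \<and> horizontal_lift M E A \<rho> nab z v2 X2}"

definition vertical_space ::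
    "('m, 'n::euclidean_space) atlas \<Rightarrow> ('m, quat) vbundle
       \<Rightarrow> ('m \<Rightarrow> quat \<Rightarrow> ('v::euclidean_space \<Rightarrow>\<^sub>L 'v))
       \<Rightarrow> 'm \<times> ('v \<Rightarrow>\<^sub>L 'v) \<Rightarrow> ('m \<times> ('v \<Rightarrow>\<^sub>L 'v)) tvec set" where
  "vertical_space M A \<rho> z = {X \<in> tangent_space (Z_smooth_functions M A \<rho>) z.
     \<forall>g\<in>smooth_functions M. X (\<lambda>z'. g (fst z')) = 0}"

text \<open>\<open>X\<close> is the velocity at time 0 of the curve \<open>c\<close> in the fibre of \<open>Z\<close> through \<open>z\<close>.\<close>

definition fibre_curve_velocity ::
    "('m, 'n::euclidean_space) atlas \<Rightarrow> ('m, quat) vbundle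
       \<Rightarrow> ('m \<Rightarrow> quat \<Rightarrow> ('v::euclidean_space \<Rightarrow>\<^sub>L 'v))
       \<Rightarrow> 'm \<times> ('v \<Rightarrow>\<^sub>L 'v) \<Rightarrow> (real \<Rightarrow> ('v \<Rightarrow>\<^sub>L 'v)) \<Rightarrow> ('m \<times> ('v \<Rightarrow>\<^sub>L 'v)) tvec \<Rightarrow> bool" where
  "fibre_curve_velocity M A \<rho> z c X \<longleftrightarrow>
     (\<forall>t. c t \<in> Z_fibre \<rho> (fst z)) \<and> c 0 = snd z \<and> c differentiable (at 0) \<and>
     (\<forall>f\<in>Z_smooth_functions M A \<rho>.
        ((\<lambda>t. f (fst z, c t)) has_real_derivative X f) (at 0))"

text \<open>The tangent space at \<open>L\<close> of the Grassmannian of a complex vector space \<open>V\<close> is the complex vector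
  space \<open>Hom (L, V / L)\<close>: the velocity at time 0 of a curve \<open>L t\<close> of subspaces maps \<open>\<gamma> 0\<close> to the class of
  \<open>\<gamma>' 0\<close>, for any curve \<open>\<gamma>\<close> with \<open>\<gamma> t \<in> L t\<close>.  It is represented by its graph, pulled back from
  \<open>L 0 \<times> (V / L 0)\<close> to \<open>L 0 \<times> V\<close>.\<close>

definition Grassmannian_velocity ::
    "(real \<Rightarrow> ('v::euclidean_space \<times> 'v) set) \<Rightarrow> (('v \<times> 'v) \<times> ('v \<times> 'v)) set" where
  "Grassmannian_velocity L =
     {(\<gamma> 0, w') | \<gamma> w'. (\<forall>t. \<gamma> t \<in> L t) \<and> (\<gamma> has_vector_derivative w') (at 0)}"

text \<open>\<open>X' = \<J> X\<close> for the complex structure \<open>\<J>\<close> of the fibre of \<open>Z\<close> which makes \<open>J \<mapsto> E\<^sup>J\<close> holomorphic,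
  that is, the differential of \<open>J \<mapsto> E\<^sup>J\<close> maps \<open>X'\<close> to \<open>i\<close> times the image of \<open>X\<close>.\<close>

definition fibre_complex_structure ::
    "('m, 'n::euclidean_space) atlas \<Rightarrow> ('m, quat) vbundle
       \<Rightarrow> ('m \<Rightarrow> quat \<Rightarrow> ('v::euclidean_space \<Rightarrow>\<^sub>L 'v)) \<Rightarrow> 'm \<times> ('v \<Rightarrow>\<^sub>L 'v)
       \<Rightarrow> ('m \<times> ('v \<Rightarrow>\<^sub>L 'v)) tvec \<Rightarrow> ('m \<times> ('v \<Rightarrow>\<^sub>L 'v)) tvec \<Rightarrow> bool" where
  "fibre_complex_structure M A \<rho> z X X' \<longleftrightarrow>
     X \<in> vertical_space M A \<rho> z \<and> X' \<in> vertical_space M A \<rho> z \<and>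
     (\<exists>c c'. fibre_curve_velocity M A \<rho> z c X \<and> fibre_curve_velocity M A \<rho> z c' X' \<and>
        (\<forall>w u. (w, u) \<in> Grassmannian_velocity (\<lambda>t. eigenspace_minus_i (c t)) \<longleftrightarrow>
               (w, times_i u) \<in> Grassmannian_velocity (\<lambda>t. eigenspace_minus_i (c' t))))"

text \<open>\<open>(ker d\<pi>)\<^sup>0\<^sup>,\<^sup>1\<close> is the eigenspace of \<open>\<J>\<close> for \<open>-i\<close>, that is, the set of all \<open>X + i \<J> X\<close>.\<close>

definition vertical_01 ::
    "('m, 'n::euclidean_space) atlas \<Rightarrow> ('m, quat) vbundle
       \<Rightarrow> ('m \<Rightarrow> quat \<Rightarrow> ('v::euclidean_space \<Rightarrow>\<^sub>L 'v)) \<Rightarrow> 'm \<times> ('v \<Rightarrow>\<^sub>L 'v)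
       \<Rightarrow> (('m \<times> ('v \<Rightarrow>\<^sub>L 'v)) tvec \<times> ('m \<times> ('v \<Rightarrow>\<^sub>L 'v)) tvec) set" where
  "vertical_01 M A \<rho> z = {(X, X'). fibre_complex_structure M A \<rho> z X X'}"

definition twistor_C ::
    "('m::topological_space, 'n::euclidean_space) atlas \<Rightarrow> ('m, 'v::euclidean_space) vbundle
       \<Rightarrow> ('m, quat) vbundle \<Rightarrow> ('m \<Rightarrow> quat \<Rightarrow> ('v \<Rightarrow>\<^sub>L 'v)) \<Rightarrow> ('m \<Rightarrow> 'm tvec \<Rightarrow> 'v)
       \<Rightarrow> ('m \<Rightarrow> 'm tvec \<Rightarrow> ('m \<Rightarrow> 'v) \<Rightarrow> 'v)
       \<Rightarrow> 'm \<times> ('v \<Rightarrow>\<^sub>L 'v) \<Rightarrow> (('m \<times> ('v \<Rightarrow>\<^sub>L 'v)) tvec \<times> ('m \<times> ('v \<Rightarrow>\<^sub>L 'v)) tvec) set" where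
  "twistor_C M E A \<rho> \<iota> nab z = {(\<lambda>f. X1 f + Y1 f, \<lambda>f. X2 f + Y2 f) | X1 X2 Y1 Y2.
     (X1, X2) \<in> twistor_B M E A \<rho> \<iota> nab z \<and> (Y1, Y2) \<in> vertical_01 M A \<rho> z}"

end

theory Submission
  imports Defs
begin

text \<open>Over a chart, \<open>Z\<close> becomes the set of all \<open>(y, u)\<close> with \<open>|u| = 1\<close>, where \<open>u\<close> stands for the complex
  structure \<open>J\<^sub>u\<close>, and by Hadamard's lemma a derivation is determined by its values on the coordinates.
  Let \<open>\<omega>\<close> and \<open>\<Gamma>\<close> be the connection forms on \<open>E\<close> and \<open>Q\<close>, and for \<open>X = (a, \<eta>)\<close> let \<open>\<zeta> X = \<eta> + \<Gamma> a u\<close> be its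
  vertical part.  Then \<open>X\<^sub>1 + i X\<^sub>2\<close> lies in \<open>\<C>\<close> iff \<open>\<iota> a\<^sub>2 = J\<^sub>u (\<iota> a\<^sub>1)\<close> and \<open>\<zeta> X\<^sub>2 = u \<times> \<zeta> X\<^sub>1\<close>.  Differentiating
  these relations covariantly and antisymmetrising shows that a bracket of sections of \<open>\<C>\<close> satisfies the
  first one because the torsion vanishes, and the second one up to the curvature term
  \<open>[R(X, Y), J\<^sub>u]\<close>, \<open>X\<close> and \<open>Y\<close> in \<open>\<iota>\<^sup>-\<^sup>1(E\<^sup>J)\<close>, projected to the maps from \<open>E\<^sup>J\<close> to its conjugate.  That
  projection has the form \<open>s(X, Y) K\<close> with \<open>K\<close> injective and \<open>s\<close> a complex 2-form on a space of complex dimension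
  \<open>2 k - l\<close>.  The first Bianchi identity yields \<open>s(X, Y) Z + s(Y, Z) X + s(Z, X) Y = 0\<close>, whence \<open>s = 0\<close> if that
  dimension is at least 3; in dimension 1 there is no nonzero 2-form.\<close>


section \<open>Calculus of \<open>C\<^sup>k\<close> functions\<close>

text \<open>Tangent vectors are derivations of global functions, and the axioms on connection and
  torsion speak of global fields and sections, whereas the argument is local. So each local object
  is multiplied by a cutoff equal to 1 near the point, and derivations and \<open>nab\<close> are
  shown to be local. The fibre coordinate \<open>u\<close> runs over all nonzero vectors: functions
  on \<open>Z\<close> are extended constantly along rays, so that ordinary derivatives on an open
  set are available. The radial direction then has to be projected out. The 2-form s and the map K
  never appear. For X = a + i a', Y = b + i b' in the preimage of E^J, where i acts as -J on E^J,
  the operator [R(X, Y), J] is J_h on E^J, with one real vector h orthogonal to \<open>u\<close>.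
  Injectivity of K becomes J_h J_h = -|h|^2. That K is fixed up to a complex factor becomes: J_h J_w
  is a real combination of 1 and J for every w orthogonal to \<open>u\<close>. In complex dimension
  2 the cyclic identity is empty, because its left side is alternating in three dependent vectors;
  this is the excluded case.\<close>

lemma Ck_on_cong:
  assumes "open S" "\<And>x. x \<in> S \<Longrightarrow> f x = g x" "Ck_on k S f"
  shows "Ck_on k S g"
  using assms(2,3)
proof (induction k arbitrary: f g)
  case 0
  then show ?case by (simp cong: continuous_on_cong)
next
  case (Suc k)
  have g': "(g has_derivative frechet_derivative f (at x)) (at x)" if "x \<in> S" for x
    using Suc.prems that assms(1)
    by (intro has_derivative_transform_within_open[of f _ x UNIV S g])
      (auto simp: frechet_derivative_works)
  then have "frechet_derivative g (at x) = frechet_derivative f (at x)" if "x \<in> S" for x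
    using frechet_derivative_at that by metis
  then have "Ck_on k S (\<lambda>x. frechet_derivative g (at x) v)" for v
    using Suc.IH[of "\<lambda>x. frechet_derivative f (at x) v"] Suc.prems by simp
  then show ?case using g' by (auto simp: differentiable_def)
qed

lemma Ck_on_SucI:
  assumes "open S" "\<And>x. x \<in> S \<Longrightarrow> (f has_derivative f' x) (at x)"
    and "\<And>v. Ck_on k S (\<lambda>x. f' x v)"
  shows "Ck_on (Suc k) S f"
proof -
  have "frechet_derivative f (at x) = f' x" if "x \<in> S" for x
    using assms(2)[OF that] frechet_derivative_at by metis
  then have "Ck_on k S (\<lambda>x. frechet_derivative f (at x) v)" for v
    using Ck_on_cong[OF assms(1) _ assms(3)[of v], of "\<lambda>x. frechet_derivative f (at x) v"] by simp
  then show ?thesis using assms(2) by (auto simp: differentiable_def)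
qed

lemma Ck_on_has_derivative:
  "Ck_on (Suc k) S f \<Longrightarrow> x \<in> S \<Longrightarrow> (f has_derivative frechet_derivative f (at x)) (at x)"
  by (simp add: frechet_derivative_works)

lemma Ck_on_frechet_derivative: "Ck_on (Suc k) S f \<Longrightarrow> Ck_on k S (\<lambda>x. frechet_derivative f (at x) v)"
  by simp

lemma Ck_on_SucD: "Ck_on (Suc k) S f \<Longrightarrow> Ck_on k S f"
proof (induction k arbitrary: f)
  case 0
  then show ?case
    by (auto intro!: continuous_at_imp_continuous_on differentiable_imp_continuous_within)
qed auto

lemma Ck_on_le: "Ck_on k S f \<Longrightarrow> j \<le> k \<Longrightarrow> Ck_on j S f"
  by (induction k) (use Ck_on_SucD le_Suc_eq in blast)+

lemma Ck_on_subset: "Ck_on k S f \<Longrightarrow> T \<subseteq> S \<Longrightarrow> Ck_on k T f"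
  by (induction k arbitrary: f) (auto intro: continuous_on_subset)

lemma Ck_on_local:
  assumes "\<And>x. x \<in> S \<Longrightarrow> \<exists>T. open T \<and> x \<in> T \<and> Ck_on k (S \<inter> T) f"
  shows "Ck_on k S f"
  using assms
proof (induction k arbitrary: f)
  case 0
  have "continuous (at x within S) f" if xS: "x \<in> S" for x
  proof -
    obtain T where T: "open T" "x \<in> T" "continuous_on (S \<inter> T) f"
      using 0[OF xS] by auto
    have "at x within S \<inter> T = at x within S"
      using T at_within_nhd[of x T "S \<inter> T" S] by auto
    then show ?thesis using T xS by (metis IntI continuous_on_eq_continuous_within)
  qed
  then show ?case by (simp add: continuous_on_eq_continuous_within)
next
  case (Suc k)
  have "f differentiable (at x)" if "x \<in> S" for x using Suc.prems[OF that] that by auto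
  moreover have "Ck_on k S (\<lambda>x. frechet_derivative f (at x) v)" for v
    using Suc.prems by (intro Suc.IH) fastforce
  ultimately show ?case by simp
qed

lemma Ck_on_const: "open S \<Longrightarrow> Ck_on k S (\<lambda>x. c)"
proof (induction k arbitrary: c)
  case (Suc k)
  then show ?case by (intro Ck_on_SucI[where f' = "\<lambda>x v. 0"]) auto
qed auto

lemma Ck_on_bounded_linear:
  assumes "bounded_linear L" "open S" "Ck_on k S f"
  shows "Ck_on k S (\<lambda>x. L (f x))"
  using assms(3)
proof (induction k arbitrary: f)
  case 0
  then show ?case using assms(1) by (simp add: bounded_linear.continuous_on)
next
  case (Suc k)
  then show ?case
    by (intro Ck_on_SucI[where f' = "\<lambda>x v. L (frechet_derivative f (at x) v)"] assms)
      (auto intro: bounded_linear.has_derivative[OF assms(1)] Ck_on_has_derivative Ck_on_frechet_derivative simp del: Ck_on.simps)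
qed

lemma Ck_on_id: "open S \<Longrightarrow> Ck_on k S (\<lambda>x. x)"
proof (cases k)
  case (Suc j)
  then show "open S \<Longrightarrow> ?thesis"
    by (simp only: Suc) (intro Ck_on_SucI[where f' = "\<lambda>x v. v"] Ck_on_const; auto)
qed auto

lemma Ck_on_add:
  assumes "open S" "Ck_on k S f" "Ck_on k S g"
  shows "Ck_on k S (\<lambda>x. f x + g x)"
  using assms(2,3)
proof (induction k arbitrary: f g)
  case 0
  then show ?case by (simp add: continuous_on_add)
next
  case (Suc k)
  then show ?case
    by (intro Ck_on_SucI[where f' = "\<lambda>x v. frechet_derivative f (at x) v + frechet_derivative g (at x) v"] assms)
      (auto intro!: has_derivative_add Ck_on_has_derivative Ck_on_frechet_derivative simp del: Ck_on.simps)
qed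

lemma Ck_on_sum:
  assumes "open S" "\<And>i. i \<in> I \<Longrightarrow> Ck_on k S (f i)"
  shows "Ck_on k S (\<lambda>x. \<Sum>i\<in>I. f i x)"
  using assms(2)
  by (induction I rule: infinite_finite_induct) (auto intro: Ck_on_const Ck_on_add assms(1))

lemma Ck_on_bilinear:
  assumes "bounded_bilinear B" "open S" "Ck_on k S f" "Ck_on k S g"
  shows "Ck_on k S (\<lambda>x. B (f x) (g x))"
  using assms(3,4)
proof (induction k arbitrary: f g)
  case 0
  then show ?case using bounded_bilinear.continuous_on[OF assms(1)] by simp
next
  case (Suc k)
  have "Ck_on k S f" "Ck_on k S g" using Suc.prems Ck_on_SucD by blast+
  then show ?case using Suc
    by (intro Ck_on_SucI[where f' = "\<lambda>x v. B (f x) (frechet_derivative g (at x) v) + B (frechet_derivative f (at x) v) (g x)"]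
        assms Ck_on_add)
      (auto intro!: bounded_bilinear.FDERIV[OF assms(1)] Ck_on_has_derivative Ck_on_frechet_derivative simp del: Ck_on.simps)
qed

lemma linear_sum_Basis:
  fixes L :: "'a::euclidean_space \<Rightarrow> 'b::real_vector"
  assumes "linear L" shows "L v = (\<Sum>b\<in>Basis. (v \<bullet> b) *\<^sub>R L b)"
  by (metis (no_types, lifting) assms euclidean_representation linear_scale linear_sum sum.cong)

text \<open>The chain rule is written in a basis, so that the derivative becomes a sum of products
  of derivatives of \<open>g\<close> with partial derivatives of \<open>f\<close> composed with the
  same \<open>g\<close>. The induction therefore varies \<open>f\<close> and keeps
  \<open>g\<close>.\<close>

lemma Ck_on_compose:
  assumes "open S" "open T" "Ck_on k T f" "Ck_on k S g" "\<And>x. x \<in> S \<Longrightarrow> g x \<in> T"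
  shows "Ck_on k S (\<lambda>x. f (g x))"
  using assms(3,4)
proof (induction k arbitrary: f)
  case 0
  then show ?case using assms(5) by (auto intro: continuous_on_compose2)
next
  case (Suc k)
  have g: "Ck_on k S g" using Suc.prems Ck_on_SucD by blast
  have lin: "linear (frechet_derivative f (at (g x)))" if "x \<in> S" for x
    using Suc.prems assms(5)[OF that] by (simp add: linear_frechet_derivative)
  have "Ck_on k S (\<lambda>x. \<Sum>b\<in>Basis. (frechet_derivative g (at x) v \<bullet> b) *\<^sub>R frechet_derivative f (at (g x)) b)" for v
    using Suc
    by (intro Ck_on_sum assms Ck_on_bilinear[OF bounded_bilinear_scaleR] Suc.IH g
        Ck_on_bounded_linear[OF bounded_linear_inner_left]) auto
  moreover have "((\<lambda>x. f (g x)) has_derivative (\<lambda>v. \<Sum>b\<in>Basis. (frechet_derivative g (at x) v \<bullet> b) *\<^sub>R frechet_derivative f (at (g x)) b)) (at x)"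
    if "x \<in> S" for x
    using has_derivative_compose[OF Ck_on_has_derivative[OF Suc.prems(2) that]
        Ck_on_has_derivative[OF Suc.prems(1) assms(5)[OF that]]]
    by (subst (asm) linear_sum_Basis[OF lin[OF that]])
  ultimately show ?case by (intro Ck_on_SucI[OF assms(1)])
qed

section \<open>Infinitely differentiable maps\<close>

lemma Cinf_on_cong: "open S \<Longrightarrow> (\<And>x. x \<in> S \<Longrightarrow> f x = g x) \<Longrightarrow> Cinf_on S f \<Longrightarrow> Cinf_on S g"
  unfolding Cinf_on_def using Ck_on_cong by blast

lemma Cinf_on_subset: "Cinf_on S f \<Longrightarrow> T \<subseteq> S \<Longrightarrow> Cinf_on T f"
  unfolding Cinf_on_def using Ck_on_subset by blast

lemma Cinf_on_local:
  "(\<And>x. x \<in> S \<Longrightarrow> \<exists>T. open T \<and> x \<in> T \<and> Cinf_on (S \<inter> T) f) \<Longrightarrow> Cinf_on S f"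
  unfolding Cinf_on_def by (metis Ck_on_local)

lemma Cinf_on_const: "open S \<Longrightarrow> Cinf_on S (\<lambda>x. c)"
  unfolding Cinf_on_def by (simp add: Ck_on_const)

lemma Cinf_on_id: "open S \<Longrightarrow> Cinf_on S (\<lambda>x. x)"
  unfolding Cinf_on_def by (simp add: Ck_on_id)

lemma Cinf_on_bounded_linear: "bounded_linear L \<Longrightarrow> open S \<Longrightarrow> Cinf_on S f \<Longrightarrow> Cinf_on S (\<lambda>x. L (f x))"
  unfolding Cinf_on_def by (simp add: Ck_on_bounded_linear)

lemma Cinf_on_add: "open S \<Longrightarrow> Cinf_on S f \<Longrightarrow> Cinf_on S g \<Longrightarrow> Cinf_on S (\<lambda>x. f x + g x)"
  unfolding Cinf_on_def by (simp add: Ck_on_add)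

lemma Cinf_on_sum: "open S \<Longrightarrow> (\<And>i. i \<in> I \<Longrightarrow> Cinf_on S (f i)) \<Longrightarrow> Cinf_on S (\<lambda>x. \<Sum>i\<in>I. f i x)"
  unfolding Cinf_on_def by (simp add: Ck_on_sum)

lemma Cinf_on_bilinear:
  "bounded_bilinear B \<Longrightarrow> open S \<Longrightarrow> Cinf_on S f \<Longrightarrow> Cinf_on S g \<Longrightarrow> Cinf_on S (\<lambda>x. B (f x) (g x))"
  unfolding Cinf_on_def by (simp add: Ck_on_bilinear)

lemmas Cinf_on_scaleR = Cinf_on_bilinear[OF bounded_bilinear_scaleR]
lemmas Cinf_on_mult = Cinf_on_bilinear[OF bounded_bilinear_mult]
lemmas Cinf_on_inner = Cinf_on_bilinear[OF bounded_bilinear_inner]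

lemma Cinf_on_minus: "open S \<Longrightarrow> Cinf_on S f \<Longrightarrow> Cinf_on S (\<lambda>x. - f x)"
  by (rule Cinf_on_bounded_linear[OF bounded_linear_minus[OF bounded_linear_ident]])

lemma Cinf_on_diff: "open S \<Longrightarrow> Cinf_on S f \<Longrightarrow> Cinf_on S g \<Longrightarrow> Cinf_on S (\<lambda>x. f x - g x)"
  using Cinf_on_add[OF _ _ Cinf_on_minus, of S f g] by simp

lemma Cinf_on_compose:
  "open S \<Longrightarrow> open T \<Longrightarrow> Cinf_on T f \<Longrightarrow> Cinf_on S g \<Longrightarrow> (\<And>x. x \<in> S \<Longrightarrow> g x \<in> T) \<Longrightarrow> Cinf_on S (\<lambda>x. f (g x))"
  unfolding Cinf_on_def using Ck_on_compose by blast

lemma Cinf_on_has_derivative: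
  "Cinf_on S f \<Longrightarrow> x \<in> S \<Longrightarrow> (f has_derivative frechet_derivative f (at x)) (at x)"
  unfolding Cinf_on_def using Ck_on_has_derivative[of 0] by blast

lemma Cinf_on_differentiable: "Cinf_on S f \<Longrightarrow> x \<in> S \<Longrightarrow> f differentiable (at x)"
  using Cinf_on_has_derivative differentiableI by blast

lemma Cinf_on_frechet_derivative: "Cinf_on S f \<Longrightarrow> Cinf_on S (\<lambda>x. frechet_derivative f (at x) v)"
  unfolding Cinf_on_def using Ck_on.simps(2) by blast

lemma Cinf_on_continuous_on: "Cinf_on S f \<Longrightarrow> continuous_on S f"
  unfolding Cinf_on_def using Ck_on.simps(1) by blast

lemma Cinf_on_fst: "open S \<Longrightarrow> Cinf_on S f \<Longrightarrow> Cinf_on S (\<lambda>x. fst (f x))"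
  by (rule Cinf_on_bounded_linear[OF bounded_linear_fst])

lemma Cinf_on_snd: "open S \<Longrightarrow> Cinf_on S f \<Longrightarrow> Cinf_on S (\<lambda>x. snd (f x))"
  by (rule Cinf_on_bounded_linear[OF bounded_linear_snd])

lemma Cinf_on_Pair:
  assumes "open S" "Cinf_on S f" "Cinf_on S g" shows "Cinf_on S (\<lambda>x. (f x, g x))"
proof -
  have "Cinf_on S (\<lambda>x. (f x, 0) + (0, g x))"
    using assms by (intro Cinf_on_add Cinf_on_bounded_linear[of "\<lambda>x. (x, 0)"]
        Cinf_on_bounded_linear[of "\<lambda>x. (0, x)"] bounded_linear_Pair bounded_linear_zero bounded_linear_ident)
  then show ?thesis by simp
qed

text \<open>A family closed under differentiation up to constant coefficients is smooth, by
  induction on the order for all indices at once. It is applied to the powers of \<open>t\<close>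
  and to the flat functions \<open>flat_exp n\<close>.\<close>

lemma has_real_derivative_Cinf_family:
  fixes g :: "'i \<Rightarrow> real \<Rightarrow> real"
  assumes "open S" "\<And>i x. x \<in> S \<Longrightarrow> (g i has_real_derivative (\<Sum>j\<in>N i. c i j * g j x)) (at x)"
  shows "Cinf_on S (g i)"
  unfolding Cinf_on_def
proof
  fix k show "Ck_on k S (g i)"
  proof (induction k arbitrary: i)
    case 0
    have "continuous (at x) (g i)" if "x \<in> S" for x using assms(2)[OF that] DERIV_isCont by blast
    then show ?case by (simp add: continuous_at_imp_continuous_on)
  next
    case (Suc k)
    show ?case
    proof (rule Ck_on_SucI[OF assms(1), where f' = "\<lambda>x v. (\<Sum>j\<in>N i. c i j * g j x) * v"])
      show "(g i has_derivative (*) (\<Sum>j\<in>N i. c i j * g j x)) (at x)" if "x \<in> S" for x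
        using assms(2)[OF that] unfolding has_field_derivative_def .
      show "Ck_on k S (\<lambda>x. (\<Sum>j\<in>N i. c i j * g j x) * v)" for v
        by (intro Ck_on_bilinear[OF bounded_bilinear_mult] Ck_on_sum Ck_on_const assms(1) Suc.IH)
    qed
  qed
qed

lemma Cinf_on_powr: "Cinf_on {0<..} (\<lambda>t::real. t powr a)"
  by (rule has_real_derivative_Cinf_family[where g = "\<lambda>a t. t powr a" and N = "\<lambda>a. {a - 1}" and c = "\<lambda>a b. a"])
    (auto intro!: derivative_eq_intros)

lemma inner_powr_half: "(u \<bullet> u) powr (1/2) = norm u" for u :: "'a::real_inner"
  by (simp add: norm_eq_sqrt_inner powr_half_sqrt)

lemma inner_powr_minus_half: "(u \<bullet> u) powr (-1/2) = inverse (norm u)" for u :: "'a::real_inner"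
  using powr_minus[of "u \<bullet> u" "1/2"] inner_powr_half[of u] by simp

text \<open>The norm is a real power of the inner square, which is smooth and, where
  \<open>f\<close> does not vanish, positive.\<close>

lemma Cinf_on_inverse_norm:
  assumes "open S" "Cinf_on S f" "\<And>x. x \<in> S \<Longrightarrow> f x \<noteq> (0::'b::real_inner)"
  shows "Cinf_on S (\<lambda>x. inverse (norm (f x)))"
  by (rule Cinf_on_cong[OF assms(1) _ Cinf_on_compose[OF assms(1) _ Cinf_on_powr[of "-1/2"]
          Cinf_on_inner[OF assms(1,2,2)]]]) (use assms inner_powr_minus_half in auto)

lemma Cinf_on_normalize:
  assumes "open S" "Cinf_on S f" "\<And>x. x \<in> S \<Longrightarrow> f x \<noteq> (0::'b::real_inner)"
  shows "Cinf_on S (\<lambda>x. f x /\<^sub>R norm (f x))"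
  using assms by (intro Cinf_on_scaleR Cinf_on_inverse_norm)

text \<open>Differentiability is not assumed: \<open>frechet_derivative\<close> chooses from the set
  of all derivatives, and that set is the same for both functions.\<close>

lemma frechet_derivative_cong_open:
  assumes "open S" "x \<in> S" "\<And>y. y \<in> S \<Longrightarrow> f y = g y"
  shows "frechet_derivative f (at x) = frechet_derivative g (at x)"
proof -
  have "\<And>D. (f has_derivative D) (at x) \<longleftrightarrow> (g has_derivative D) (at x)"
    by (rule iffI; erule has_derivative_transform_within_open[OF _ assms(1,2)]) (simp_all add: assms(3))
  then show ?thesis by (simp add: frechet_derivative_def)
qed

lemma frechet_derivative_add_mult:
  fixes f g :: "'e::real_normed_vector \<Rightarrow> real"
  assumes "f differentiable (at x)" "g differentiable (at x)"
  shows "frechet_derivative (\<lambda>y. f y + g y) (at x) a = frechet_derivative f (at x) a + frechet_derivative g (at x) a"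
    and "frechet_derivative (\<lambda>y. f y * g y) (at x) a = f x * frechet_derivative g (at x) a + g x * frechet_derivative f (at x) a"
proof -
  have f: "(f has_derivative frechet_derivative f (at x)) (at x)" and g: "(g has_derivative frechet_derivative g (at x)) (at x)"
    using assms by (auto simp: frechet_derivative_works)
  show "frechet_derivative (\<lambda>y. f y + g y) (at x) a = frechet_derivative f (at x) a + frechet_derivative g (at x) a"
    by (simp add: frechet_derivative_at[OF has_derivative_add[OF f g], symmetric])
  show "frechet_derivative (\<lambda>y. f y * g y) (at x) a = f x * frechet_derivative g (at x) a + g x * frechet_derivative f (at x) a"
    by (simp add: frechet_derivative_at[OF has_derivative_mult[OF f g], symmetric] mult.commute)
qed

section \<open>Symmetry of second derivatives\<close>

lemma second_difference_mean_value:
  fixes f :: "'a::real_normed_vector \<Rightarrow> real"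
  assumes f: "\<And>y. y \<in> ball p e \<Longrightarrow> (f has_derivative f' y) (at y)"
    and g: "\<And>y. y \<in> ball p e \<Longrightarrow> ((\<lambda>x. f' x v) has_derivative g y) (at y)"
    and s: "0 < s" "s * (norm v + norm w) < e"
  shows "\<exists>y\<in>cball p (s * (norm v + norm w)).
    f (p + s *\<^sub>R v + s *\<^sub>R w) - f (p + s *\<^sub>R v) - f (p + s *\<^sub>R w) + f p = s\<^sup>2 * g y w"
proof -
  have in_cball: "p + r *\<^sub>R v + t *\<^sub>R w \<in> cball p (s * (norm v + norm w))"
    if "0 \<le> r" "r \<le> s" "0 \<le> t" "t \<le> s" for r t
  proof -
    have "norm (r *\<^sub>R v + t *\<^sub>R w) \<le> r * norm v + t * norm w"
      using norm_triangle_ineq[of "r *\<^sub>R v" "t *\<^sub>R w"] that by simp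
    also have "\<dots> \<le> s * norm v + s * norm w"
      using that by (intro add_mono mult_right_mono) auto
    finally show ?thesis by (simp add: dist_norm norm_minus_commute algebra_simps)
  qed
  then have inb: "p + r *\<^sub>R v + t *\<^sub>R w \<in> ball p e"
    if "0 \<le> r" "r \<le> s" "0 \<le> t" "t \<le> s" for r t
    using that s(2) by fastforce
  have inb0: "p + r *\<^sub>R v \<in> ball p e" if "0 \<le> r" "r \<le> s" for r
    using inb[OF that, of 0] s by simp
  have lin: "f' y (c *\<^sub>R z) = c * f' y z" "g y (c *\<^sub>R z) = c * g y z" if "y \<in> ball p e" for y c z
    using linear_scale[OF has_derivative_linear[OF f[OF that]]] linear_scale[OF has_derivative_linear[OF g[OF that]]]
    by simp_all
  \<comment> \<open>The second difference is the increment over \<open>{0..s}\<close> of this first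
    difference. The mean value theorem is used once along \<open>v\<close> here and once along
    \<open>w\<close> below.\<close>
  define phi where "phi r = f (p + r *\<^sub>R v + s *\<^sub>R w) - f (p + r *\<^sub>R v)" for r
  have "(phi has_derivative (\<lambda>h. h * (f' (p + r *\<^sub>R v + s *\<^sub>R w) v - f' (p + r *\<^sub>R v) v)))
      (at r within {0..s})" if "0 \<le> r" "r \<le> s" for r
  proof -
    have "((\<lambda>r. f (p + r *\<^sub>R v + s *\<^sub>R w)) has_derivative (\<lambda>h. f' (p + r *\<^sub>R v + s *\<^sub>R w) (h *\<^sub>R v)))
        (at r within {0..s})"
      using f[OF inb] that s by (intro has_derivative_compose[of "\<lambda>r. p + r *\<^sub>R v + s *\<^sub>R w" "\<lambda>h. h *\<^sub>R v" _ _ f])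
        (auto intro!: derivative_eq_intros)
    moreover have "((\<lambda>r. f (p + r *\<^sub>R v)) has_derivative (\<lambda>h. f' (p + r *\<^sub>R v) (h *\<^sub>R v)))
        (at r within {0..s})"
      using f[OF inb0] that s by (intro has_derivative_compose[of "\<lambda>r. p + r *\<^sub>R v" "\<lambda>h. h *\<^sub>R v" _ _ f])
        (auto intro!: derivative_eq_intros)
    ultimately have "(phi has_derivative (\<lambda>h. f' (p + r *\<^sub>R v + s *\<^sub>R w) (h *\<^sub>R v) - f' (p + r *\<^sub>R v) (h *\<^sub>R v)))
        (at r within {0..s})"
      unfolding phi_def by (rule has_derivative_diff)
    then show ?thesis
      using inb[of r s] inb0[of r] that s by (simp add: lin right_diff_distrib)
  qed
  from mvt_simple[OF s(1) this] obtain r where r: "0 < r" "r < s"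
    "phi s - phi 0 = s * (f' (p + r *\<^sub>R v + s *\<^sub>R w) v - f' (p + r *\<^sub>R v) v)" by auto
  define psi where "psi t = f' (p + r *\<^sub>R v + t *\<^sub>R w) v" for t
  have "(psi has_derivative (\<lambda>h. h * g (p + r *\<^sub>R v + t *\<^sub>R w) w)) (at t within {0..s})"
    if "0 \<le> t" "t \<le> s" for t
  proof -
    have "((\<lambda>t. f' (p + r *\<^sub>R v + t *\<^sub>R w) v) has_derivative (\<lambda>h. g (p + r *\<^sub>R v + t *\<^sub>R w) (h *\<^sub>R w)))
        (at t within {0..s})"
      using g[OF inb] that r by (intro has_derivative_compose[of "\<lambda>t. p + r *\<^sub>R v + t *\<^sub>R w" "\<lambda>h. h *\<^sub>R w" _ _ "\<lambda>x. f' x v"])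
        (auto intro!: derivative_eq_intros)
    then show ?thesis unfolding psi_def using inb that r by (simp add: lin)
  qed
  from mvt_simple[OF s(1) this] obtain t where t: "0 < t" "t < s"
    "psi s - psi 0 = s * g (p + r *\<^sub>R v + t *\<^sub>R w) w" by auto
  show ?thesis
    using in_cball[of r t] r t by (auto simp: phi_def psi_def power2_eq_square algebra_simps)
qed

text \<open>The second difference is symmetric in \<open>v\<close> and \<open>w\<close>, so by the
  mean value theorem each mixed derivative, at some point near \<open>p\<close>, equals the same
  number. If they differed at \<open>p\<close>, continuity would keep them apart on a small
  ball.\<close>

lemma frechet_derivative_commute:
  fixes f :: "'a::euclidean_space \<Rightarrow> real"
  assumes "open S" "p \<in> S" "Ck_on 2 S f"
  shows "frechet_derivative (\<lambda>x. frechet_derivative f (at x) v) (at p) w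
       = frechet_derivative (\<lambda>x. frechet_derivative f (at x) w) (at p) v"
proof (rule ccontr)
  let ?D = "\<lambda>x v w. frechet_derivative (\<lambda>x. frechet_derivative f (at x) v) (at x) w"
  assume ne: "\<not> ?thesis"
  define eps where "eps = \<bar>?D p v w - ?D p w v\<bar> / 2"
  have eps: "eps > 0" using ne by (simp add: eps_def)
  have C: "Ck_on (Suc 0) S (\<lambda>x. frechet_derivative f (at x) v)" for v
    using assms(3) by (simp add: numeral_2_eq_2)
  have f1: "(f has_derivative frechet_derivative f (at x)) (at x)" if "x \<in> S" for x
    using assms(3) that Ck_on_has_derivative by (metis numeral_2_eq_2)
  have cont: "continuous_on S (\<lambda>x. ?D x v w)" for v w
    using C[of v] by simp
  let ?U = "(S \<inter> (\<lambda>x. ?D x v w) -` ball (?D p v w) eps) \<inter> (S \<inter> (\<lambda>x. ?D x w v) -` ball (?D p w v) eps)"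
  have "open ?U" "p \<in> ?U"
    using continuous_open_preimage[OF cont assms(1) open_ball] assms(2) eps by auto
  then obtain d where d: "d > 0" "ball p d \<subseteq> ?U"
    using open_contains_ball_eq by blast
  \<comment> \<open>The summand 1 keeps the denominator positive when \<open>v\<close> and
    \<open>w\<close> both vanish, and the half makes the bound strict.\<close>
  define s where "s = d / 2 / (norm v + norm w + 1)"
  have pos: "norm v + norm w + 1 > 0" by (simp add: add_nonneg_pos)
  have s: "s > 0" "s * (norm v + norm w) < d"
    using d(1) pos by (auto simp: s_def field_simps intro!: add_strict_increasing2)
  have s': "s * (norm w + norm v) < d" using s(2) by (simp add: algebra_simps)
  have S: "y \<in> S" "dist (?D y v w) (?D p v w) < eps" "dist (?D y w v) (?D p w v) < eps"
    if "y \<in> ball p d" for y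
    using d(2) that by (auto simp: dist_commute)
  have mv: "\<exists>y\<in>ball p d. f (p + s *\<^sub>R v + s *\<^sub>R w) - f (p + s *\<^sub>R v) - f (p + s *\<^sub>R w) + f p = s\<^sup>2 * ?D y v w"
    if "s * (norm v + norm w) < d" for v w
  proof -
    have "\<exists>y\<in>cball p (s * (norm v + norm w)).
      f (p + s *\<^sub>R v + s *\<^sub>R w) - f (p + s *\<^sub>R v) - f (p + s *\<^sub>R w) + f p = s\<^sup>2 * ?D y v w"
      by (rule second_difference_mean_value[where e = d and f' = "\<lambda>x. frechet_derivative f (at x)"])
        (use f1 S(1) C Ck_on_has_derivative s(1) that in blast)+
    moreover have "cball p (s * (norm v + norm w)) \<subseteq> ball p d" using that by auto
    ultimately show ?thesis by blast
  qed
  obtain y where y: "y \<in> ball p d" "f (p + s *\<^sub>R v + s *\<^sub>R w) - f (p + s *\<^sub>R v) - f (p + s *\<^sub>R w) + f p = s\<^sup>2 * ?D y v w"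
    using mv[OF s(2)] by blast
  obtain z where z: "z \<in> ball p d" "f (p + s *\<^sub>R w + s *\<^sub>R v) - f (p + s *\<^sub>R w) - f (p + s *\<^sub>R v) + f p = s\<^sup>2 * ?D z w v"
    using mv[OF s'] by blast
  have "s\<^sup>2 * ?D y v w = s\<^sup>2 * ?D z w v"
    using y(2) z(2) by (simp add: algebra_simps)
  then have "?D y v w = ?D z w v" using s by simp
  then show False
    using S(2)[OF y(1)] S(3)[OF z(1)] unfolding eps_def dist_real_def by (smt (verit) field_sum_of_halves)
qed

text \<open>Over a finite-dimensional domain an operator is the sum of rank-one operators built from
  its values on a basis, so pointwise smoothness is enough for smoothness in the operator
  norm.\<close>

lemma Cinf_on_blinfunI:
  fixes F :: "'a::euclidean_space \<Rightarrow> ('v::euclidean_space \<Rightarrow>\<^sub>L 'w::real_normed_vector)"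
  assumes "open S" "\<And>v. Cinf_on S (\<lambda>x. blinfun_apply (F x) v)"
  shows "Cinf_on S F"
proof -
  have "Cinf_on S (\<lambda>x. \<Sum>b\<in>Basis. blinfun_scaleR_left (blinfun_apply (F x) b) o\<^sub>L blinfun_inner_right b)"
    by (intro Cinf_on_sum Cinf_on_bilinear[OF bounded_bilinear_blinfun_compose]
        Cinf_on_bounded_linear[OF bounded_linear_blinfun_scaleR_left] Cinf_on_const assms)
  moreover have "(\<Sum>b\<in>Basis. blinfun_scaleR_left (blinfun_apply (F x) b) o\<^sub>L blinfun_inner_right b) = F x" for x
  proof (rule blinfun_eqI)
    fix v
    show "blinfun_apply (\<Sum>b\<in>Basis. blinfun_scaleR_left (blinfun_apply (F x) b) o\<^sub>L blinfun_inner_right b) v = blinfun_apply (F x) v"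
      using linear_sum_Basis[OF bounded_linear.linear[OF blinfun.bounded_linear_right], of "F x" v]
      by (simp add: blinfun.sum_left inner_commute)
  qed
  ultimately show ?thesis by simp
qed

lemma Cinf_on_blinfun_apply:
  "open S \<Longrightarrow> Cinf_on S F \<Longrightarrow> Cinf_on S f \<Longrightarrow> Cinf_on S (\<lambda>x. blinfun_apply (F x) (f x))"
  by (rule Cinf_on_bilinear[OF bounded_bilinear_blinfun_apply])

section \<open>Hadamard's lemma\<close>

lemma Ck_on_radial_integral:
  fixes f :: "'a::euclidean_space \<Rightarrow> real"
  assumes "Ck_on k (ball q r) f"
  shows "Ck_on k (ball q r) (\<lambda>y. integral (cbox 0 1) (\<lambda>t. t ^ m * f (q + t *\<^sub>R (y - q))))"
  using assms
\<comment> \<open>Differentiating under the integral brings out a factor \<open>t\<close>, so the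
  power \<open>m\<close> has to vary in the induction.\<close>
proof (induction k arbitrary: f m)
  have inb: "q + t *\<^sub>R (y - q) \<in> ball q r" if "y \<in> ball q r" "t \<in> cbox 0 1" for y t
  proof -
    have "t * norm (y - q) \<le> norm (y - q)" using that by (auto intro: mult_left_le_one_le)
    then show ?thesis using that by (simp add: dist_norm norm_minus_commute)
  qed
  have cont: "continuous_on (ball q r \<times> cbox 0 1) (\<lambda>(y, t). t ^ m * h (q + t *\<^sub>R (y - q)))"
    if "continuous_on (ball q r) h" for h :: "'a \<Rightarrow> real" and m
    unfolding split_beta
    by (intro continuous_intros continuous_on_compose2[OF that]) (use inb in auto)
  {
    case 0
    then show ?case using integral_continuous_on_param[OF cont] by simp
  next
    case (Suc k)
    let ?f' = "\<lambda>x. frechet_derivative f (at x)"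
    \<comment> \<open>The Leibniz rule asks for a derivative that is a bounded linear map and
      jointly continuous in \<open>y\<close> and \<open>t\<close>; a sum of rank-one maps shows
      both.\<close>
    define fx where "fx y t = (\<Sum>b\<in>Basis. (t ^ Suc m * ?f' (q + t *\<^sub>R (y - q)) b) *\<^sub>R blinfun_inner_right b)"
      for y t
    have fx: "blinfun_apply (fx y t) v = t ^ Suc m * ?f' (q + t *\<^sub>R (y - q)) v"
      if "y \<in> ball q r" "t \<in> cbox 0 1" for y t v
    proof -
      have "linear (?f' (q + t *\<^sub>R (y - q)))"
        using inb[OF that] Suc.prems by (simp add: linear_frechet_derivative)
      from linear_sum_Basis[OF this, of v] show ?thesis
        by (simp add: fx_def blinfun.sum_left blinfun.scaleR_left sum_distrib_left mult_ac inner_commute)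
    qed
    have cont_f': "continuous_on (ball q r) (\<lambda>x. ?f' x v)" for v
      using Ck_on_le[OF Ck_on_frechet_derivative[OF Suc.prems], of 0] by simp
    have cont_fx: "continuous_on (ball q r \<times> cbox 0 1) (\<lambda>(y, t). fx y t)"
    proof -
      have "continuous_on (ball q r \<times> cbox 0 1)
          (\<lambda>z. \<Sum>b\<in>Basis. (case z of (y, t) \<Rightarrow> t ^ Suc m * ?f' (q + t *\<^sub>R (y - q)) b) *\<^sub>R blinfun_inner_right b)"
        by (intro continuous_on_sum continuous_on_scaleR cont[OF cont_f'] continuous_on_const)
      then show ?thesis by (simp add: fx_def split_beta)
    qed
    have "((\<lambda>y. integral (cbox 0 1) (\<lambda>t. t ^ m * f (q + t *\<^sub>R (y - q)))) has_derivative
        blinfun_apply (integral (cbox 0 1) (fx y))) (at y within ball q r)" if "y \<in> ball q r" for y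
    proof (rule leibniz_rule[OF _ _ cont_fx that convex_ball])
      fix x t assume xt: "x \<in> ball q r" "t \<in> cbox 0 (1::real)"
      have "((\<lambda>x. f (q + t *\<^sub>R (x - q))) has_derivative (\<lambda>v. ?f' (q + t *\<^sub>R (x - q)) (t *\<^sub>R v))) (at x within ball q r)"
        by (rule has_derivative_compose[of "\<lambda>x. q + t *\<^sub>R (x - q)" _ _ _ f, OF _ Ck_on_has_derivative[OF Suc.prems inb[OF xt]]])
          (auto intro!: derivative_eq_intros)
      moreover have "?f' (q + t *\<^sub>R (x - q)) (t *\<^sub>R v) = t * ?f' (q + t *\<^sub>R (x - q)) v" for v
        using inb[OF xt] Suc.prems by (simp add: linear_frechet_derivative linear_scale)
      ultimately show "((\<lambda>x. t ^ m * f (q + t *\<^sub>R (x - q))) has_derivative blinfun_apply (fx x t)) (at x within ball q r)"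
        by (auto intro!: derivative_eq_intros simp: fx[OF xt] fun_eq_iff)
    next
      fix x assume x: "x \<in> ball q r"
      have "continuous_on (cbox 0 1) (\<lambda>t. t ^ m * f (q + t *\<^sub>R (x - q)))"
        by (intro continuous_intros continuous_on_compose2[OF Ck_on_le[OF Suc.prems, of 0, simplified]])
          (use inb[OF x] in auto)
      then show "(\<lambda>t. t ^ m * f (q + t *\<^sub>R (x - q))) integrable_on cbox 0 1"
        by (rule integrable_continuous)
    qed
    note der_within = this
    have der: "((\<lambda>y. integral (cbox 0 1) (\<lambda>t. t ^ m * f (q + t *\<^sub>R (y - q)))) has_derivative
        blinfun_apply (integral (cbox 0 1) (fx y))) (at y)" if "y \<in> ball q r" for y
      using der_within[OF that] by (simp only: at_within_open[OF that open_ball])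
    have eq: "blinfun_apply (integral (cbox 0 1) (fx y)) v
        = integral (cbox 0 1) (\<lambda>t. t ^ Suc m * ?f' (q + t *\<^sub>R (y - q)) v)" if "y \<in> ball q r" for y v
    proof -
      have "continuous_on (cbox 0 1) (fx y)"
        using continuous_on_compose2[OF cont_fx continuous_on_Pair[OF continuous_on_const continuous_on_id],
            of y "cbox 0 1"] that by (auto simp: image_subset_iff)
      then show ?thesis
        by (subst blinfun_apply_integral[OF integrable_continuous])
          (auto intro!: integral_cong simp: fx[OF that])
    qed
    show ?case
    proof (rule Ck_on_SucI[OF open_ball der])
      show "Ck_on k (ball q r) (\<lambda>x. blinfun_apply (integral (cbox 0 1) (fx x)) v)" for v
        by (rule Ck_on_cong[OF open_ball _ Suc.IH[of "\<lambda>x. ?f' x v" "Suc m"]])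
          (use eq Suc.prems in auto)
    qed
  }
qed

lemma Hadamard:
  fixes h :: "'a::euclidean_space \<Rightarrow> real"
  assumes "Cinf_on (ball q r) h" "r > 0"
  obtains g where "\<And>b. Cinf_on (ball q r) (g b)" "\<And>b. g b q = frechet_derivative h (at q) b"
    "\<And>y. y \<in> ball q r \<Longrightarrow> h y = h q + (\<Sum>b\<in>Basis. ((y - q) \<bullet> b) * g b y)"
proof
  \<comment> \<open>The mean of a partial derivative over the segment from \<open>q\<close> to
    \<open>y\<close>. The factor \<open>t ^ 0\<close> only matches the shape of
    \<open>Ck_on_radial_integral\<close>.\<close>
  let ?g = "\<lambda>b y. integral (cbox 0 1) (\<lambda>t. t ^ 0 * frechet_derivative h (at (q + t *\<^sub>R (y - q))) b)"
  show "Cinf_on (ball q r) (?g b)" for b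
    using Cinf_on_frechet_derivative[OF assms(1)] Ck_on_radial_integral unfolding Cinf_on_def by blast
  show "?g b q = frechet_derivative h (at q) b" for b by simp
  fix y assume y: "y \<in> ball q r"
  have inb: "q + t *\<^sub>R (y - q) \<in> ball q r" if "t \<in> cbox 0 1" for t
  proof -
    have "t * norm (y - q) \<le> norm (y - q)" using that by (auto intro: mult_left_le_one_le)
    then show ?thesis using that y by (simp add: dist_norm norm_minus_commute)
  qed
  let ?h' = "\<lambda>t. frechet_derivative h (at (q + t *\<^sub>R (y - q)))"
  have h': "?h' t (y - q) = (\<Sum>b\<in>Basis. ((y - q) \<bullet> b) * ?h' t b)" if "t \<in> cbox 0 1" for t
    using linear_sum_Basis[OF linear_frechet_derivative, of h "at (q + t *\<^sub>R (y - q))" "y - q"]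
      Cinf_on_differentiable[OF assms(1) inb[OF that]] by simp
  have "((\<lambda>t. h (q + t *\<^sub>R (y - q))) has_vector_derivative ?h' t (y - q)) (at t within {0..1})"
    if t: "t \<in> {0..1}" for t
  proof -
    have "((\<lambda>t. h (q + t *\<^sub>R (y - q))) has_derivative (\<lambda>s. ?h' t (s *\<^sub>R (y - q)))) (at t within {0..1})"
      by (rule has_derivative_compose[of "\<lambda>t. q + t *\<^sub>R (y - q)" _ _ _ h, OF _ Cinf_on_has_derivative[OF assms(1)]])
        (use inb t in \<open>auto intro!: derivative_eq_intros\<close>)
    moreover have "?h' t (s *\<^sub>R (y - q)) = s *\<^sub>R ?h' t (y - q)" for s
      using Cinf_on_differentiable[OF assms(1) inb] t by (simp add: linear_frechet_derivative linear_scale)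
    ultimately show ?thesis by (simp add: has_vector_derivative_def)
  qed
  from fundamental_theorem_of_calculus[OF _ this]
  have "((\<lambda>t. ?h' t (y - q)) has_integral (h y - h q)) (cbox 0 1)" by simp
  then have "h y - h q = integral (cbox 0 1) (\<lambda>t. ?h' t (y - q))" by (simp add: integral_unique)
  also have "\<dots> = integral (cbox 0 1) (\<lambda>t. \<Sum>b\<in>Basis. ((y - q) \<bullet> b) * ?h' t b)"
    by (rule integral_cong) (rule h')
  also have "\<dots> = (\<Sum>b\<in>Basis. integral (cbox 0 1) (\<lambda>t. ((y - q) \<bullet> b) * ?h' t b))"
  proof (rule integral_sum[OF finite_Basis])
    fix b
    have "continuous_on (cbox 0 1) (\<lambda>t. ((y - q) \<bullet> b) * ?h' t b)"
      by (intro continuous_intros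
          continuous_on_compose2[OF Cinf_on_continuous_on[OF Cinf_on_frechet_derivative[OF assms(1)]]])
        (use inb in auto)
    then show "(\<lambda>t. ((y - q) \<bullet> b) * ?h' t b) integrable_on cbox 0 1"
      by (rule integrable_continuous)
  qed
  finally show "h y = h q + (\<Sum>b\<in>Basis. ((y - q) \<bullet> b) * ?g b y)"
    by (simp only: integral_mult_right power_0 mult_1_left)
qed

section \<open>Cutoff functions\<close>

definition flat_exp :: "nat \<Rightarrow> real \<Rightarrow> real" where
  "flat_exp n t = (if t > 0 then exp (- (1 / t)) / t ^ n else 0)"

lemma flat_exp_tendsto: "((flat_exp n) \<longlongrightarrow> 0) (at 0)"
proof -
  have "((\<lambda>x. x ^ n / exp x) \<longlongrightarrow> (0::real)) at_top" by (rule tendsto_power_div_exp_0)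
  then have "((\<lambda>t. (inverse t) ^ n / exp (inverse t)) \<longlongrightarrow> (0::real)) (at_right 0)"
    by (rule filterlim_compose[OF _ filterlim_inverse_at_top_right])
  then have "(flat_exp n \<longlongrightarrow> 0) (at_right 0)"
    by (rule Lim_transform_eventually)
      (auto simp: eventually_at_filter flat_exp_def exp_minus field_simps)
  moreover have "(flat_exp n \<longlongrightarrow> 0) (at_left 0)"
    by (rule Lim_transform_eventually[OF tendsto_const]) (auto simp: eventually_at_filter flat_exp_def)
  ultimately show ?thesis by (simp add: filterlim_split_at)
qed

text \<open>The powers of \<open>t\<close> in the denominator make the family closed under
  differentiation, which is what \<open>has_real_derivative_Cinf_family\<close> wants.\<close>

lemma flat_exp_has_derivative:
  "(flat_exp n has_real_derivative (\<Sum>j\<in>{Suc n, n + 2}. (if j = Suc n then - real n else 1) * flat_exp j t)) (at t)"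
proof -
  consider "t > 0" | "t = 0" | "t < 0" by linarith
  then have "(flat_exp n has_real_derivative (flat_exp (n + 2) t - n * flat_exp (Suc n) t)) (at t)"
  proof cases
    case 1
    have "((\<lambda>t. exp (- (1 / t)) / t ^ n) has_real_derivative (flat_exp (n + 2) t - n * flat_exp (Suc n) t)) (at t)"
    proof -
      have "t ^ n = t * t ^ (n - Suc 0)" if "n > 0"
        using that by (cases n) auto
      then show ?thesis using 1
        by (cases "n = 0")
          (auto intro!: derivative_eq_intros simp: flat_exp_def divide_simps power2_eq_square power_add algebra_simps)
    qed
    then show ?thesis
      by (rule has_field_derivative_transform_within_open[of _ _ _ "{0<..}"]) (use 1 in \<open>auto simp: flat_exp_def\<close>)
  next
    case 2
    \<comment> \<open>At 0 the difference quotient of one flat function is the next one, which tends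
      to 0.\<close>
    have "((\<lambda>h. flat_exp n h / h) \<longlongrightarrow> 0) (at 0)"
      by (rule Lim_transform_eventually[OF flat_exp_tendsto[of "Suc n"]])
        (auto simp: eventually_at_filter flat_exp_def field_simps)
    then show ?thesis using 2 by (simp add: DERIV_def flat_exp_def cong: if_cong)
  next
    case 3
    have "((\<lambda>t. 0) has_real_derivative (flat_exp (n + 2) t - n * flat_exp (Suc n) t)) (at t)"
      using 3 by (simp add: flat_exp_def)
    then show ?thesis
      by (rule has_field_derivative_transform_within_open[of _ _ _ "{..<0}"]) (use 3 in \<open>auto simp: flat_exp_def\<close>)
  qed
  then show ?thesis by (simp add: algebra_simps)
qed

lemma Cinf_on_flat_exp: "Cinf_on UNIV (flat_exp n)"
  by (rule has_real_derivative_Cinf_family[OF open_UNIV flat_exp_has_derivative])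

text \<open>The denominator is always positive, since \<open>t\<close> or \<open>1 - t\<close> is.
  Writing the quotient with \<open>powr\<close> reduces smoothness to that of real powers.\<close>

definition smooth_step :: "real \<Rightarrow> real" where
  "smooth_step t = flat_exp 0 t * (flat_exp 0 t + flat_exp 0 (1 - t)) powr (- 1)"

lemma flat_exp_0: "flat_exp 0 t \<ge> 0" "t > 0 \<Longrightarrow> flat_exp 0 t > 0" "t \<le> 0 \<Longrightarrow> flat_exp 0 t = 0"
  by (auto simp: flat_exp_def)

lemma smooth_step_eq: "t \<le> 0 \<Longrightarrow> smooth_step t = 0" "t \<ge> 1 \<Longrightarrow> smooth_step t = 1"
  using flat_exp_0(2)[of t] by (auto simp: smooth_step_def flat_exp_0(3) powr_minus_divide)

lemma Cinf_on_smooth_step: "Cinf_on UNIV smooth_step"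
proof -
  have pos: "flat_exp 0 t + flat_exp 0 (1 - t) > 0" for t
    using flat_exp_0(1,2)[of t] flat_exp_0(1,2)[of "1 - t"] by (cases "t > 0") auto
  have "Cinf_on UNIV (\<lambda>t. flat_exp 0 t * (flat_exp 0 t + flat_exp 0 (1 - t)) powr (- 1))"
    by (intro Cinf_on_mult Cinf_on_flat_exp open_UNIV Cinf_on_compose[OF _ _ Cinf_on_powr] Cinf_on_add
        Cinf_on_compose[OF _ _ Cinf_on_flat_exp] Cinf_on_diff Cinf_on_const Cinf_on_id) (use pos in auto)
  then show ?thesis by (simp add: smooth_step_def[abs_def])
qed

text \<open>The argument of \<open>smooth_step\<close> is at least 1 exactly when \<open>y\<close>
  is within distance \<open>r\<close> of \<open>q\<close>, and at most 0 exactly when the distance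
  is at least \<open>2 * r\<close>.\<close>

definition bump :: "'a::euclidean_space \<Rightarrow> real \<Rightarrow> 'a \<Rightarrow> real" where
  "bump q r y = smooth_step ((4 * r\<^sup>2 - (y - q) \<bullet> (y - q)) / (3 * r\<^sup>2))"

lemma Cinf_on_bump: "Cinf_on UNIV (bump q r)"
proof -
  have "Cinf_on UNIV (\<lambda>y. smooth_step ((4 * r\<^sup>2 - (y - q) \<bullet> (y - q)) * (1 / (3 * r\<^sup>2))))"
    by (intro Cinf_on_compose[OF _ _ Cinf_on_smooth_step] Cinf_on_mult Cinf_on_diff Cinf_on_const Cinf_on_inner
        Cinf_on_id open_UNIV) auto
  then show ?thesis by (simp add: bump_def[abs_def])
qed

lemma bump_eq_1: assumes "r > 0" "y \<in> cball q r" shows "bump q r y = 1"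
proof -
  have "(norm (y - q))\<^sup>2 \<le> r\<^sup>2" using assms by (intro power_mono) (auto simp: dist_norm norm_minus_commute)
  then show ?thesis using assms unfolding bump_def
    by (intro smooth_step_eq) (simp add: field_simps power2_norm_eq_inner)
qed

lemma bump_eq_0: assumes "r > 0" "y \<notin> ball q (2 * r)" shows "bump q r y = 0"
proof -
  have "(2 * r)\<^sup>2 \<le> (norm (y - q))\<^sup>2" using assms by (intro power_mono) (auto simp: dist_norm norm_minus_commute)
  then show ?thesis using assms unfolding bump_def
    by (intro smooth_step_eq) (simp add: field_simps power2_norm_eq_inner)
qed

section \<open>Derivations\<close>

text \<open>Extension by zero is smooth: \<open>S\<close> and the complement of the closed ball of
  radius \<open>2 * s\<close> are open and cover the space, and on the latter the function
  vanishes.\<close>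

lemma Cinf_on_cutoff:
  fixes g :: "'a::euclidean_space \<Rightarrow> 'b::real_normed_vector"
  assumes "open S" "Cinf_on S g" "s > 0" "cball q (2 * s) \<subseteq> S"
  shows "Cinf_on UNIV (\<lambda>y. bump q s y *\<^sub>R (if y \<in> S then g y else 0))"
proof (rule Cinf_on_local)
  fix x :: 'a
  show "\<exists>T. open T \<and> x \<in> T \<and> Cinf_on (UNIV \<inter> T) (\<lambda>y. bump q s y *\<^sub>R (if y \<in> S then g y else 0))"
  proof (cases "x \<in> S")
    case True
    have "Cinf_on S (\<lambda>y. bump q s y *\<^sub>R (if y \<in> S then g y else 0))"
      by (rule Cinf_on_cong[OF assms(1) _ Cinf_on_scaleR[OF assms(1) Cinf_on_subset[OF Cinf_on_bump] assms(2)]]) auto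
    then show ?thesis using True assms(1) by auto
  next
    case False
    have "Cinf_on (- cball q (2 * s)) (\<lambda>y. bump q s y *\<^sub>R (if y \<in> S then g y else 0))"
      by (rule Cinf_on_cong[OF _ _ Cinf_on_const[of _ 0]]) (use bump_eq_0[OF assms(3), of _ q] in auto)
    moreover have "x \<in> - cball q (2 * s)" using False assms(4) by auto
    ultimately show ?thesis
      by (intro exI[of _ "- cball q (2 * s)"]) (simp add: open_Compl)
  qed
qed

text \<open>Treats functions on \<open>M\<close>, where \<open>N\<close> is the whole type, and
  functions on \<open>Z\<close>, a proper subset of its type, together. For the latter, membership
  depends on the values on \<open>N\<close> alone, hence \<open>F_cong\<close>.\<close>

locale function_algebra =
  fixes F :: "('a \<Rightarrow> real) set" and N :: "'a set"
  assumes F_const: "(\<lambda>_. c) \<in> F"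
    and F_add: "f \<in> F \<Longrightarrow> g \<in> F \<Longrightarrow> (\<lambda>z. f z + g z) \<in> F"
    and F_mult: "f \<in> F \<Longrightarrow> g \<in> F \<Longrightarrow> (\<lambda>z. f z * g z) \<in> F"
    and F_cong: "f \<in> F \<Longrightarrow> (\<And>z. z \<in> N \<Longrightarrow> f z = g z) \<Longrightarrow> g \<in> F"
begin

lemma F_cmult: "f \<in> F \<Longrightarrow> (\<lambda>z. c * f z) \<in> F"
  by (rule F_mult[OF F_const])

lemma F_diff: "f \<in> F \<Longrightarrow> g \<in> F \<Longrightarrow> (\<lambda>z. f z - g z) \<in> F"
  using F_add[OF _ F_cmult[of g "-1"]] by simp

lemma F_sum: "(\<And>i. i \<in> I \<Longrightarrow> f i \<in> F) \<Longrightarrow> (\<lambda>z. \<Sum>i\<in>I. f i z) \<in> F"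
  by (induction I rule: infinite_finite_induct) (auto intro: F_const F_add)

context
  fixes p X assumes X: "X \<in> tangent_space F p"
begin

lemma tangent_add: "f \<in> F \<Longrightarrow> g \<in> F \<Longrightarrow> X (\<lambda>q. f q + g q) = X f + X g"
  and tangent_cmult: "f \<in> F \<Longrightarrow> X (\<lambda>q. c * f q) = c * X f"
  and tangent_mult: "f \<in> F \<Longrightarrow> g \<in> F \<Longrightarrow> X (\<lambda>q. f q * g q) = f p * X g + g p * X f"
  and tangent_outside: "f \<notin> F \<Longrightarrow> X f = 0"
  using X by (auto simp: tangent_space_def)

lemma tangent_const: "X (\<lambda>_. c) = 0"
  using tangent_mult[OF F_const[of 1] F_const[of 1]] tangent_cmult[OF F_const[of 1], of c] by simp

lemma tangent_diff: "f \<in> F \<Longrightarrow> g \<in> F \<Longrightarrow> X (\<lambda>q. f q - g q) = X f - X g"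
  using tangent_add[OF _ F_cmult[of g "-1"]] tangent_cmult[of g "-1"] by simp

lemma tangent_sum: "finite I \<Longrightarrow> (\<And>i. i \<in> I \<Longrightarrow> f i \<in> F) \<Longrightarrow> X (\<lambda>q. \<Sum>i\<in>I. f i q) = (\<Sum>i\<in>I. X (f i))"
  by (induction I rule: finite_induct) (auto simp: tangent_const tangent_add F_sum)

lemma tangent_cong:
  assumes "p \<in> N" "f \<in> F" "\<And>z. z \<in> N \<Longrightarrow> f z = g z"
  shows "X f = X g"
proof -
  let ?i = "\<lambda>z. if z \<in> N then 0 else 1 :: real"
  have g: "g \<in> F" using F_cong assms by blast
  have i: "?i \<in> F" by (rule F_cong[OF F_const[of 0]]) simp
  \<comment> \<open>Both factors vanish at \<open>p\<close>, so the Leibniz rule gives 0; the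
    indicator lies in \<open>F\<close> because it agrees with 0 on \<open>N\<close>.\<close>
  have "(\<lambda>z. f z - g z) = (\<lambda>z. (f z - g z) * ?i z)" using assms(3) by (auto simp: fun_eq_iff)
  then have "X (\<lambda>z. f z - g z) = X (\<lambda>z. (f z - g z) * ?i z)" by simp
  also have "\<dots> = 0" using assms by (subst tangent_mult[OF F_diff[OF assms(2) g] i]) simp
  finally show ?thesis using tangent_diff[OF assms(2) g] by simp
qed

text \<open>Multiplying the Hadamard expansion of \<open>h\<close> twice by a cutoff function gives an identity between
  global functions to which the Leibniz rule applies.\<close>

lemma tangent_formula:
  fixes c :: "'a \<Rightarrow> 'e::euclidean_space" and C :: "'e \<Rightarrow> 'a \<Rightarrow> real"
  assumes p: "p \<in> S" "open D" "c p \<in> D"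
    and ext: "\<And>h s. Cinf_on UNIV h \<Longrightarrow> s > 0 \<Longrightarrow> cball (c p) s \<subseteq> D \<Longrightarrow> (\<And>y. y \<notin> ball (c p) s \<Longrightarrow> h y = 0)
      \<Longrightarrow> (\<lambda>z. if z \<in> S then h (c z) else 0) \<in> F"
    and C: "\<And>b. b \<in> Basis \<Longrightarrow> C b \<in> F" "\<And>b z. b \<in> Basis \<Longrightarrow> z \<in> S \<Longrightarrow> c z \<in> D \<Longrightarrow> C b z = c z \<bullet> b"
    and f: "f \<in> F" "Cinf_on D h" "\<And>z. z \<in> S \<Longrightarrow> c z \<in> D \<Longrightarrow> f z = h (c z)"
  shows "X f = frechet_derivative h (at (c p)) (\<Sum>b\<in>Basis. X (C b) *\<^sub>R b)"
proof -
  let ?q = "c p"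
  obtain r where r: "r > 0" "cball ?q r \<subseteq> D" using p open_contains_cball by blast
  \<comment> \<open>The bump lives in a ball of radius \<open>2 * s\<close>, which has to stay
    inside the ball of radius \<open>r\<close> where the expansion holds.\<close>
  define s where "s = r / 3"
  have s: "s > 0" "2 * s < r" using r by (auto simp: s_def)
  have sb: "cball ?q (2 * s) \<subseteq> ball ?q r" using s by auto
  have sD: "cball ?q (2 * s) \<subseteq> D" using sb r(2) ball_subset_cball by blast
  have "Cinf_on (ball ?q r) h" by (rule Cinf_on_subset[OF f(2)]) (use r(2) in auto)
  from Hadamard[OF this r(1)] obtain g where g: "\<And>b. Cinf_on (ball ?q r) (g b)"
    "\<And>b. g b ?q = frechet_derivative h (at ?q) b"
    "\<And>y. y \<in> ball ?q r \<Longrightarrow> h y = h ?q + (\<Sum>b\<in>Basis. ((y - ?q) \<bullet> b) * g b y)" by blast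
  define k where "k z = (if z \<in> S then bump ?q s (c z) else 0)" for z
  define G where "G b z = (if z \<in> S then bump ?q s (c z) *\<^sub>R (if c z \<in> ball ?q r then g b (c z) else 0) else 0)" for b z
  have k: "k \<in> F" unfolding k_def
    by (rule ext[OF Cinf_on_bump _ sD]) (use s bump_eq_0[OF s(1)] in auto)
  have G: "G b \<in> F" for b unfolding G_def
    by (rule ext[OF Cinf_on_cutoff[OF open_ball g(1) s(1) sb] _ sD]) (use s bump_eq_0[OF s(1)] in auto)
  have kp: "k p = 1" "G b p = g b ?q" for b
    using p(1) s r bump_eq_1[OF s(1), of ?q ?q] by (auto simp: k_def G_def)
  \<comment> \<open>\<open>g b\<close> is defined near \<open>c p\<close> only and needs one cutoff
    factor of its own, contained in \<open>G b\<close>; the second factor localises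
    \<open>C b\<close>.\<close>
  have id: "k z * (k z * f z) = h ?q * (k z * k z) + (\<Sum>b\<in>Basis. (k z * G b z) * (C b z - ?q \<bullet> b))" for z
  proof (cases "z \<in> S \<and> c z \<in> ball ?q r")
    case True
    then have D: "c z \<in> D" using r(2) ball_subset_cball by blast
    have "f z = h ?q + (\<Sum>b\<in>Basis. ((c z - ?q) \<bullet> b) * g b (c z))"
      using True f(3)[OF _ D] g(3)[of "c z"] by simp
    then have "k z * (k z * f z) = h ?q * (k z * k z) + (\<Sum>b\<in>Basis. k z * (k z * g b (c z)) * (c z \<bullet> b - ?q \<bullet> b))"
      by (simp add: algebra_simps sum_distrib_left inner_diff_left)
    also have "(\<Sum>b\<in>Basis. k z * (k z * g b (c z)) * (c z \<bullet> b - ?q \<bullet> b)) = (\<Sum>b\<in>Basis. (k z * G b z) * (C b z - ?q \<bullet> b))"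
      using True D by (intro sum.cong) (auto simp: C(2) G_def k_def)
    finally show ?thesis .
  next
    case False
    then have "k z = 0" "G b z = 0" for b using sb bump_eq_0[OF s(1), of "c z" ?q] s(2) by (auto simp: k_def G_def)
    then show ?thesis by simp
  qed
  have Cp: "C b p = ?q \<bullet> b" if "b \<in> Basis" for b using C(2) that p by blast
  have XC: "X (\<lambda>z. C b z - ?q \<bullet> b) = X (C b)" if "b \<in> Basis" for b
    using tangent_diff[OF C(1)[OF that] F_const[of "?q \<bullet> b"]] tangent_const by simp
  have CF: "(\<lambda>z. C b z - ?q \<bullet> b) \<in> F" if "b \<in> Basis" for b
    by (rule F_diff[OF C(1)[OF that] F_const])
  \<comment> \<open>The value of \<open>X\<close> on the cutoff is unknown. It occurs with
    coefficient \<open>2 * f p\<close> here and \<open>2 * h ?q\<close> below, and these agree, so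
    it drops out.\<close>
  have "X (\<lambda>z. k z * (k z * f z)) = X f + 2 * f p * X k"
    by (simp add: tangent_mult k f F_mult kp)
  moreover have "X (\<lambda>z. k z * (k z * f z)) = 2 * h ?q * X k + (\<Sum>b\<in>Basis. g b ?q * X (C b))"
  proof -
    have "X (\<lambda>z. \<Sum>b\<in>Basis. (k z * G b z) * (C b z - ?q \<bullet> b)) = (\<Sum>b\<in>Basis. X (\<lambda>z. (k z * G b z) * (C b z - ?q \<bullet> b)))"
      by (rule tangent_sum) (auto intro!: F_mult k G CF)
    also have "\<dots> = (\<Sum>b\<in>Basis. g b ?q * X (C b))"
      by (rule sum.cong[OF refl]) (simp add: tangent_mult F_mult k G CF kp Cp XC)
    finally have *: "X (\<lambda>z. \<Sum>b\<in>Basis. (k z * G b z) * (C b z - ?q \<bullet> b)) = (\<Sum>b\<in>Basis. g b ?q * X (C b))" .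
    have SF: "(\<lambda>z. \<Sum>b\<in>Basis. (k z * G b z) * (C b z - ?q \<bullet> b)) \<in> F"
      by (intro F_sum F_mult k G CF)
    show ?thesis unfolding id
      by (subst tangent_add[OF F_cmult[OF F_mult[OF k k]] SF])
        (simp add: * tangent_cmult tangent_mult F_mult k kp)
  qed
  moreover have "f p = h ?q" using f(3) p by blast
  ultimately have "X f = (\<Sum>b\<in>Basis. g b ?q * X (C b))" by simp
  also have "\<dots> = frechet_derivative h (at ?q) (\<Sum>b\<in>Basis. X (C b) *\<^sub>R b)"
    using linear_frechet_derivative[OF Cinf_on_differentiable[OF f(2) p(3)]]
    by (simp add: linear_sum linear_scale g(2) mult.commute)
  finally show ?thesis .
qed

end

lemma tangent_space_lincomb:
  assumes "X \<in> tangent_space F p" "Y \<in> tangent_space F p"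
  shows "(\<lambda>f. a * X f + b * Y f) \<in> tangent_space F p"
  unfolding tangent_space_def
  using assms
  by (auto simp: tangent_add tangent_cmult tangent_mult tangent_outside algebra_simps)

text \<open>Each of the two compositions of \<open>X\<close> and \<open>Y\<close> violates the
  Leibniz rule by the same cross terms, symmetric in \<open>X\<close> and \<open>Y\<close>, which
  cancel in the difference. \<open>P\<close> and \<open>R\<close> below stand for either field, so
  that each rule is proved for both orders.\<close>

lemma bracket_vector_fields:
  assumes X: "X \<in> vector_fields F N" and Y: "Y \<in> vector_fields F N"
  shows "bracket F X Y \<in> vector_fields F N"
proof -
  have XT: "X p \<in> tangent_space F p" and YT: "Y p \<in> tangent_space F p" if "p \<in> N" for p
    using X Y that by (auto simp: vector_fields_def)
  have XF: "(\<lambda>p. X p f) \<in> F" and YF: "(\<lambda>p. Y p f) \<in> F" if "f \<in> F" for f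
    using X Y that by (auto simp: vector_fields_def)
  have "bracket F X Y p \<in> tangent_space F p" if p: "p \<in> N" for p
  proof -
    have add: "P p (\<lambda>q. R q (\<lambda>z. f z + g z)) = P p (\<lambda>q. R q f) + P p (\<lambda>q. R q g)"
      if "P \<in> {X, Y}" "R \<in> {X, Y}" "f \<in> F" "g \<in> F" for P R f g
    proof -
      have P: "P p \<in> tangent_space F p" and R: "\<And>f. f \<in> F \<Longrightarrow> (\<lambda>q. R q f) \<in> F"
        and RT: "\<And>z. z \<in> N \<Longrightarrow> R z \<in> tangent_space F z"
        using that XT YT p XF YF by auto
      \<comment> \<open>Additivity of \<open>R q\<close> is known only for \<open>q\<close> in
        \<open>N\<close>, so the two arguments of \<open>P p\<close> may differ elsewhere;
        \<open>tangent_cong\<close> bridges this.\<close>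
      have "P p (\<lambda>q. R q f + R q g) = P p (\<lambda>q. R q (\<lambda>z. f z + g z))"
        by (rule tangent_cong[OF P p]) (simp_all add: tangent_add[OF RT] F_add R that)
      then show ?thesis by (simp add: tangent_add[OF P] R that)
    qed
    have cmult: "P p (\<lambda>q. R q (\<lambda>z. c * f z)) = c * P p (\<lambda>q. R q f)"
      if "P \<in> {X, Y}" "R \<in> {X, Y}" "f \<in> F" for P R f c
    proof -
      have P: "P p \<in> tangent_space F p" and R: "\<And>f. f \<in> F \<Longrightarrow> (\<lambda>q. R q f) \<in> F"
        and RT: "\<And>z. z \<in> N \<Longrightarrow> R z \<in> tangent_space F z"
        using that XT YT p XF YF by auto
      have "P p (\<lambda>q. c * R q f) = P p (\<lambda>q. R q (\<lambda>z. c * f z))"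
        by (rule tangent_cong[OF P p]) (simp_all add: tangent_cmult[OF RT] F_cmult R that)
      then show ?thesis by (simp add: tangent_cmult[OF P] R that)
    qed
    have mult: "P p (\<lambda>q. R q (\<lambda>z. f z * g z))
        = f p * P p (\<lambda>q. R q g) + R p g * P p f + (g p * P p (\<lambda>q. R q f) + R p f * P p g)"
      if "P \<in> {X, Y}" "R \<in> {X, Y}" "f \<in> F" "g \<in> F" for P R f g
    proof -
      have P: "P p \<in> tangent_space F p" and R: "\<And>f. f \<in> F \<Longrightarrow> (\<lambda>q. R q f) \<in> F"
        and RT: "\<And>z. z \<in> N \<Longrightarrow> R z \<in> tangent_space F z"
        using that XT YT p XF YF by auto
      have "P p (\<lambda>q. f q * R q g + g q * R q f) = P p (\<lambda>q. R q (\<lambda>z. f z * g z))"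
        by (rule tangent_cong[OF P p]) (simp_all add: tangent_mult[OF RT] F_mult F_add R that)
      moreover have "P p (\<lambda>q. f q * R q g + g q * R q f)
          = f p * P p (\<lambda>q. R q g) + R p g * P p f + (g p * P p (\<lambda>q. R q f) + R p f * P p g)"
        by (simp add: tangent_add[OF P] tangent_mult[OF P] that R F_mult)
      ultimately show ?thesis by simp
    qed
    show ?thesis
      unfolding tangent_space_def bracket_def
      by (auto simp: add cmult mult F_add F_cmult F_mult algebra_simps)
  qed
  moreover have "(\<lambda>p. bracket F X Y p f) \<in> F" if "f \<in> F" for f
    using F_diff XF YF that by (simp add: bracket_def)
  ultimately show ?thesis by (simp add: vector_fields_def)
qed

end

section \<open>Smooth functions and coordinates on a manifold\<close>

locale mfd =
  fixes M :: "('m::{t2_space, second_countable_topology}, 'n::euclidean_space) atlas"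
  assumes M: "smooth_manifold M"
begin

lemma chart:
  assumes "(U, \<phi>) \<in> M"
  shows open_chart: "open U" and open_chart_image: "open (\<phi> ` U)"
    and chart_homeomorphism: "homeomorphism U (\<phi> ` U) \<phi> (inv_into U \<phi>)"
  using M assms by (auto simp: smooth_manifold_def)

lemma chart_inv [simp]:
  assumes "(U, \<phi>) \<in> M"
  shows "x \<in> U \<Longrightarrow> inv_into U \<phi> (\<phi> x) = x" and "y \<in> \<phi> ` U \<Longrightarrow> \<phi> (inv_into U \<phi> y) = y"
    and "y \<in> \<phi> ` U \<Longrightarrow> inv_into U \<phi> y \<in> U"
  using chart_homeomorphism[OF assms] by (auto simp: homeomorphism_def inv_into_into)

lemma chart_cover: "\<exists>U \<phi>. (U, \<phi>) \<in> M \<and> x \<in> U"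
proof -
  have "x \<in> (\<Union>(U, \<phi>)\<in>M. U)" using M by (simp add: smooth_manifold_def)
  then show ?thesis by blast
qed

lemma chart_inj: "(U, \<phi>) \<in> M \<Longrightarrow> inj_on \<phi> U"
  by (metis chart_inv(1) inj_onI)

lemma open_chart_image_Int:
  assumes "(U, \<phi>) \<in> M" "open S" shows "open (\<phi> ` (U \<inter> S))"
proof -
  have "continuous_on (\<phi> ` U) (inv_into U \<phi>)"
    using chart_homeomorphism[OF assms(1)] by (simp add: homeomorphism_def)
  then have "open (\<phi> ` U \<inter> inv_into U \<phi> -` S)"
    using continuous_open_preimage open_chart_image assms by blast
  moreover have "\<phi> ` U \<inter> inv_into U \<phi> -` S = \<phi> ` (U \<inter> S)"
    using chart_inv[OF assms(1)] by force
  ultimately show ?thesis by simp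
qed

lemma smooth_mapD: "smooth_map M S f \<Longrightarrow> (U, \<phi>) \<in> M \<Longrightarrow> Cinf_on (\<phi> ` (U \<inter> S)) (\<lambda>y. f (inv_into U \<phi> y))"
  by (auto simp: smooth_map_def o_def)

lemma smooth_mapI:
  "(\<And>U \<phi>. (U, \<phi>) \<in> M \<Longrightarrow> Cinf_on (\<phi> ` (U \<inter> S)) (\<lambda>y. f (inv_into U \<phi> y))) \<Longrightarrow> smooth_map M S f"
  by (auto simp: smooth_map_def o_def)

lemma smooth_map_subset: "smooth_map M S f \<Longrightarrow> T \<subseteq> S \<Longrightarrow> smooth_map M T f"
  by (rule smooth_mapI) (erule Cinf_on_subset[OF smooth_mapD], auto)

lemma smooth_map_cong:
  assumes "open S" "\<And>x. x \<in> S \<Longrightarrow> f x = g x" "smooth_map M S f"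
  shows "smooth_map M S g"
proof (rule smooth_mapI)
  fix U \<phi> assume U: "(U, \<phi>) \<in> M"
  show "Cinf_on (\<phi> ` (U \<inter> S)) (\<lambda>y. g (inv_into U \<phi> y))"
    by (rule Cinf_on_cong[OF open_chart_image_Int[OF U assms(1)] _ smooth_mapD[OF assms(3) U]])
      (use U assms(2) in auto)
qed

lemma smooth_map_local:
  assumes "\<And>x. x \<in> S \<Longrightarrow> \<exists>T. open T \<and> x \<in> T \<and> smooth_map M (S \<inter> T) f"
  shows "smooth_map M S f"
proof (rule smooth_mapI, rule Cinf_on_local)
  fix U \<phi> y assume U: "(U, \<phi>) \<in> M" and y: "y \<in> \<phi> ` (U \<inter> S)"
  then obtain x T where x: "x \<in> U" "x \<in> S" "y = \<phi> x" "open T" "x \<in> T" "smooth_map M (S \<inter> T) f"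
    using assms by blast
  have "\<phi> ` (U \<inter> S) \<inter> \<phi> ` (U \<inter> T) = \<phi> ` (U \<inter> (S \<inter> T))"
    using chart_inj[OF U] by (auto simp: inj_on_def)
  then show "\<exists>T. open T \<and> y \<in> T \<and> Cinf_on (\<phi> ` (U \<inter> S) \<inter> T) (\<lambda>y. f (inv_into U \<phi> y))"
    using smooth_mapD[OF x(6) U] open_chart_image_Int[OF U x(4)] x by (intro exI[of _ "\<phi> ` (U \<inter> T)"]) auto
qed

lemma smooth_map_const: "open S \<Longrightarrow> smooth_map M S (\<lambda>_. c)"
  by (rule smooth_mapI) (intro Cinf_on_const open_chart_image_Int)

lemma smooth_map_compose:
  assumes "open S" "open T" "Cinf_on T h" "smooth_map M S f" "\<And>x. x \<in> S \<Longrightarrow> f x \<in> T"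
  shows "smooth_map M S (\<lambda>x. h (f x))"
proof (rule smooth_mapI)
  fix U \<phi> assume U: "(U, \<phi>) \<in> M"
  show "Cinf_on (\<phi> ` (U \<inter> S)) (\<lambda>y. h (f (inv_into U \<phi> y)))"
    by (rule Cinf_on_compose[OF open_chart_image_Int[OF U assms(1)] assms(2,3) smooth_mapD[OF assms(4) U]])
      (use U assms(5) in auto)
qed

lemma smooth_map_bounded_linear: "bounded_linear L \<Longrightarrow> open S \<Longrightarrow> smooth_map M S f \<Longrightarrow> smooth_map M S (\<lambda>x. L (f x))"
  by (rule smooth_mapI) (erule Cinf_on_bounded_linear, erule open_chart_image_Int, assumption, erule smooth_mapD)

lemma smooth_map_bilinear:
  "bounded_bilinear B \<Longrightarrow> open S \<Longrightarrow> smooth_map M S f \<Longrightarrow> smooth_map M S g \<Longrightarrow> smooth_map M S (\<lambda>x. B (f x) (g x))"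
  by (rule smooth_mapI) (intro Cinf_on_bilinear[of B] open_chart_image_Int smooth_mapD)

lemmas smooth_map_scaleR = smooth_map_bilinear[OF bounded_bilinear_scaleR]

lemma smooth_map_add:
  "open S \<Longrightarrow> smooth_map M S f \<Longrightarrow> smooth_map M S g \<Longrightarrow> smooth_map M S (\<lambda>x. f x + g x)"
  by (rule smooth_mapI) (intro Cinf_on_add open_chart_image_Int smooth_mapD)

lemma smooth_map_sum:
  "open S \<Longrightarrow> (\<And>i. i \<in> I \<Longrightarrow> smooth_map M S (f i)) \<Longrightarrow> smooth_map M S (\<lambda>x. \<Sum>i\<in>I. f i x)"
  by (rule smooth_mapI) (intro Cinf_on_sum open_chart_image_Int smooth_mapD)

lemma smooth_map_chart: "(U, \<phi>) \<in> M \<Longrightarrow> smooth_map M U \<phi>"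
  using M unfolding smooth_manifold_def smooth_map_def by fast

lemma smooth_map_of_chart:
  assumes "(U, \<phi>) \<in> M" "open S" "S \<subseteq> U" "Cinf_on (\<phi> ` S) h"
  shows "smooth_map M S (\<lambda>x. h (\<phi> x))"
proof -
  have "open (\<phi> ` S)" using open_chart_image_Int[OF assms(1,2)] assms(3) by (simp add: Int_absorb1)
  then show ?thesis
    by (rule smooth_map_compose[OF assms(2) _ assms(4) smooth_map_subset[OF smooth_map_chart[OF assms(1)] assms(3)]]) simp
qed

abbreviation FM :: "('m \<Rightarrow> real) set" where "FM \<equiv> smooth_functions M"

lemma FM_iff: "f \<in> FM \<longleftrightarrow> smooth_map M UNIV f"
  by (simp add: smooth_functions_def)

sublocale FM: function_algebra "smooth_functions M" UNIV
proof
  show "(\<lambda>z. f z * g z) \<in> FM" if "f \<in> FM" "g \<in> FM" for f g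
    using smooth_map_bilinear[OF bounded_bilinear_mult open_UNIV] that by (simp add: FM_iff)
qed (auto simp: FM_iff smooth_map_const smooth_map_add, metis ext)

lemma FM_chart: "f \<in> FM \<Longrightarrow> (U, \<phi>) \<in> M \<Longrightarrow> Cinf_on (\<phi> ` U) (\<lambda>y. f (inv_into U \<phi> y))"
  using smooth_mapD[of UNIV f U \<phi>] by (simp add: FM_iff)

text \<open>The coordinate vector \<open>a\<close> as a derivation, set to 0 off the smooth
  functions because \<open>tangent_space\<close> demands it.\<close>

definition tanv :: "'m set \<Rightarrow> ('m \<Rightarrow> 'n) \<Rightarrow> 'm \<Rightarrow> 'n \<Rightarrow> 'm tvec" where
  "tanv U \<phi> x a = (\<lambda>f. if f \<in> FM then frechet_derivative (\<lambda>y. f (inv_into U \<phi> y)) (at (\<phi> x)) a else 0)"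

lemma tanv_tangent: "(U, \<phi>) \<in> M \<Longrightarrow> x \<in> U \<Longrightarrow> tanv U \<phi> x a \<in> tangent_space FM x"
  unfolding tangent_space_def tanv_def
  by (auto simp: FM.F_add FM.F_mult FM.F_cmult
      frechet_derivative_add_mult[OF Cinf_on_differentiable[OF FM_chart] Cinf_on_differentiable[OF FM_chart]]
      frechet_derivative_add_mult(2)[OF differentiable_const Cinf_on_differentiable[OF FM_chart]])

end

text \<open>The ball of twice the radius leaves room for a cutoff \<open>\<kappa>\<close> that is 1
  over the inner ball \<open>B\<close> and supported inside \<open>V\<close>. The set
  \<open>V\<close> may be smaller than the chart domain, since bundle trivialisations will have to
  exist over it.\<close>

locale mfd_chart = mfd M for M :: "('m::{t2_space, second_countable_topology}, 'n::euclidean_space) atlas" +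
  fixes U :: "'m set" and \<phi> :: "'m \<Rightarrow> 'n" and V :: "'m set" and y0 :: 'n and r :: real
  assumes U: "(U, \<phi>) \<in> M" and V: "open V" "V \<subseteq> U" and r: "r > 0" "cball y0 (2 * r) \<subseteq> \<phi> ` V"
begin

definition \<psi> :: "'n \<Rightarrow> 'm" where "\<psi> = inv_into U \<phi>"

definition B :: "'n set" where "B = ball y0 r"

definition N1 :: "'m set" where "N1 = \<psi> ` B"

definition \<kappa> :: "'m \<Rightarrow> real" where "\<kappa> x = (if x \<in> V then bump y0 r (\<phi> x) else 0)"

lemma open_B [simp]: "open B" by (simp add: B_def)

lemma \<psi>_\<phi> [simp]: "x \<in> U \<Longrightarrow> \<psi> (\<phi> x) = x" and \<phi>_\<psi> [simp]: "y \<in> \<phi> ` U \<Longrightarrow> \<phi> (\<psi> y) = y"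
  using U by (auto simp: \<psi>_def)

lemma B_subset: "B \<subseteq> \<phi> ` V"
  using r unfolding B_def by (intro subset_trans[OF _ r(2)] subsetI) auto

lemma N1_iff: "x \<in> N1 \<longleftrightarrow> x \<in> V \<and> \<phi> x \<in> B"
proof -
  have "\<psi> y \<in> V \<and> \<phi> (\<psi> y) \<in> B" if "y \<in> B" for y
    using that B_subset V(2) by fastforce
  then show ?thesis using V(2) by (force simp: N1_def image_iff)
qed

lemma N1_D: "x \<in> N1 \<Longrightarrow> x \<in> V" "x \<in> N1 \<Longrightarrow> x \<in> U" "x \<in> N1 \<Longrightarrow> \<phi> x \<in> B"
  using N1_iff V(2) by auto

lemma \<psi>_B [simp]: "y \<in> B \<Longrightarrow> \<psi> y \<in> N1" "y \<in> B \<Longrightarrow> \<phi> (\<psi> y) = y" "y \<in> B \<Longrightarrow> \<psi> y \<in> V" "y \<in> B \<Longrightarrow> \<psi> y \<in> U"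
proof -
  have *: "\<exists>x\<in>V. y = \<phi> x" if "y \<in> B" for y using that B_subset by blast
  show "y \<in> B \<Longrightarrow> \<psi> y \<in> N1" "y \<in> B \<Longrightarrow> \<phi> (\<psi> y) = y" "y \<in> B \<Longrightarrow> \<psi> y \<in> V" "y \<in> B \<Longrightarrow> \<psi> y \<in> U"
    using *[of y] V(2) by (auto simp: N1_def)
qed

lemma continuous_on_\<psi>: "continuous_on (\<phi> ` U) \<psi>" and continuous_on_\<phi>: "continuous_on U \<phi>"
  using chart_homeomorphism[OF U] by (auto simp: homeomorphism_def \<psi>_def)

lemma open_N1 [simp]: "open N1"
proof -
  have "N1 = V \<inter> \<phi> -` B" using N1_iff by auto
  then show ?thesis
    using continuous_open_preimage[OF continuous_on_subset[OF continuous_on_\<phi> V(2)] V(1) open_B] by simp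
qed

lemma \<kappa>_1: "x \<in> N1 \<Longrightarrow> \<kappa> x = 1"
  using N1_iff bump_eq_1[OF r(1), of "\<phi> x" y0] by (auto simp: \<kappa>_def B_def)

lemma \<kappa>_0: "x \<notin> V \<Longrightarrow> \<kappa> x = 0" by (simp add: \<kappa>_def)

lemma smooth_\<kappa>_V: "smooth_map M V \<kappa>"
proof -
  have "smooth_map M V (\<lambda>x. bump y0 r (\<phi> x))"
    by (rule smooth_map_of_chart[OF U V]) (rule Cinf_on_subset[OF Cinf_on_bump], simp)
  then show ?thesis by (rule smooth_map_cong[OF V(1), rotated]) (simp add: \<kappa>_def)
qed

lemma \<kappa>_support: obtains K where "closed K" "K \<subseteq> V" "\<And>z. z \<notin> K \<Longrightarrow> \<kappa> z = 0"
proof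
  let ?K = "\<psi> ` cball y0 (2 * r)"
  show "?K \<subseteq> V" using r(2) V(2) by force
  have "cball y0 (2 * r) \<subseteq> \<phi> ` U" using r(2) V(2) by auto
  then have "compact ?K"
    by (intro compact_continuous_image[OF continuous_on_subset[OF continuous_on_\<psi>]]) auto
  \<comment> \<open>Here the Hausdorff property is used. Compactness in the chart yields closedness
    in \<open>M\<close>, so that extending by zero across the boundary of \<open>V\<close> is
    smooth.\<close>
  then show "closed ?K" by (rule compact_imp_closed)
  fix z assume z: "z \<notin> ?K"
  show "\<kappa> z = 0"
  proof (cases "z \<in> V")
    case True
    then have "\<phi> z \<notin> ball y0 (2 * r)" using z V(2) \<psi>_\<phi>[of z] by (metis ball_subset_cball image_eqI subsetD)
    then show ?thesis using bump_eq_0[OF r(1), of "\<phi> z" y0] by (simp add: \<kappa>_def)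
  qed (simp add: \<kappa>_def)
qed

lemma smooth_cutoff:
  assumes "open S" "smooth_map M (S \<inter> V) f"
  shows "smooth_map M S (\<lambda>x. \<kappa> x *\<^sub>R f x)"
proof (rule smooth_map_local)
  fix x assume x: "x \<in> S"
  show "\<exists>T. open T \<and> x \<in> T \<and> smooth_map M (S \<inter> T) (\<lambda>x. \<kappa> x *\<^sub>R f x)"
  proof (cases "x \<in> V")
    case True
    then show ?thesis
      using assms V(1) smooth_\<kappa>_V
      by (intro exI[of _ V]) (auto intro!: smooth_map_scaleR intro: smooth_map_subset)
  next
    case False
    obtain K where K: "closed K" "K \<subseteq> V" "\<And>z. z \<notin> K \<Longrightarrow> \<kappa> z = 0" using \<kappa>_support by metis
    then have "open (- K)" by auto
    then have "smooth_map M (S \<inter> - K) (\<lambda>x. \<kappa> x *\<^sub>R f x)"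
      using assms(1) by (intro smooth_map_cong[OF _ _ smooth_map_const[of _ 0]]) (auto simp: open_Int K(3))
    then show ?thesis using False K(2) \<open>open (- K)\<close> by (intro exI[of _ "- K"]) auto
  qed
qed

lemma \<kappa>_FM: "\<kappa> \<in> FM"
  using smooth_cutoff[OF open_UNIV smooth_map_const[of _ "1::real"]] V(1) by (simp add: FM_iff)

lemma cutoff_FM: "smooth_map M V f \<Longrightarrow> (\<lambda>x. \<kappa> x * f x) \<in> FM"
  using smooth_cutoff[of UNIV f] by (simp add: FM_iff)

section \<open>Coordinates of tangent vectors on the base\<close>

definition coordM :: "'n \<Rightarrow> 'm \<Rightarrow> real" where "coordM b x = \<kappa> x * (\<phi> x \<bullet> b)"

definition vecM :: "'m tvec \<Rightarrow> 'n" where "vecM v = (\<Sum>b\<in>Basis. v (coordM b) *\<^sub>R b)"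

lemma smooth_coord: "smooth_map M V (\<lambda>x. \<phi> x \<bullet> b)"
  by (rule smooth_map_bounded_linear[OF bounded_linear_inner_left V(1) smooth_map_subset[OF smooth_map_chart[OF U] V(2)]])

lemma coordM_FM: "coordM b \<in> FM"
  unfolding coordM_def[abs_def] by (rule cutoff_FM[OF smooth_coord])

lemma tangent_formula_M:
  assumes x: "x \<in> N1" and v: "v \<in> tangent_space FM x"
    and f: "f \<in> FM" "Cinf_on B h" "\<And>z. z \<in> N1 \<Longrightarrow> f z = h (\<phi> z)"
  shows "v f = frechet_derivative h (at (\<phi> x)) (vecM v)"
  unfolding vecM_def
proof (rule FM.tangent_formula[OF v, where S = V and D = B])
  show "x \<in> V" "open B" "\<phi> x \<in> B" using x N1_D by auto
  show "(\<lambda>z. if z \<in> V then h (\<phi> z) else 0) \<in> FM" 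
    if h: "Cinf_on UNIV h" "cball (\<phi> x) s \<subseteq> B" "\<And>y. y \<notin> ball (\<phi> x) s \<Longrightarrow> h y = 0" for h s
  proof -
    \<comment> \<open>Where \<open>h\<close> is nonzero, the point lies in \<open>N1\<close> and
      \<open>\<kappa>\<close> is 1. The extra factor thus changes nothing and makes the extension by
      zero smooth.\<close>
    have "(\<lambda>z. if z \<in> V then h (\<phi> z) else 0) = (\<lambda>z. \<kappa> z * (if z \<in> V then h (\<phi> z) else 0))"
    proof
      fix z show "(if z \<in> V then h (\<phi> z) else 0) = \<kappa> z * (if z \<in> V then h (\<phi> z) else 0)"
        using h(2) h(3)[of "\<phi> z"] \<kappa>_1[of z] N1_iff[of z] by (cases "\<phi> z \<in> ball (\<phi> x) s") auto
    qed
    moreover have "smooth_map M V (\<lambda>z. h (\<phi> z))"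
      by (rule smooth_map_of_chart[OF U V Cinf_on_subset[OF h(1)]]) simp
    then have "smooth_map M V (\<lambda>z. if z \<in> V then h (\<phi> z) else 0)"
      by (rule smooth_map_cong[OF V(1), rotated]) simp
    ultimately show ?thesis using cutoff_FM[of "\<lambda>z. if z \<in> V then h (\<phi> z) else 0"] by simp
  qed
  show "coordM b z = \<phi> z \<bullet> b" if "z \<in> V" "\<phi> z \<in> B" for b z
    using that N1_iff \<kappa>_1 by (simp add: coordM_def)
qed (use f N1_iff coordM_FM in auto)

lemma Cinf_on_FM: "f \<in> FM \<Longrightarrow> Cinf_on B (\<lambda>y. f (\<psi> y))"
  unfolding \<psi>_def by (rule Cinf_on_subset[OF FM_chart[OF _ U]]) (use B_subset V(2) in auto)

abbreviation tv :: "'m \<Rightarrow> 'n \<Rightarrow> 'm tvec" where "tv \<equiv> tanv U \<phi>"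

lemma tv_apply: "f \<in> FM \<Longrightarrow> tv x a f = frechet_derivative (\<lambda>y. f (\<psi> y)) (at (\<phi> x)) a"
  by (simp add: tanv_def \<psi>_def)

lemma tv_vecM:
  assumes "x \<in> N1" "v \<in> tangent_space FM x" shows "tv x (vecM v) = v"
proof
  fix f show "tv x (vecM v) f = v f"
  proof (cases "f \<in> FM")
    case True
    show ?thesis using tangent_formula_M[OF assms True Cinf_on_FM[OF True]] tv_apply[OF True] N1_D by simp
  qed (use FM.tangent_outside[OF assms(2)] in \<open>simp add: tanv_def\<close>)
qed

lemma tangent_tv [simp]: "x \<in> N1 \<Longrightarrow> tv x a \<in> tangent_space FM x"
  by (rule tanv_tangent[OF U]) (simp add: N1_D)

lemma vecM_tv: assumes "x \<in> N1" shows "vecM (tv x a) = a"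
proof -
  have "tv x a (coordM b) = a \<bullet> b" for b
  proof -
    have "frechet_derivative (\<lambda>y. coordM b (\<psi> y)) (at (\<phi> x)) = frechet_derivative (\<lambda>y. y \<bullet> b) (at (\<phi> x))"
      by (rule frechet_derivative_cong_open[OF open_B]) (use assms N1_D in \<open>auto simp: coordM_def \<kappa>_1\<close>)
    also have "\<dots> = (\<lambda>y. y \<bullet> b)"
      by (rule frechet_derivative_at[symmetric]) (auto intro!: derivative_eq_intros)
    finally show ?thesis by (simp add: tv_apply[OF coordM_FM])
  qed
  then show ?thesis by (simp add: vecM_def euclidean_representation)
qed

lemma tangent_cong_near:
  assumes "x \<in> N1" "v \<in> tangent_space FM x" "f \<in> FM" "g \<in> FM" "\<forall>\<^sub>F y in nhds x. f y = g y"
  shows "v f = v g"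
proof -
  obtain T where T: "open T" "x \<in> T" "\<And>y. y \<in> T \<Longrightarrow> f y = g y"
    using assms(5) by (auto simp: eventually_nhds)
  have "frechet_derivative (\<lambda>y. f (\<psi> y)) (at (\<phi> x)) = frechet_derivative (\<lambda>y. g (\<psi> y)) (at (\<phi> x))"
  proof (rule frechet_derivative_cong_open[OF open_chart_image_Int[OF U T(1)]])
    show "\<phi> x \<in> \<phi> ` (U \<inter> T)" using T assms(1) N1_D by auto
    show "f (\<psi> y) = g (\<psi> y)" if "y \<in> \<phi> ` (U \<inter> T)" for y using that T(3) by auto
  qed
  then show ?thesis
    using tv_apply[OF assms(3), of x "vecM v"] tv_apply[OF assms(4), of x "vecM v"]
    by (simp add: tv_vecM[OF assms(1,2)])
qed

text \<open>Torsion and smoothness of the connection are stated for global vector fields, so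
  coordinate fields are cut off; over \<open>N1\<close> nothing changes.\<close>

definition coord_field :: "'n \<Rightarrow> 'm \<Rightarrow> 'm tvec" where
  "coord_field a x = (\<lambda>f. \<kappa> x * tv x a f)"

lemma coord_field_N1: "x \<in> N1 \<Longrightarrow> coord_field a x = tv x a"
  by (simp add: coord_field_def \<kappa>_1)

lemma coord_field_vector_field: "coord_field a \<in> vector_fields FM UNIV"
proof -
  have "coord_field a x \<in> tangent_space FM x" for x
  proof (cases "x \<in> V")
    case True
    then have "tv x a \<in> tangent_space FM x" using tanv_tangent[OF U] V(2) by blast
    from FM.tangent_space_lincomb[OF this this, of "\<kappa> x" 0] show ?thesis by (simp add: coord_field_def)
  next
    case False
    then show ?thesis by (simp add: coord_field_def \<kappa>_0 tangent_space_def)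
  qed
  moreover have "(\<lambda>x. coord_field a x f) \<in> FM" if f: "f \<in> FM" for f
  proof -
    have "smooth_map M V (\<lambda>x. frechet_derivative (\<lambda>y. f (\<psi> y)) (at (\<phi> x)) a)"
      by (rule smooth_map_of_chart[OF U V Cinf_on_frechet_derivative[OF Cinf_on_subset[OF FM_chart[OF f U, folded \<psi>_def]]]])
        (use V(2) in auto)
    from cutoff_FM[OF this] show ?thesis by (simp add: coord_field_def tv_apply[OF f])
  qed
  ultimately show ?thesis by (simp add: vector_fields_def)
qed

text \<open>Over \<open>N1\<close> a coordinate field has constant derivatives on the coordinate
  functions, so the bracket kills those, and a tangent vector is determined by its values on
  them.\<close>

lemma coord_field_bracket:
  assumes "x \<in> N1" shows "bracket FM (coord_field a) (coord_field b) x = (\<lambda>_. 0)"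
proof -
  have tan: "bracket FM (coord_field a) (coord_field b) x \<in> tangent_space FM x"
    using FM.bracket_vector_fields[OF coord_field_vector_field[of a] coord_field_vector_field[of b]]
    by (simp add: vector_fields_def)
  have const: "coord_field a x (\<lambda>q. coord_field b q (coordM e)) = 0" for a b e
  proof -
    have "(\<lambda>q. coord_field b q (coordM e)) \<in> FM"
      using coord_field_vector_field[of b] coordM_FM by (simp add: vector_fields_def)
    moreover have "tv q b (coordM e) = b \<bullet> e" if "q \<in> N1" for q
    proof -
      have "frechet_derivative (\<lambda>y. coordM e (\<psi> y)) (at (\<phi> q)) = frechet_derivative (\<lambda>y. y \<bullet> e) (at (\<phi> q))"
        by (rule frechet_derivative_cong_open[OF open_B]) (use that N1_D in \<open>auto simp: coordM_def \<kappa>_1\<close>)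
      also have "\<dots> = (\<lambda>y. y \<bullet> e)"
        by (rule frechet_derivative_at[symmetric]) (auto intro!: derivative_eq_intros)
      finally show ?thesis by (simp add: tv_apply[OF coordM_FM])
    qed
    ultimately have "tv x a (\<lambda>q. coord_field b q (coordM e)) = tv x a (\<lambda>q. b \<bullet> e)"
      using assms by (intro tangent_cong_near[OF assms] FM.F_const)
        (auto simp: coord_field_N1 intro!: eventually_nhds_in_open eventually_mono[OF eventually_nhds_in_open[OF open_N1 assms]])
    then show ?thesis using FM.tangent_const[OF tangent_tv[OF assms]] assms by (simp add: coord_field_N1)
  qed
  have "vecM (bracket FM (coord_field a) (coord_field b) x) = 0"
    by (simp add: vecM_def bracket_def coordM_FM const)
  then have "bracket FM (coord_field a) (coord_field b) x = tv x 0" using tv_vecM[OF assms tan] by simp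
  also have "\<dots> = (\<lambda>_. 0)"
    using assms N1_D by (auto simp: tanv_def fun_eq_iff \<psi>_def[symmetric]
       intro!: linear_0 linear_frechet_derivative Cinf_on_differentiable[OF Cinf_on_FM])
  finally show ?thesis .
qed

end

lemma (in mfd) mfd_chart_exists:
  assumes "(U, \<phi>) \<in> M" "x \<in> U" "open S" "x \<in> S"
  obtains r where "r > 0" "mfd_chart M U \<phi> (U \<inter> S) (\<phi> x) r"
proof -
  have "open (\<phi> ` (U \<inter> S))" "\<phi> x \<in> \<phi> ` (U \<inter> S)" using open_chart_image_Int assms by auto
  then obtain e where e: "e > 0" "cball (\<phi> x) e \<subseteq> \<phi> ` (U \<inter> S)" using open_contains_cball by blast
  then have "mfd_chart M U \<phi> (U \<inter> S) (\<phi> x) (e / 2)"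
    using assms open_chart[OF assms(1)] by unfold_locales auto
  then show ?thesis using that[of "e / 2"] e by simp
qed

text \<open>The last clause is how the cutoff is used: whatever is smooth over \<open>T\<close>
  extends by zero after multiplication with \<open>k\<close>.\<close>

lemma (in mfd) cutoff_exists:
  assumes "open T" "x \<in> T"
  obtains k T' where "k \<in> FM" "open T'" "x \<in> T'" "T' \<subseteq> T" "\<And>y. y \<in> T' \<Longrightarrow> k y = 1" "\<And>y. y \<notin> T \<Longrightarrow> k y = 0"
    "\<And>S (f :: 'm \<Rightarrow> 'b::real_normed_vector). open S \<Longrightarrow> smooth_map M (S \<inter> T) f \<Longrightarrow> smooth_map M S (\<lambda>x. k x *\<^sub>R f x)"
proof -
  obtain U \<phi> where Ux: "(U, \<phi>) \<in> M" "x \<in> U" using chart_cover by blast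
  obtain r where r: "r > 0" "mfd_chart M U \<phi> (U \<inter> T) (\<phi> x) r" using mfd_chart_exists[OF Ux assms] by blast
  interpret mfd_chart M U \<phi> "U \<inter> T" "\<phi> x" r by (rule r)
  show ?thesis
  proof (rule that[OF \<kappa>_FM open_N1])
    show "x \<in> N1" using Ux(2) assms(2) r(1) by (simp add: N1_iff B_def)
    show "smooth_map M S (\<lambda>x. \<kappa> x *\<^sub>R f x)" if "open S" "smooth_map M (S \<inter> T) f"
      for S and f :: "'m \<Rightarrow> 'b"
      by (rule smooth_cutoff[OF that(1)]) (rule smooth_map_subset[OF that(2)], auto)
  qed (use N1_D \<kappa>_1 \<kappa>_0 in auto)
qed

section \<open>Quaternions\<close>

lemma linear_inv_bij:
  assumes "linear f" "bij f" shows "linear (inv f)"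
proof (rule linearI)
  have f: "f (inv f x) = x" for x using assms(2) by (simp add: bij_is_surj surj_f_inv_f)
  have g: "inv f (f x) = x" for x using assms(2) by (simp add: bij_is_inj)
  show "inv f (x + y) = inv f x + inv f y" for x y
    using g[of "inv f x + inv f y"] by (simp add: linear_add[OF assms(1)] f)
  show "inv f (c *\<^sub>R x) = c *\<^sub>R inv f x" for c x
    using g[of "c *\<^sub>R inv f x"] by (simp add: linear_scale[OF assms(1)] f)
qed

lemma quat_Aut_D:
  assumes "\<sigma> \<in> quat_Aut"
  shows quat_Aut_linear: "linear \<sigma>" and quat_Aut_bij: "bij \<sigma>"
    and quat_Aut_mult: "\<sigma> (quat_mult a b) = quat_mult (\<sigma> a) (\<sigma> b)"
  using assms unfolding quat_Aut_def by blast+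

lemma quat_Aut_inv:
  assumes "\<sigma> \<in> quat_Aut" shows "inv \<sigma> \<in> quat_Aut"
proof -
  have f: "\<sigma> (inv \<sigma> x) = x" "inv \<sigma> (\<sigma> x) = x" for x
    using quat_Aut_bij[OF assms] by (auto simp: bij_is_surj surj_f_inv_f bij_is_inj)
  have "inv \<sigma> (quat_mult a b) = quat_mult (inv \<sigma> a) (inv \<sigma> b)" for a b
    using f quat_Aut_mult[OF assms, of "inv \<sigma> a" "inv \<sigma> b"] by metis
  then show ?thesis
    using linear_inv_bij quat_Aut_linear[OF assms] quat_Aut_bij[OF assms] by (simp add: quat_Aut_def bij_imp_bij_inv)
qed

lemma quat_mult_1: "quat_mult (1, 0) a = a" "quat_mult a (1, 0) = a"
  by (simp_all add: quat_mult_def)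

lemma quat_mult_Im: "quat_mult (0, u) (0, v) = (- (u \<bullet> v), cross3 u v)"
  by (simp add: quat_mult_def)

lemma quat_Aut_1: assumes "\<sigma> \<in> quat_Aut" shows "\<sigma> (1, 0) = (1, 0)"
proof -
  obtain a where "\<sigma> a = (1, 0)" using quat_Aut_bij[OF assms] by (metis bij_pointE)
  then show ?thesis using quat_Aut_mult[OF assms, of "(1, 0)" a] by (simp add: quat_mult_1)
qed

text \<open>The imaginary quaternions are those with square in the nonpositive reals.\<close>

lemma quat_Aut_Im:
  assumes "\<sigma> \<in> quat_Aut"
  shows "fst (\<sigma> (0, u)) = 0" "norm (snd (\<sigma> (0, u))) = norm u"
proof -
  obtain s w where sw: "\<sigma> (0, u) = (s, w)" by fastforce
  have "quat_mult (s, w) (s, w) = \<sigma> ((- (u \<bullet> u)) *\<^sub>R (1, 0))"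
    using quat_Aut_mult[OF assms, of "(0, u)" "(0, u)"] by (simp add: sw quat_mult_Im)
  also have "\<dots> = (- (u \<bullet> u), 0)"
    by (subst linear_scale[OF quat_Aut_linear[OF assms]]) (simp add: quat_Aut_1[OF assms])
  finally have "quat_mult (s, w) (s, w) = (- (u \<bullet> u), 0)" .
  moreover have "quat_mult (s, w) (s, w) = (s * s - w \<bullet> w, (2 * s) *\<^sub>R w)"
    unfolding quat_mult_def by (simp only: fst_conv snd_conv cross_refl mult_2 scaleR_left_distrib add_0_right)
  ultimately have eq: "s * s - w \<bullet> w = - (u \<bullet> u)" "(2 * s) *\<^sub>R w = 0"
    by (simp_all only: prod.inject)
  have "s = 0"
  proof (rule ccontr)
    assume "s \<noteq> 0"
    then have "w = 0" using eq(2) by simp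
    then have "s * s = - (u \<bullet> u)" using eq(1) by simp
    moreover have "s * s > 0" using \<open>s \<noteq> 0\<close> not_real_square_gt_zero[of s] by argo
    moreover have "u \<bullet> u \<ge> 0" by simp
    ultimately show False by linarith
  qed
  then show "fst (\<sigma> (0, u)) = 0" "norm (snd (\<sigma> (0, u))) = norm u"
    using eq(1) sw by (auto simp: norm_eq)
qed

lemma quat_Aut_Im_eq: "\<sigma> \<in> quat_Aut \<Longrightarrow> \<sigma> (0, u) = (0, snd (\<sigma> (0, u)))"
  by (simp add: prod_eq_iff quat_Aut_Im)

section \<open>The structure in a chart\<close>

locale cr_quat = mfd M for M :: "('m::{t2_space, second_countable_topology}, 'n::euclidean_space) atlas" +
  fixes E :: "('m, 'v::euclidean_space) vbundle" and A :: "('m, quat) vbundle"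
    and \<rho> :: "'m \<Rightarrow> quat \<Rightarrow> ('v \<Rightarrow>\<^sub>L 'v)" and \<iota> :: "'m \<Rightarrow> 'm tvec \<Rightarrow> 'v"
    and nab :: "'m \<Rightarrow> 'm tvec \<Rightarrow> ('m \<Rightarrow> 'v) \<Rightarrow> 'v"
  assumes CR: "almost_CR_quaternionic M E A \<rho> \<iota>" and nab: "quaternionic_connection M E \<rho> \<iota> nab"
begin

abbreviation SE :: "('m \<Rightarrow> 'v) set" where "SE \<equiv> smooth_sections M E"

lemma vb: "vector_bundle M E" "vector_bundle M A"
  using CR by (auto simp: almost_CR_quaternionic_def linear_quaternionic_structure_def quat_algebra_bundle_def)

lemma E_open: "(W, \<tau>) \<in> E \<Longrightarrow> open W" and A_open: "(W', \<alpha>) \<in> A \<Longrightarrow> open W'"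
  using vb by (auto simp: vector_bundle_def)

lemma E_cover: "\<exists>W \<tau>. (W, \<tau>) \<in> E \<and> x \<in> W" and A_cover: "\<exists>W' \<alpha>. (W', \<alpha>) \<in> A \<and> x \<in> W'"
proof -
  have "x \<in> (\<Union>(U, \<phi>)\<in>E. U)" "x \<in> (\<Union>(U, \<phi>)\<in>A. U)" using vb by (simp_all add: vector_bundle_def)
  then show "\<exists>W \<tau>. (W, \<tau>) \<in> E \<and> x \<in> W" "\<exists>W' \<alpha>. (W', \<alpha>) \<in> A \<and> x \<in> W'" by blast+
qed

lemma E_triv:
  assumes "(W, \<tau>) \<in> E" "x \<in> W"
  shows "linear (\<tau> x)" "bij (\<tau> x)" "linear (inv (\<tau> x))" "\<tau> x (inv (\<tau> x) v) = v" "inv (\<tau> x) (\<tau> x v) = v"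
proof -
  show *: "linear (\<tau> x)" "bij (\<tau> x)" using vb(1) assms by (auto simp: vector_bundle_def)
  then show "linear (inv (\<tau> x))" "\<tau> x (inv (\<tau> x) v) = v" "inv (\<tau> x) (\<tau> x v) = v"
    by (auto simp: linear_inv_bij bij_is_surj surj_f_inv_f bij_is_inj)
qed

lemma E_transition:
  "(W, \<tau>) \<in> E \<Longrightarrow> (W2, \<tau>2) \<in> E \<Longrightarrow> smooth_map M (W \<inter> W2) (\<lambda>x. \<tau>2 x (inv (\<tau> x) v))"
  using vb(1) unfolding vector_bundle_def by fast

lemma A_transition:
  "(W, \<tau>) \<in> A \<Longrightarrow> (W2, \<tau>2) \<in> A \<Longrightarrow> smooth_map M (W \<inter> W2) (\<lambda>x. \<tau>2 x (inv (\<tau> x) v))"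
  using vb(2) unfolding vector_bundle_def by fast

lemma A_Aut: "(W', \<alpha>) \<in> A \<Longrightarrow> x \<in> W' \<Longrightarrow> \<alpha> x \<in> quat_Aut"
  using CR by (auto simp: almost_CR_quaternionic_def linear_quaternionic_structure_def quat_algebra_bundle_def)

lemma rho_linear: "linear (\<rho> x)" and rho_1: "\<rho> x (1, 0) = id_blinfun"
  and rho_mult: "\<rho> x (quat_mult a b) = \<rho> x a o\<^sub>L \<rho> x b"
  and rho_smooth: "(W', \<alpha>) \<in> A \<Longrightarrow> smooth_End_section M E W' (\<lambda>x. \<rho> x (inv (\<alpha> x) a))"
  using CR unfolding almost_CR_quaternionic_def linear_quaternionic_structure_def by blast+

section \<open>Sections and locality of the connection\<close>

lemma SE_D: "s \<in> SE \<Longrightarrow> (W, \<tau>) \<in> E \<Longrightarrow> smooth_map M W (\<lambda>x. \<tau> x (s x))"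
  by (auto simp: smooth_sections_def)

lemma SE_add: "s \<in> SE \<Longrightarrow> t \<in> SE \<Longrightarrow> (\<lambda>x. s x + t x) \<in> SE"
proof -
  assume st: "s \<in> SE" "t \<in> SE"
  have "smooth_map M W (\<lambda>x. \<tau> x (s x + t x))" if W: "(W, \<tau>) \<in> E" for W \<tau>
    by (rule smooth_map_cong[OF E_open[OF W] _ smooth_map_add[OF E_open[OF W] SE_D[OF st(1) W] SE_D[OF st(2) W]]])
      (simp add: linear_add[OF E_triv(1)[OF W]])
  then show ?thesis by (auto simp: smooth_sections_def)
qed

lemma SE_scale: "f \<in> FM \<Longrightarrow> s \<in> SE \<Longrightarrow> (\<lambda>x. f x *\<^sub>R s x) \<in> SE"
proof -
  assume fs: "f \<in> FM" "s \<in> SE"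
  have "smooth_map M W (\<lambda>x. \<tau> x (f x *\<^sub>R s x))" if W: "(W, \<tau>) \<in> E" for W \<tau>
  proof (rule smooth_map_cong[OF E_open[OF W] _ smooth_map_scaleR[OF E_open[OF W] _ SE_D[OF fs(2) W]]])
    show "smooth_map M W f" using fs(1) smooth_map_subset by (auto simp: FM_iff)
  qed (simp add: linear_scale[OF E_triv(1)[OF W]])
  then show ?thesis by (auto simp: smooth_sections_def)
qed

lemma SE_zero: "(\<lambda>_. 0) \<in> SE"
proof -
  have "smooth_map M W (\<lambda>x. \<tau> x 0)" if W: "(W, \<tau>) \<in> E" for W \<tau>
    by (rule smooth_map_cong[OF E_open[OF W] _ smooth_map_const[OF E_open[OF W], of 0]]) (simp add: linear_0[OF E_triv(1)[OF W]])
  then show ?thesis by (auto simp: smooth_sections_def)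
qed

lemma SE_sum: "(\<And>i. i \<in> I \<Longrightarrow> s i \<in> SE) \<Longrightarrow> (\<lambda>x. \<Sum>i\<in>I. s i x) \<in> SE"
  by (induction I rule: infinite_finite_induct) (auto intro: SE_zero SE_add)

lemma bundle_conn: "bundle_connection M E nab"
  using nab by (simp add: quaternionic_connection_def almost_quaternionic_connection_def)

lemma nab_lin: "v \<in> tangent_space FM x \<Longrightarrow> w \<in> tangent_space FM x \<Longrightarrow> s \<in> SE \<Longrightarrow>
    nab x (\<lambda>f. a * v f + b * w f) s = a *\<^sub>R nab x v s + b *\<^sub>R nab x w s"
  and nab_add: "v \<in> tangent_space FM x \<Longrightarrow> s \<in> SE \<Longrightarrow> t \<in> SE \<Longrightarrow>
    nab x v (\<lambda>y. s y + t y) = nab x v s + nab x v t"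
  and nab_Leibniz: "v \<in> tangent_space FM x \<Longrightarrow> f \<in> FM \<Longrightarrow> s \<in> SE \<Longrightarrow>
    nab x v (\<lambda>y. f y *\<^sub>R s y) = v f *\<^sub>R s x + f x *\<^sub>R nab x v s"
  and nab_smooth: "X \<in> vector_fields FM UNIV \<Longrightarrow> s \<in> SE \<Longrightarrow> (\<lambda>x. nab x (X x) s) \<in> SE"
  using bundle_conn by (auto simp: bundle_connection_def)

lemma nab_zero: "v \<in> tangent_space FM x \<Longrightarrow> nab x v (\<lambda>_. 0) = 0"
  using nab_Leibniz[OF _ FM.F_const SE_zero, of v x 0] FM.tangent_const[of v x 0] by simp

lemma nab_sum: "v \<in> tangent_space FM x \<Longrightarrow> finite I \<Longrightarrow> (\<And>i. i \<in> I \<Longrightarrow> s i \<in> SE) \<Longrightarrow>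
    nab x v (\<lambda>y. \<Sum>i\<in>I. s i y) = (\<Sum>i\<in>I. nab x v (s i))"
  by (rotate_tac 1, induction I rule: finite_induct) (auto simp: nab_zero nab_add SE_sum)

text \<open>The difference \<open>d\<close> of the sections equals \<open>(1 - k) d\<close> for a
  cutoff \<open>k\<close>. Both factors vanish at \<open>x\<close>, so both Leibniz terms
  do.\<close>

lemma nab_local:
  assumes v: "v \<in> tangent_space FM x" and s: "s \<in> SE" "t \<in> SE" "\<forall>\<^sub>F y in nhds x. s y = t y"
  shows "nab x v s = nab x v t"
proof -
  obtain T where T: "open T" "x \<in> T" "\<And>y. y \<in> T \<Longrightarrow> s y = t y"
    using s(3) by (auto simp: eventually_nhds)
  obtain k T' where k: "k \<in> FM" "x \<in> T'" "T' \<subseteq> T" "\<And>y. y \<in> T' \<Longrightarrow> k y = 1" "\<And>y. y \<notin> T \<Longrightarrow> k y = 0"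
    by (rule cutoff_exists[OF T(1,2)]) (rule that)
  define d where "d y = s y + (- 1) *\<^sub>R t y" for y
  have d: "d \<in> SE" unfolding d_def[abs_def]
    by (rule SE_add[OF s(1) SE_scale[OF FM.F_const s(2)]])
  have f: "(\<lambda>y. 1 - k y) \<in> FM" by (rule FM.F_diff[OF FM.F_const k(1)])
  have d0: "d y = 0" if "y \<in> T" for y using T(3)[OF that] by (simp add: d_def)
  have "d y = (1 - k y) *\<^sub>R d y" for y using d0[of y] k(5)[of y] by (cases "y \<in> T") simp_all
  then have "d = (\<lambda>y. (1 - k y) *\<^sub>R d y)" by (rule ext)
  then have "nab x v d = nab x v (\<lambda>y. (1 - k y) *\<^sub>R d y)" by simp
  also have "\<dots> = 0" using nab_Leibniz[OF v f d] d0[OF T(2)] k(4)[OF k(2)] by simp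
  finally have "nab x v d = 0" .
  moreover have "s = (\<lambda>y. t y + d y)" by (auto simp: d_def)
  then have "nab x v s = nab x v t + nab x v d" using nab_add[OF v s(2) d] by simp
  ultimately show ?thesis by simp
qed

lemma End_section_apply:
  assumes T: "open S" "smooth_End_section M E S T" and s: "s \<in> SE" and W: "(W, \<tau>) \<in> E"
  shows "smooth_map M (S \<inter> W) (\<lambda>x. \<tau> x (blinfun_apply (T x) (s x)))"
proof -
  have o: "open (S \<inter> W)" using T(1) E_open[OF W] by auto
  have TW: "smooth_map M (S \<inter> W) (\<lambda>x. \<tau> x (blinfun_apply (T x) (inv (\<tau> x) b)))" for b
    using T(2) W unfolding smooth_End_section_def by fast
  have sW: "smooth_map M (S \<inter> W) (\<lambda>x. \<tau> x (s x))" by (rule smooth_map_subset[OF SE_D[OF s W]]) simp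
  have "smooth_map M (S \<inter> W) (\<lambda>x. \<Sum>b\<in>Basis. (\<tau> x (s x) \<bullet> b) *\<^sub>R \<tau> x (blinfun_apply (T x) (inv (\<tau> x) b)))"
    by (intro smooth_map_sum smooth_map_scaleR smooth_map_bounded_linear[OF bounded_linear_inner_left] o TW sW)
  then show ?thesis
  proof (rule smooth_map_cong[OF o, rotated])
    fix x assume x: "x \<in> S \<inter> W"
    have "linear (\<lambda>w. \<tau> x (blinfun_apply (T x) (inv (\<tau> x) w)))"
      using linear_compose[OF linear_compose[OF E_triv(3)[OF W] bounded_linear.linear[OF blinfun.bounded_linear_right]] E_triv(1)[OF W]] x
      by (simp add: o_def)
    from linear_sum_Basis[OF this, of "\<tau> x (s x)"]
    show "(\<Sum>b\<in>Basis. (\<tau> x (s x) \<bullet> b) *\<^sub>R \<tau> x (blinfun_apply (T x) (inv (\<tau> x) b))) = \<tau> x (blinfun_apply (T x) (s x))"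
      using E_triv(5)[OF W] x by simp
  qed
qed

lemma iota_lin: "v \<in> tangent_space FM x \<Longrightarrow> w \<in> tangent_space FM x \<Longrightarrow>
    \<iota> x (\<lambda>f. a * v f + b * w f) = a *\<^sub>R \<iota> x v + b *\<^sub>R \<iota> x w"
  and iota_inj: "inj_on (\<iota> x) (tangent_space FM x)"
  and iota_smooth: "X \<in> vector_fields FM UNIV \<Longrightarrow> (\<lambda>x. \<iota> x (X x)) \<in> SE"
  and iota_span: "J \<in> Z_fibre \<rho> x \<Longrightarrow>
        {a + blinfun_apply J b | a b. a \<in> \<iota> x ` tangent_space FM x \<and> b \<in> \<iota> x ` tangent_space FM x} = UNIV"
  using CR unfolding almost_CR_quaternionic_def by blast+

lemma torsion_free: "X \<in> vector_fields FM UNIV \<Longrightarrow> Y \<in> vector_fields FM UNIV \<Longrightarrow>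
    nab x (X x) (\<lambda>y. \<iota> y (Y y)) - nab x (Y x) (\<lambda>y. \<iota> y (X y)) = \<iota> x (bracket FM X Y x)"
  using nab by (simp add: quaternionic_connection_def)

end

text \<open>One open set \<open>V\<close> inside a chart domain and inside the domains of
  trivialisations of \<open>E\<close> and \<open>A\<close>, so that all structures have coordinate
  expressions over it.\<close>

locale cr_chart = cr_quat M E A \<rho> \<iota> nab + mfd_chart M U \<phi> V y0 r
  for M :: "('m::{t2_space, second_countable_topology}, 'n::euclidean_space) atlas"
    and E :: "('m, 'v::euclidean_space) vbundle" and A \<rho> \<iota> nab U \<phi> V y0 r +
  fixes W :: "'m set" and \<tau> :: "'m \<Rightarrow> 'v \<Rightarrow> 'v" and W' :: "'m set" and \<alpha> :: "'m \<Rightarrow> quat \<Rightarrow> quat"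
  assumes W: "(W, \<tau>) \<in> E" "V \<subseteq> W" and W': "(W', \<alpha>) \<in> A" "V \<subseteq> W'"
begin

lemma \<tau>: assumes "x \<in> V" shows "linear (\<tau> x)" "bij (\<tau> x)" "linear (inv (\<tau> x))" "\<tau> x (inv (\<tau> x) v) = v" "inv (\<tau> x) (\<tau> x v) = v"
  using E_triv[OF W(1)] assms W(2) by blast+

definition Tr :: "'m \<Rightarrow> ('v \<Rightarrow>\<^sub>L 'v) \<Rightarrow> ('v \<Rightarrow>\<^sub>L 'v)" where
  "Tr x q = Blinfun (\<lambda>v. \<tau> x (blinfun_apply q (inv (\<tau> x) v)))"

lemma Tr_apply: assumes "x \<in> V" shows "blinfun_apply (Tr x q) v = \<tau> x (blinfun_apply q (inv (\<tau> x) v))"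
proof -
  have "linear (\<lambda>v. \<tau> x (blinfun_apply q (inv (\<tau> x) v)))"
    using linear_compose[OF linear_compose[OF \<tau>(3)[OF assms] bounded_linear.linear[OF blinfun.bounded_linear_right]] \<tau>(1)[OF assms]]
    by (simp add: o_def)
  then show ?thesis unfolding Tr_def by (simp add: bounded_linear_Blinfun_apply linear_conv_bounded_linear)
qed

lemma Tr_alg:
  assumes "x \<in> V"
  shows "Tr x (q + q') = Tr x q + Tr x q'" "Tr x (c *\<^sub>R q) = c *\<^sub>R Tr x q"
    "Tr x (q o\<^sub>L q') = Tr x q o\<^sub>L Tr x q'" "Tr x id_blinfun = id_blinfun"
  by (rule blinfun_eqI, simp add: Tr_apply[OF assms] blinfun.add_left blinfun.scaleR_left \<tau>[OF assms]
      linear_add[OF \<tau>(1)[OF assms]] linear_scale[OF \<tau>(1)[OF assms]])+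

lemma Tr_smooth:
  assumes "open S" "smooth_End_section M E S T"
  shows "Cinf_on (\<phi> ` (V \<inter> S)) (\<lambda>y. Tr (\<psi> y) (T (\<psi> y)))"
proof (rule Cinf_on_blinfunI)
  have VS: "U \<inter> (V \<inter> S) = V \<inter> S" using V(2) by auto
  show o: "open (\<phi> ` (V \<inter> S))"
    using open_chart_image_Int[OF U open_Int[OF V(1) assms(1)]] VS by simp
  fix v
  have "smooth_map M (S \<inter> W) (\<lambda>x. \<tau> x (blinfun_apply (T x) (inv (\<tau> x) v)))"
    using assms(2) W(1) unfolding smooth_End_section_def by fast
  then have "smooth_map M (V \<inter> S) (\<lambda>x. \<tau> x (blinfun_apply (T x) (inv (\<tau> x) v)))"
    by (rule smooth_map_subset) (use W(2) in auto)
  from smooth_mapD[OF this U]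
  show "Cinf_on (\<phi> ` (V \<inter> S)) (\<lambda>y. blinfun_apply (Tr (\<psi> y) (T (\<psi> y))) v)"
    unfolding VS by (rule Cinf_on_cong[OF o, rotated]) (use V(2) in \<open>auto simp: Tr_apply \<psi>_def[symmetric]\<close>)
qed

section \<open>The connection form on E\<close>

definition loc :: "('m \<Rightarrow> 'v) \<Rightarrow> 'n \<Rightarrow> 'v" where "loc s y = \<tau> (\<psi> y) (s (\<psi> y))"

lemma loc_smooth: assumes "s \<in> SE" shows "Cinf_on B (loc s)"
proof -
  have "smooth_map M V (\<lambda>x. \<tau> x (s x))" by (rule smooth_map_subset[OF SE_D[OF assms W(1)] W(2)])
  from smooth_mapD[OF this U] have "Cinf_on (\<phi> ` (U \<inter> V)) (loc s)" by (simp add: loc_def[abs_def] \<psi>_def)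
  then show ?thesis by (rule Cinf_on_subset) (use Int_absorb1[OF V(2)] B_subset in simp)
qed

definition glob :: "('m \<Rightarrow> 'v) \<Rightarrow> 'm \<Rightarrow> 'v" where "glob h x = \<kappa> x *\<^sub>R inv (\<tau> x) (h x)"

lemma glob_SE: assumes "smooth_map M V h" shows "glob h \<in> SE"
proof -
  have "smooth_map M W2 (\<lambda>x. \<tau>2 x (glob h x))" if W2: "(W2, \<tau>2) \<in> E" for W2 \<tau>2
  proof -
    have o: "open (W2 \<inter> V)" using E_open[OF W2] V(1) by auto
    have tW: "smooth_map M (W2 \<inter> V) (\<lambda>x. \<tau>2 x (inv (\<tau> x) b))" for b
      by (rule smooth_map_subset[OF E_transition[OF W(1) W2]]) (use W(2) in auto)
    have hW: "smooth_map M (W2 \<inter> V) h" by (rule smooth_map_subset[OF assms]) simp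
    have "smooth_map M (W2 \<inter> V) (\<lambda>x. \<Sum>b\<in>Basis. (h x \<bullet> b) *\<^sub>R \<tau>2 x (inv (\<tau> x) b))"
      by (intro smooth_map_sum smooth_map_scaleR smooth_map_bounded_linear[OF bounded_linear_inner_left] o tW hW)
    then have "smooth_map M (W2 \<inter> V) (\<lambda>x. \<tau>2 x (inv (\<tau> x) (h x)))"
    proof (rule smooth_map_cong[OF o, rotated])
      fix x assume x: "x \<in> W2 \<inter> V"
      have "linear (\<lambda>w. \<tau>2 x (inv (\<tau> x) w))"
        using linear_compose[OF \<tau>(3) E_triv(1)[OF W2]] x by (simp add: o_def)
      from linear_sum_Basis[OF this, of "h x"]
      show "(\<Sum>b\<in>Basis. (h x \<bullet> b) *\<^sub>R \<tau>2 x (inv (\<tau> x) b)) = \<tau>2 x (inv (\<tau> x) (h x))" by simp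
    qed
    from smooth_cutoff[OF E_open[OF W2] this] show ?thesis
      by (rule smooth_map_cong[OF E_open[OF W2], rotated]) (simp add: glob_def linear_scale[OF E_triv(1)[OF W2]])
  qed
  then show ?thesis by (auto simp: smooth_sections_def)
qed

lemma loc_glob: "y \<in> B \<Longrightarrow> loc (glob h) y = h (\<psi> y)"
  by (simp add: loc_def glob_def \<kappa>_1 \<tau>(4))

definition sb :: "'v \<Rightarrow> 'm \<Rightarrow> 'v" where "sb b = glob (\<lambda>_. b)"

lemma sb_SE: "sb b \<in> SE"
  unfolding sb_def by (rule glob_SE[OF smooth_map_const[OF V(1)]])

lemma loc_sb: "y \<in> B \<Longrightarrow> loc (sb b) y = b"
  by (simp add: sb_def loc_glob)

text \<open>Its columns are the covariant derivatives of the frame \<open>sb\<close>. As a sum of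
  rank-one operators it is smooth in \<open>y\<close> as soon as each column is.\<close>

definition \<omega> :: "'n \<Rightarrow> 'n \<Rightarrow> ('v \<Rightarrow>\<^sub>L 'v)" where
  "\<omega> y a = (\<Sum>b\<in>Basis. blinfun_scaleR_left (\<tau> (\<psi> y) (nab (\<psi> y) (tv (\<psi> y) a) (sb b))) o\<^sub>L blinfun_inner_right b)"

lemma \<omega>_apply: "blinfun_apply (\<omega> y a) w = (\<Sum>b\<in>Basis. (w \<bullet> b) *\<^sub>R \<tau> (\<psi> y) (nab (\<psi> y) (tv (\<psi> y) a) (sb b)))"
  by (simp add: \<omega>_def blinfun.sum_left inner_commute)

lemma tv_add_scale:
  assumes "x \<in> N1" shows "tv x (a *\<^sub>R v + b *\<^sub>R w) = (\<lambda>f. a * tv x v f + b * tv x w f)"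
proof
  fix f show "tv x (a *\<^sub>R v + b *\<^sub>R w) f = a * tv x v f + b * tv x w f"
  proof (cases "f \<in> FM")
    case True
    then have "linear (frechet_derivative (\<lambda>y. f (\<psi> y)) (at (\<phi> x)))"
      using Cinf_on_differentiable[OF Cinf_on_FM[OF True]] N1_D[OF assms] by (intro linear_frechet_derivative) auto
    then show ?thesis using True by (simp add: tv_apply linear_add linear_scale)
  qed (simp add: tanv_def)
qed

lemma \<omega>_linear: assumes "y \<in> B" shows "linear (\<omega> y)"
proof -
  have t: "linear (\<tau> (\<psi> y))" and N: "\<psi> y \<in> N1" using \<tau>(1) assms by auto
  have "\<omega> y (c *\<^sub>R a + d *\<^sub>R b) = c *\<^sub>R \<omega> y a + d *\<^sub>R \<omega> y b" for a b c d
    by (rule blinfun_eqI)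
      (simp add: \<omega>_apply tv_add_scale[OF N] nab_lin[OF tangent_tv[OF N] tangent_tv[OF N] sb_SE] linear_add[OF t] linear_scale[OF t]
        blinfun.add_left blinfun.scaleR_left algebra_simps sum.distrib scaleR_sum_right)
  from this[of 1 _ 1] this[of _ _ 0] show ?thesis by (intro linearI) auto
qed

lemma \<omega>_smooth: "Cinf_on B (\<lambda>y. \<omega> y a)"
proof -
  have "Cinf_on B (\<lambda>y. \<tau> (\<psi> y) (nab (\<psi> y) (tv (\<psi> y) a) (sb b)))" for b
    by (rule Cinf_on_cong[OF open_B _ loc_smooth[OF nab_smooth[OF coord_field_vector_field[of a] sb_SE[of b]]]])
      (simp add: loc_def coord_field_N1)
  then show ?thesis unfolding \<omega>_def
    by (intro Cinf_on_sum Cinf_on_bilinear[OF bounded_bilinear_blinfun_compose]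
        Cinf_on_bounded_linear[OF bounded_linear_blinfun_scaleR_left] Cinf_on_const open_B)
qed

text \<open>The connection is the derivative plus \<open>\<omega>\<close>: near the point,
  \<open>s\<close> is expanded in the frame \<open>sb\<close> with global coefficient functions, and
  \<open>nab_local\<close> allows the Leibniz rule to be applied to the expansion.\<close>

lemma nab_formula:
  assumes y: "y \<in> B" and s: "s \<in> SE"
  shows "\<tau> (\<psi> y) (nab (\<psi> y) (tv (\<psi> y) a) s) = frechet_derivative (loc s) (at y) a + blinfun_apply (\<omega> y a) (loc s y)"
proof -
  let ?x = "\<psi> y" and ?v = "tv (\<psi> y) a"
  define f where "f b x = \<kappa> x * (\<tau> x (s x) \<bullet> b)" for b x
  have N: "?x \<in> N1" and V': "?x \<in> V" using y by auto
  have v: "?v \<in> tangent_space FM ?x" by (rule tangent_tv[OF N])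
  have f: "f b \<in> FM" for b unfolding f_def
    by (rule cutoff_FM[OF smooth_map_bounded_linear[OF bounded_linear_inner_left V(1) smooth_map_subset[OF SE_D[OF s W(1)] W(2)]]])
  have vf: "?v (f b) = frechet_derivative (loc s) (at y) a \<bullet> b" for b
  proof -
    have "frechet_derivative (\<lambda>z. f b (\<psi> z)) (at y) = frechet_derivative (\<lambda>z. loc s z \<bullet> b) (at y)"
      by (rule frechet_derivative_cong_open[OF open_B y]) (simp add: f_def loc_def \<kappa>_1)
    also have "\<dots> = (\<lambda>a. frechet_derivative (loc s) (at y) a \<bullet> b)"
      by (rule frechet_derivative_at[symmetric, OF has_derivative_inner_left[OF Cinf_on_has_derivative[OF loc_smooth[OF s] y]]])
    finally show ?thesis using y by (simp add: tv_apply[OF f])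
  qed
  have exp: "s z = (\<Sum>b\<in>Basis. f b z *\<^sub>R sb b z)" if "z \<in> N1" for z
  proof -
    have z: "z \<in> V" using that N1_D by blast
    have "(\<Sum>b\<in>Basis. f b z *\<^sub>R sb b z) = inv (\<tau> z) (\<Sum>b\<in>Basis. (\<tau> z (s z) \<bullet> b) *\<^sub>R b)"
      using that by (simp add: f_def sb_def glob_def \<kappa>_1 linear_sum[OF \<tau>(3)[OF z]] linear_scale[OF \<tau>(3)[OF z]])
    then show ?thesis by (simp add: euclidean_representation \<tau>(5)[OF z])
  qed
  have "\<forall>\<^sub>F z in nhds ?x. s z = (\<Sum>b\<in>Basis. f b z *\<^sub>R sb b z)"
    by (rule eventually_mono[OF eventually_nhds_in_open[OF open_N1 N] exp])
  then have "nab ?x ?v s = nab ?x ?v (\<lambda>z. \<Sum>b\<in>Basis. f b z *\<^sub>R sb b z)"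
    by (intro nab_local v s SE_sum SE_scale f sb_SE)
  also have "\<dots> = (\<Sum>b\<in>Basis. (frechet_derivative (loc s) (at y) a \<bullet> b) *\<^sub>R sb b ?x + f b ?x *\<^sub>R nab ?x ?v (sb b))"
    by (subst nab_sum[OF v]) (simp_all add: SE_scale f sb_SE nab_Leibniz[OF v f sb_SE] vf)
  finally have "\<tau> ?x (nab ?x ?v s) = (\<Sum>b\<in>Basis. (frechet_derivative (loc s) (at y) a \<bullet> b) *\<^sub>R \<tau> ?x (sb b ?x))
      + (\<Sum>b\<in>Basis. f b ?x *\<^sub>R \<tau> ?x (nab ?x ?v (sb b)))"
    by (simp add: linear_sum[OF \<tau>(1)[OF V']] linear_add[OF \<tau>(1)[OF V']] linear_scale[OF \<tau>(1)[OF V']] sum.distrib)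
  moreover have "\<tau> ?x (sb b ?x) = b" for b using loc_sb[OF y] by (simp add: loc_def)
  moreover have "f b ?x = loc s y \<bullet> b" for b using y by (simp add: f_def loc_def \<kappa>_1)
  ultimately show ?thesis by (simp add: euclidean_representation \<omega>_apply)
qed

text \<open>The induced connection on endomorphisms is the derivative plus the commutator with
  \<open>\<omega>\<close>. \<open>End_derivative\<close> tests \<open>q\<close> on all pairs of
  sections. One direction evaluates an arbitrary pair, the other uses the frame, whose values at the
  point exhaust the fibre.\<close>

lemma End_derivative_iff:
  assumes y: "y \<in> B" and S: "open S" "\<psi> y \<in> S" "smooth_End_section M E S T"
  shows "End_derivative M E nab (\<psi> y) (tv (\<psi> y) a) T q \<longleftrightarrow>
    Tr (\<psi> y) q = frechet_derivative (\<lambda>z. Tr (\<psi> z) (T (\<psi> z))) (at y) a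
      + (\<omega> y a o\<^sub>L Tr (\<psi> y) (T (\<psi> y))) - (Tr (\<psi> y) (T (\<psi> y)) o\<^sub>L \<omega> y a)"
    (is "_ \<longleftrightarrow> ?R")
proof -
  let ?x = "\<psi> y" and ?v = "tv (\<psi> y) a"
  let ?T = "\<lambda>z. Tr (\<psi> z) (T (\<psi> z))"
  have V': "?x \<in> V" using y by auto
  have yS: "y \<in> \<phi> ` (V \<inter> S)" using S(2) y by (metis IntI V' \<psi>_B(2) imageI)
  have dT: "(?T has_derivative frechet_derivative ?T (at y)) (at y)"
    by (rule Cinf_on_has_derivative[OF Tr_smooth[OF S(1,3)] yS])
  let ?D = "frechet_derivative ?T (at y) a + (\<omega> y a o\<^sub>L ?T y) - (?T y o\<^sub>L \<omega> y a)"
  have key: "\<tau> ?x (nab ?x ?v s' - blinfun_apply (T ?x) (nab ?x ?v s)) = blinfun_apply ?D (loc s y)"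
    if s: "s \<in> SE" "s' \<in> SE" and ev: "\<forall>\<^sub>F z in nhds ?x. s' z = blinfun_apply (T z) (s z)" for s s'
  proof -
    obtain O' where O: "open O'" "?x \<in> O'" "\<And>z. z \<in> O' \<Longrightarrow> s' z = blinfun_apply (T z) (s z)"
      using ev by (auto simp: eventually_nhds)
    have UVO: "U \<inter> (V \<inter> O') = V \<inter> O'" using V(2) by auto
    have o: "open (\<phi> ` (V \<inter> O'))" using open_chart_image_Int[OF U open_Int[OF V(1) O(1)]] UVO by simp
    have yO: "y \<in> \<phi> ` (V \<inter> O')" using O(2) y by (metis IntI V' \<psi>_B(2) imageI)
    have eq: "loc s' z = blinfun_apply (?T z) (loc s z)" if "z \<in> \<phi> ` (V \<inter> O')" for z
      using that O(3) V(2) by (auto simp: loc_def Tr_apply \<tau>)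
    have "frechet_derivative (loc s') (at y) = frechet_derivative (\<lambda>z. blinfun_apply (?T z) (loc s z)) (at y)"
      by (rule frechet_derivative_cong_open[OF o yO eq])
    also have "\<dots> = (\<lambda>a. blinfun_apply (?T y) (frechet_derivative (loc s) (at y) a) + blinfun_apply (frechet_derivative ?T (at y) a) (loc s y))"
      by (rule frechet_derivative_at[symmetric, OF bounded_bilinear.FDERIV[OF bounded_bilinear_blinfun_apply dT
          Cinf_on_has_derivative[OF loc_smooth[OF s(1)] y]]])
    finally have d: "frechet_derivative (loc s') (at y) a
      = blinfun_apply (?T y) (frechet_derivative (loc s) (at y) a) + blinfun_apply (frechet_derivative ?T (at y) a) (loc s y)" by simp
    have "\<tau> ?x (blinfun_apply (T ?x) (nab ?x ?v s)) = blinfun_apply (?T y) (\<tau> ?x (nab ?x ?v s))"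
      using V' by (simp add: Tr_apply \<tau>)
    then show ?thesis
      using V' by (simp add: linear_diff[OF \<tau>(1)] nab_formula[OF y s(1)] nab_formula[OF y s(2)] d eq[OF yO]
          blinfun.add_right blinfun.add_left blinfun.diff_left)
  qed
  show ?thesis
  proof
    assume R: ?R
    show "End_derivative M E nab ?x ?v T q"
      unfolding End_derivative_def
    proof (intro ballI impI)
      fix s s' assume s: "s \<in> SE" "s' \<in> SE" "\<forall>\<^sub>F z in nhds ?x. s' z = blinfun_apply (T z) (s z)"
      have "\<tau> ?x (blinfun_apply q (s ?x)) = blinfun_apply (Tr ?x q) (loc s y)"
        using V' by (simp add: Tr_apply loc_def \<tau>)
      then have "\<tau> ?x (blinfun_apply q (s ?x)) = \<tau> ?x (nab ?x ?v s' - blinfun_apply (T ?x) (nab ?x ?v s))"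
        using key[OF s] R by simp
      then show "blinfun_apply q (s ?x) = nab ?x ?v s' - blinfun_apply (T ?x) (nab ?x ?v s)"
        using \<tau>(5)[OF V'] by metis
    qed
  next
    assume L: "End_derivative M E nab ?x ?v T q"
    obtain k T' where k: "open T'" "?x \<in> T'" "T' \<subseteq> S" "\<And>z. z \<in> T' \<Longrightarrow> k z = 1"
      "\<And>S' (f :: 'm \<Rightarrow> 'v). open S' \<Longrightarrow> smooth_map M (S' \<inter> S) f \<Longrightarrow> smooth_map M S' (\<lambda>x. k x *\<^sub>R f x)"
      by (rule cutoff_exists[OF S(1,2)]) (rule that)
    have "blinfun_apply (Tr ?x q) b = blinfun_apply ?D b" for b
    proof -
      \<comment> \<open>\<open>T\<close> is given over \<open>S\<close> only; the cutoff turns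
        \<open>T (sb b)\<close> into a global section with the right germ.\<close>
      define s' where "s' z = k z *\<^sub>R blinfun_apply (T z) (sb b z)" for z
      have "smooth_map M W2 (\<lambda>x. \<tau>2 x (s' x))" if W2: "(W2, \<tau>2) \<in> E" for W2 \<tau>2
      proof -
        have "smooth_map M (W2 \<inter> S) (\<lambda>x. \<tau>2 x (blinfun_apply (T x) (sb b x)))"
          using End_section_apply[OF S(1,3) sb_SE W2] by (simp add: Int_commute)
        from k(5)[OF E_open[OF W2] this] show ?thesis
          by (rule smooth_map_cong[OF E_open[OF W2], rotated]) (simp add: s'_def linear_scale[OF E_triv(1)[OF W2]])
      qed
      then have s': "s' \<in> SE" by (auto simp: smooth_sections_def)
      have ev: "\<forall>\<^sub>F z in nhds ?x. s' z = blinfun_apply (T z) (sb b z)"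
        by (rule eventually_mono[OF eventually_nhds_in_open[OF k(1,2)]]) (simp add: s'_def k(4))
      have "blinfun_apply q (sb b ?x) = nab ?x ?v s' - blinfun_apply (T ?x) (nab ?x ?v (sb b))"
        using L s' sb_SE ev unfolding End_derivative_def by blast
      moreover have "\<tau> ?x (blinfun_apply q (sb b ?x)) = blinfun_apply (Tr ?x q) (loc (sb b) y)"
        using V' by (simp add: Tr_apply loc_def \<tau>)
      ultimately show ?thesis using key[OF sb_SE s' ev] by (simp add: loc_sb[OF y])
    qed
    then show ?R by (rule blinfun_eqI)
  qed
qed

end

lemma scaleR_id_blinfun_eq_0:
  assumes "c *\<^sub>R (id_blinfun :: 'v::euclidean_space \<Rightarrow>\<^sub>L 'v) = 0" shows "c = 0"
proof -
  obtain b :: 'v where b: "b \<in> Basis" using nonempty_Basis by blast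
  have "blinfun_apply (c *\<^sub>R id_blinfun) b = 0" by (simp only: assms blinfun.zero_left)
  then show ?thesis using nonzero_Basis[OF b] by (simp add: blinfun.scaleR_left)
qed

lemmas blinfun_compose_simps =
  bounded_bilinear.add_left[OF bounded_bilinear_blinfun_compose] bounded_bilinear.add_right[OF bounded_bilinear_blinfun_compose]
  bounded_bilinear.diff_left[OF bounded_bilinear_blinfun_compose] bounded_bilinear.diff_right[OF bounded_bilinear_blinfun_compose]
  bounded_bilinear.minus_left[OF bounded_bilinear_blinfun_compose] bounded_bilinear.minus_right[OF bounded_bilinear_blinfun_compose]
  bounded_bilinear.scaleR_left[OF bounded_bilinear_blinfun_compose] bounded_bilinear.scaleR_right[OF bounded_bilinear_blinfun_compose]
  bounded_bilinear.zero_left[OF bounded_bilinear_blinfun_compose] bounded_bilinear.zero_right[OF bounded_bilinear_blinfun_compose]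

context cr_chart
begin

section \<open>Admissible complex structures in a trivialisation\<close>

definition J :: "'m \<Rightarrow> real ^ 3 \<Rightarrow> ('v \<Rightarrow>\<^sub>L 'v)" where "J x u = \<rho> x (inv (\<alpha> x) (0, u))"

lemma \<alpha>_Aut: "x \<in> V \<Longrightarrow> \<alpha> x \<in> quat_Aut" "x \<in> V \<Longrightarrow> inv (\<alpha> x) \<in> quat_Aut"
  using A_Aut[OF W'(1)] W'(2) quat_Aut_inv by auto

lemma J_linear: assumes "x \<in> V" shows "linear (J x)"
proof -
  have "linear (\<lambda>u. (0::real, u::real^3))" by (intro linearI) auto
  from linear_compose[OF linear_compose[OF this quat_Aut_linear[OF \<alpha>_Aut(2)[OF assms]]] rho_linear[of x]]
  show ?thesis by (simp add: J_def[abs_def] o_def)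
qed

lemma J_mult: assumes "x \<in> V" shows "J x u o\<^sub>L J x v = - (u \<bullet> v) *\<^sub>R id_blinfun + J x (cross3 u v)"
proof -
  note \<sigma> = \<alpha>_Aut(2)[OF assms]
  have "J x u o\<^sub>L J x v = \<rho> x (inv (\<alpha> x) (- (u \<bullet> v), cross3 u v))"
    by (simp add: J_def rho_mult[symmetric] quat_Aut_mult[OF \<sigma>, symmetric] quat_mult_Im)
  also have "(- (u \<bullet> v), cross3 u v) = (- (u \<bullet> v)) *\<^sub>R (1, 0) + (0, cross3 u v)" by simp
  also have "\<rho> x (inv (\<alpha> x) ((- (u \<bullet> v)) *\<^sub>R (1, 0) + (0, cross3 u v)))
      = - (u \<bullet> v) *\<^sub>R \<rho> x (inv (\<alpha> x) (1, 0)) + J x (cross3 u v)"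
    unfolding J_def
    by (simp only: linear_add[OF quat_Aut_linear[OF \<sigma>]] linear_scale[OF quat_Aut_linear[OF \<sigma>]]
        linear_add[OF rho_linear] linear_scale[OF rho_linear])
  finally show ?thesis by (simp add: quat_Aut_1[OF \<sigma>] rho_1)
qed

lemma J_eq: "x \<in> V \<Longrightarrow> J x u = \<rho> x (0, snd (inv (\<alpha> x) (0, u)))"
  using quat_Aut_Im_eq[OF \<alpha>_Aut(2), of x u] by (simp add: J_def)

lemma rho_eq_J: assumes "x \<in> V" shows "\<rho> x (0, u) = J x (snd (\<alpha> x (0, u)))" "norm (snd (\<alpha> x (0, u))) = norm u"
  using quat_Aut_Im_eq[OF \<alpha>_Aut(1)[OF assms], of u] quat_Aut_Im(2)[OF \<alpha>_Aut(1)[OF assms]]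
    bij_is_inj[OF quat_Aut_bij[OF \<alpha>_Aut(1)[OF assms]]]
  by (simp_all add: J_def)

lemma Z_fibre_J: assumes "x \<in> V" shows "Z_fibre \<rho> x = {J x u | u. norm u = 1}"
proof (intro set_eqI iffI)
  fix q assume "q \<in> Z_fibre \<rho> x"
  then obtain u where "q = \<rho> x (0, u)" "norm u = 1" by (auto simp: Z_fibre_def)
  then show "q \<in> {J x u | u. norm u = 1}" using rho_eq_J[OF assms, of u] by auto
next
  fix q assume "q \<in> {J x u | u. norm u = 1}"
  then obtain u where "q = J x u" "norm u = 1" by auto
  then show "q \<in> Z_fibre \<rho> x"
    using J_eq[OF assms, of u] quat_Aut_Im(2)[OF \<alpha>_Aut(2)[OF assms], of u] by (auto simp: Z_fibre_def)
qed

lemma Q_fibre_J: assumes "x \<in> V" shows "Q_fibre \<rho> x = {J x u | u. True}"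
proof (intro set_eqI iffI)
  fix q assume "q \<in> Q_fibre \<rho> x"
  then show "q \<in> {J x u | u. True}" using rho_eq_J(1)[OF assms] by (auto simp: Q_fibre_def)
next
  fix q assume "q \<in> {J x u | u. True}"
  then show "q \<in> Q_fibre \<rho> x" using J_eq[OF assms] by (auto simp: Q_fibre_def)
qed

lemma J_smooth: "smooth_End_section M E V (\<lambda>x. J x u)"
  unfolding smooth_End_section_def
proof clarify
  fix W2 \<tau>2 v assume "(W2, \<tau>2) \<in> E"
  then have "smooth_map M (W' \<inter> W2) (\<lambda>x. \<tau>2 x (blinfun_apply (J x u) (inv (\<tau>2 x) v)))"
    using rho_smooth[OF W'(1), of "(0, u)"] unfolding smooth_End_section_def J_def by fast
  then show "smooth_map M (V \<inter> W2) (\<lambda>x. \<tau>2 x (blinfun_apply (J x u) (inv (\<tau>2 x) v)))"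
    by (rule smooth_map_subset) (use W'(2) in auto)
qed

definition Jt :: "'n \<Rightarrow> real ^ 3 \<Rightarrow> ('v \<Rightarrow>\<^sub>L 'v)" where "Jt y u = Tr (\<psi> y) (J (\<psi> y) u)"

lemma Jt_linear: assumes "y \<in> B" shows "linear (Jt y)"
  unfolding Jt_def[abs_def] using assms J_linear[of "\<psi> y"] Tr_alg[of "\<psi> y"]
  by (intro linearI) (simp_all add: linear_add linear_scale)

lemma Jt_mult:
  assumes "y \<in> B"
  shows "Jt y u o\<^sub>L Jt y v = - (u \<bullet> v) *\<^sub>R id_blinfun + Jt y (cross3 u v)"
proof -
  have N: "\<psi> y \<in> V" using assms by simp
  have "Jt y u o\<^sub>L Jt y v = Tr (\<psi> y) (J (\<psi> y) u o\<^sub>L J (\<psi> y) v)" by (simp only: Jt_def Tr_alg(3)[OF N])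
  also have "\<dots> = - (u \<bullet> v) *\<^sub>R id_blinfun + Jt y (cross3 u v)"
    by (simp only: J_mult[OF N] Tr_alg(1,2,4)[OF N] Jt_def)
  finally show ?thesis .
qed

lemma Jt_smooth: "Cinf_on B (\<lambda>y. Jt y u)"
  unfolding Jt_def by (rule Cinf_on_subset[OF Tr_smooth[OF V(1) J_smooth]]) (use B_subset in simp)

definition trace2 :: "('v \<Rightarrow>\<^sub>L 'v) \<Rightarrow> ('v \<Rightarrow>\<^sub>L 'v) \<Rightarrow> real" where
  "trace2 p q = (\<Sum>b\<in>Basis. blinfun_apply ((p o\<^sub>L q) + (q o\<^sub>L p)) b \<bullet> b)"

text \<open>Since the trace of \<open>J\<^sub>u J\<^sub>v + J\<^sub>v J\<^sub>u\<close> is \<open>- 2 (u \<bullet> v) dim V\<close>, this recovers \<open>u\<close> from \<open>J\<^sub>u\<close> by a formula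
  which is smooth in the base point.\<close>

definition pr :: "'n \<Rightarrow> ('v \<Rightarrow>\<^sub>L 'v) \<Rightarrow> real ^ 3" where
  "pr y q = (\<Sum>i\<in>Basis. (- 1 / (2 * DIM('v)) * trace2 q (Jt y i)) *\<^sub>R i)"

lemma Jt_anticommutator:
  assumes "y \<in> B"
  shows "(Jt y u o\<^sub>L Jt y i) + (Jt y i o\<^sub>L Jt y u) = (- 2 * (u \<bullet> i)) *\<^sub>R id_blinfun"
proof -
  have "Jt y (cross3 u i) + Jt y (cross3 i u) = Jt y (cross3 u i + cross3 i u)"
    by (rule linear_add[OF Jt_linear[OF assms], symmetric])
  also have "cross3 u i + cross3 i u = 0" using cross_skew[of u i] by simp
  finally have "Jt y (cross3 u i) + Jt y (cross3 i u) = 0" using linear_0[OF Jt_linear[OF assms]] by simp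
  then have X: "Jt y (cross3 u i) + Jt y (cross3 i u) = 0" .
  have "(Jt y u o\<^sub>L Jt y i) + (Jt y i o\<^sub>L Jt y u)
      = (- (u \<bullet> i) + - (u \<bullet> i)) *\<^sub>R id_blinfun + (Jt y (cross3 u i) + Jt y (cross3 i u))"
    unfolding Jt_mult[OF assms] inner_commute[of i u] scaleR_left_distrib by (simp only: ac_simps)
  also have "- (u \<bullet> i) + - (u \<bullet> i) = - 2 * (u \<bullet> i)" by simp
  finally show ?thesis by (simp only: X add_0_right)
qed

lemma pr_Jt: assumes "y \<in> B" shows "pr y (Jt y u) = u"
proof -
  have "(Jt y u o\<^sub>L Jt y i) + (Jt y i o\<^sub>L Jt y u) = (- 2 * (u \<bullet> i)) *\<^sub>R id_blinfun" for i
    by (rule Jt_anticommutator[OF assms])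
  then have "trace2 (Jt y u) (Jt y i) = (- 2 * (u \<bullet> i)) * DIM('v)" for i
    by (simp add: trace2_def blinfun.scaleR_left blinfun.minus_left)
  then show ?thesis by (simp add: pr_def euclidean_representation)
qed

lemma Jt_eq_iff: "y \<in> B \<Longrightarrow> Jt y u = Jt y v \<longleftrightarrow> u = v"
  by (metis pr_Jt)

lemma pr_smooth:
  assumes "open S" "Cinf_on S f" "\<And>z. z \<in> S \<Longrightarrow> f z \<in> B" "Cinf_on S q"
  shows "Cinf_on S (\<lambda>z. pr (f z) (q z))"
proof -
  have Jf: "Cinf_on S (\<lambda>z. Jt (f z) i)" for i
    by (rule Cinf_on_compose[OF assms(1) open_B Jt_smooth assms(2,3)])
  show ?thesis unfolding pr_def trace2_def
    by (intro Cinf_on_sum Cinf_on_scaleR Cinf_on_mult Cinf_on_const assms Cinf_on_inner Cinf_on_blinfun_apply Cinf_on_add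
        Cinf_on_bilinear[OF bounded_bilinear_blinfun_compose] Jf)
qed

lemma pr_linear: "linear (pr y)"
proof (rule linearI)
  have "trace2 (p + q) i = trace2 p i + trace2 q i" "trace2 (c *\<^sub>R p) i = c * trace2 p i" for p q i c
    unfolding trace2_def
    by (simp_all add: blinfun_compose_simps blinfun.add_left blinfun.scaleR_left inner_add_left sum.distrib sum_distrib_left
        distrib_left)
  note t = this
  define k where "k = - 1 / (2 * real DIM('v))"
  have pr: "pr y q = (\<Sum>i\<in>Basis. (k * trace2 q (Jt y i)) *\<^sub>R i)" for q by (simp add: pr_def k_def)
  show "pr y (p + q) = pr y p + pr y q" "pr y (c *\<^sub>R q) = c *\<^sub>R pr y q" for p q c
    unfolding pr by (simp_all add: t distrib_left scaleR_left_distrib sum.distrib scaleR_sum_right mult.left_commute)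
qed

text \<open>Smoothness of \<open>T\<close> is known only as an endomorphism. Since \<open>pr\<close>
  is smooth, it turns the local sections of \<open>Z\<close> that occur in
  \<open>horizontal_lift\<close> into smooth sphere-valued functions of the chart
  coordinate.\<close>

lemma section_coordinate:
  assumes S: "open S" "smooth_End_section M E S T" "\<And>x. x \<in> S \<Longrightarrow> T x \<in> Z_fibre \<rho> x"
  defines "u \<equiv> \<lambda>y. pr y (Tr (\<psi> y) (T (\<psi> y)))"
  shows "Cinf_on (\<phi> ` (N1 \<inter> S)) u" "\<And>x. x \<in> N1 \<inter> S \<Longrightarrow> T x = J x (u (\<phi> x)) \<and> norm (u (\<phi> x)) = 1"
proof -
  have sub: "N1 \<subseteq> U" "N1 \<subseteq> V" using N1_D by auto
  have "U \<inter> (N1 \<inter> S) = N1 \<inter> S" using sub by auto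
  then have o: "open (\<phi> ` (N1 \<inter> S))" using open_chart_image_Int[OF U open_Int[OF open_N1 S(1)]] by simp
  show "Cinf_on (\<phi> ` (N1 \<inter> S)) u" unfolding u_def
  proof (rule pr_smooth[OF o Cinf_on_id[OF o]])
    show "Cinf_on (\<phi> ` (N1 \<inter> S)) (\<lambda>z. Tr (\<psi> z) (T (\<psi> z)))"
      by (rule Cinf_on_subset[OF Tr_smooth[OF S(1,2)]]) (use sub in auto)
  qed (use N1_D in auto)
  fix x assume x: "x \<in> N1 \<inter> S"
  then obtain w where w: "T x = J x w" "norm w = 1"
    using S(3)[of x] Z_fibre_J[of x] sub by auto
  have "u (\<phi> x) = w"
    using x N1_D[of x] w pr_Jt[of "\<phi> x" w] by (simp add: u_def Jt_def)
  then show "T x = J x (u (\<phi> x)) \<and> norm (u (\<phi> x)) = 1" using w by simp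
qed

section \<open>The embedding, its torsion identity, and the connection form on Q\<close>

definition \<epsilon> :: "'n \<Rightarrow> 'n \<Rightarrow> 'v" where "\<epsilon> y a = \<tau> (\<psi> y) (\<iota> (\<psi> y) (tv (\<psi> y) a))"

lemma \<epsilon>_loc: "y \<in> B \<Longrightarrow> loc (\<lambda>x. \<iota> x (coord_field a x)) y = \<epsilon> y a"
  by (simp add: loc_def \<epsilon>_def coord_field_N1)

lemma \<epsilon>_linear: assumes "y \<in> B" shows "linear (\<epsilon> y)"
proof -
  have t: "linear (\<tau> (\<psi> y))" and N: "\<psi> y \<in> N1" using \<tau>(1) assms by auto
  have "\<epsilon> y (c *\<^sub>R a + d *\<^sub>R b) = c *\<^sub>R \<epsilon> y a + d *\<^sub>R \<epsilon> y b" for a b c d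
    by (simp add: \<epsilon>_def tv_add_scale[OF N] iota_lin[OF tangent_tv[OF N] tangent_tv[OF N]] linear_add[OF t] linear_scale[OF t])
  from this[of 1 _ 1] this[of _ _ 0] show ?thesis by (intro linearI) auto
qed

lemma \<epsilon>_SE: "(\<lambda>x. \<iota> x (coord_field a x)) \<in> SE"
  by (rule iota_smooth[OF coord_field_vector_field])

lemma \<epsilon>_smooth: "Cinf_on B (\<lambda>y. \<epsilon> y a)"
  by (rule Cinf_on_cong[OF open_B \<epsilon>_loc loc_smooth[OF \<epsilon>_SE]])

lemma \<epsilon>_inj: assumes "y \<in> B" shows "inj (\<epsilon> y)"
proof (rule injI)
  fix a b assume eq: "\<epsilon> y a = \<epsilon> y b"
  have N: "\<psi> y \<in> N1" "\<psi> y \<in> V" using assms by auto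
  have "\<iota> (\<psi> y) (tv (\<psi> y) a) = \<iota> (\<psi> y) (tv (\<psi> y) b)"
    using eq \<tau>(5)[OF N(2)] unfolding \<epsilon>_def by metis
  then have "tv (\<psi> y) a = tv (\<psi> y) b"
    using iota_inj[of "\<psi> y"] tangent_tv[OF N(1)] by (auto dest: inj_onD)
  then show "a = b" using vecM_tv[OF N(1)] by metis
qed

lemma \<epsilon>_span: assumes "y \<in> B" "norm u = 1" shows "\<exists>a b. w = \<epsilon> y a + blinfun_apply (Jt y u) (\<epsilon> y b)"
proof -
  have N: "\<psi> y \<in> N1" "\<psi> y \<in> V" using assms by auto
  have "J (\<psi> y) u \<in> Z_fibre \<rho> (\<psi> y)" using Z_fibre_J[OF N(2)] assms(2) by auto
  from iota_span[OF this] obtain v v' where v: "v \<in> tangent_space FM (\<psi> y)" "v' \<in> tangent_space FM (\<psi> y)"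
    "inv (\<tau> (\<psi> y)) w = \<iota> (\<psi> y) v + blinfun_apply (J (\<psi> y) u) (\<iota> (\<psi> y) v')"
    by (smt (verit) UNIV_I image_iff mem_Collect_eq)
  have "w = \<tau> (\<psi> y) (\<iota> (\<psi> y) v) + \<tau> (\<psi> y) (blinfun_apply (J (\<psi> y) u) (\<iota> (\<psi> y) v'))"
    using v(3) \<tau>(4)[OF N(2), of w] by (simp add: linear_add[OF \<tau>(1)[OF N(2)]])
  also have "\<dots> = \<epsilon> y (vecM v) + blinfun_apply (Jt y u) (\<epsilon> y (vecM v'))"
    by (simp add: \<epsilon>_def Jt_def Tr_apply[OF N(2)] \<tau>(5)[OF N(2)] tv_vecM[OF N(1)] v)
  finally show ?thesis by blast
qed

text \<open>Torsion-freeness for two coordinate fields, whose bracket vanishes over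
  \<open>N1\<close>.\<close>

lemma \<epsilon>_torsion:
  assumes "y \<in> B"
  shows "frechet_derivative (\<lambda>z. \<epsilon> z b) (at y) a + blinfun_apply (\<omega> y a) (\<epsilon> y b)
       = frechet_derivative (\<lambda>z. \<epsilon> z a) (at y) b + blinfun_apply (\<omega> y b) (\<epsilon> y a)"
proof -
  let ?x = "\<psi> y"
  have N: "\<psi> y \<in> N1" "\<psi> y \<in> V" using assms by auto
  have "\<iota> ?x (\<lambda>_. 0) = 0"
    using iota_lin[OF tangent_tv[OF N(1)] tangent_tv[OF N(1)], of 0 0 0 0] by simp
  then have "nab ?x (tv ?x a) (\<lambda>x. \<iota> x (coord_field b x)) = nab ?x (tv ?x b) (\<lambda>x. \<iota> x (coord_field a x))"
    using torsion_free[OF coord_field_vector_field[of a] coord_field_vector_field[of b], of ?x]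
    by (simp add: coord_field_bracket[OF N(1)] coord_field_N1[OF N(1)])
  moreover have "frechet_derivative (loc (\<lambda>x. \<iota> x (coord_field c x))) (at y) = frechet_derivative (\<lambda>z. \<epsilon> z c) (at y)" for c
    by (rule frechet_derivative_cong_open[OF open_B assms \<epsilon>_loc])
  ultimately show ?thesis
    using nab_formula[OF assms \<epsilon>_SE[of b], of a] nab_formula[OF assms \<epsilon>_SE[of a], of b]
    by (simp add: \<epsilon>_loc[OF assms])
qed

definition DJ :: "'n \<Rightarrow> 'n \<Rightarrow> real ^ 3 \<Rightarrow> ('v \<Rightarrow>\<^sub>L 'v)" where
  "DJ y a u = frechet_derivative (\<lambda>z. Jt z u) (at y) a + (\<omega> y a o\<^sub>L Jt y u) - (Jt y u o\<^sub>L \<omega> y a)"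

lemma DJ_Q: assumes "y \<in> B" shows "\<exists>g. Jt y g = DJ y a u"
proof -
  have N: "\<psi> y \<in> N1" "\<psi> y \<in> V" using assms by auto
  \<comment> \<open>The connection is assumed to preserve global sections of \<open>Q\<close>.
    Unlike \<open>Z\<close>, the bundle \<open>Q\<close> is stable under scaling, so the cutoff of
    \<open>J x u\<close> is such a section, also where \<open>\<kappa>\<close> vanishes.\<close>
  define T where "T x = \<kappa> x *\<^sub>R J x u" for x
  have T: "smooth_End_section M E UNIV T"
    unfolding smooth_End_section_def
  proof clarify
    fix W2 \<tau>2 v assume W2: "(W2, \<tau>2) \<in> E"
    have "smooth_map M (W2 \<inter> V) (\<lambda>x. \<tau>2 x (blinfun_apply (J x u) (inv (\<tau>2 x) v)))"
      using J_smooth[of u] W2 unfolding smooth_End_section_def by (auto simp: Int_commute)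
    from smooth_cutoff[OF E_open[OF W2] this]
    show "smooth_map M (UNIV \<inter> W2) (\<lambda>x. \<tau>2 x (blinfun_apply (T x) (inv (\<tau>2 x) v)))"
      unfolding Int_UNIV_left
      by (rule smooth_map_cong[OF E_open[OF W2], rotated])
        (simp add: T_def blinfun.scaleR_left linear_scale[OF E_triv(1)[OF W2]])
  qed
  have "T x \<in> Q_fibre \<rho> x" for x
  proof (cases "x \<in> V")
    case True
    then have "T x = J x (\<kappa> x *\<^sub>R u)" by (simp add: T_def linear_scale[OF J_linear])
    then show ?thesis using Q_fibre_J[OF True] by auto
  next
    case False
    then have "T x = \<rho> x (0, 0)" using linear_0[OF rho_linear, of x] by (simp add: T_def \<kappa>_0 zero_prod_def)
    then show ?thesis by (auto simp: Q_fibre_def)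
  qed
  then obtain q where q: "q \<in> Q_fibre \<rho> (\<psi> y)" "End_derivative M E nab (\<psi> y) (tv (\<psi> y) a) T q"
    using nab T tangent_tv[OF N(1)] unfolding quaternionic_connection_def almost_quaternionic_connection_def by blast
  obtain g where g: "q = J (\<psi> y) g" using q(1) Q_fibre_J[OF N(2)] by auto
  have "Tr (\<psi> z) (T (\<psi> z)) = Jt z u" if "z \<in> B" for z using that by (simp add: T_def \<kappa>_1 Jt_def)
  moreover from this have "frechet_derivative (\<lambda>z. Tr (\<psi> z) (T (\<psi> z))) (at y) = frechet_derivative (\<lambda>z. Jt z u) (at y)"
    by (rule frechet_derivative_cong_open[OF open_B assms])
  ultimately have "Tr (\<psi> y) q = DJ y a u"
    using q(2) End_derivative_iff[OF assms open_UNIV _ T, of a q] assms by (simp add: DJ_def)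
  then show ?thesis using g by (auto simp: Jt_def)
qed

definition \<Gamma> :: "'n \<Rightarrow> 'n \<Rightarrow> real ^ 3 \<Rightarrow> real ^ 3" where "\<Gamma> y a u = pr y (DJ y a u)"

text \<open>By \<open>DJ_Q\<close> the covariant derivative of \<open>Jt\<close> is again some
  \<open>Jt\<close>, so passing to coordinates with \<open>pr\<close> loses nothing.\<close>

lemma Jt_\<Gamma>: "y \<in> B \<Longrightarrow> Jt y (\<Gamma> y a u) = DJ y a u"
  using DJ_Q pr_Jt unfolding \<Gamma>_def by metis

lemma frechet_Jt_linear:
  assumes "y \<in> B"
  shows "linear (frechet_derivative (\<lambda>z. Jt z u) (at y))"
    "linear (\<lambda>u. frechet_derivative (\<lambda>z. Jt z u) (at y) a)"
proof -
  have d: "((\<lambda>z. Jt z u) has_derivative frechet_derivative (\<lambda>z. Jt z u) (at y)) (at y)" for u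
    by (rule Cinf_on_has_derivative[OF Jt_smooth assms])
  show "linear (frechet_derivative (\<lambda>z. Jt z u) (at y))" using d by (rule has_derivative_linear)
  show "linear (\<lambda>u. frechet_derivative (\<lambda>z. Jt z u) (at y) a)"
  proof (rule linearI)
    fix u v :: "real ^ 3" and c :: real
    have "frechet_derivative (\<lambda>z. Jt z (u + v)) (at y) = frechet_derivative (\<lambda>z. Jt z u + Jt z v) (at y)"
      by (rule frechet_derivative_cong_open[OF open_B assms]) (simp add: linear_add[OF Jt_linear])
    also have "\<dots> = (\<lambda>a. frechet_derivative (\<lambda>z. Jt z u) (at y) a + frechet_derivative (\<lambda>z. Jt z v) (at y) a)"
      by (rule frechet_derivative_at[symmetric, OF has_derivative_add[OF d d]])
    finally show "frechet_derivative (\<lambda>z. Jt z (u + v)) (at y) a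
      = frechet_derivative (\<lambda>z. Jt z u) (at y) a + frechet_derivative (\<lambda>z. Jt z v) (at y) a" by simp
    have "frechet_derivative (\<lambda>z. Jt z (c *\<^sub>R u)) (at y) = frechet_derivative (\<lambda>z. c *\<^sub>R Jt z u) (at y)"
      by (rule frechet_derivative_cong_open[OF open_B assms]) (simp add: linear_scale[OF Jt_linear])
    also have "\<dots> = (\<lambda>a. c *\<^sub>R frechet_derivative (\<lambda>z. Jt z u) (at y) a)"
      by (rule frechet_derivative_at[symmetric, OF has_derivative_scaleR_right[OF d]])
    finally show "frechet_derivative (\<lambda>z. Jt z (c *\<^sub>R u)) (at y) a = c *\<^sub>R frechet_derivative (\<lambda>z. Jt z u) (at y) a" by simp
  qed
qed

lemma DJ_linear:
  assumes "y \<in> B" shows "linear (\<lambda>a. DJ y a u)" "linear (\<lambda>u. DJ y a u)"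
  by (rule linearI; simp add: DJ_def blinfun_compose_simps linear_add[OF frechet_Jt_linear(1)[OF assms]]
      linear_scale[OF frechet_Jt_linear(1)[OF assms]] linear_add[OF frechet_Jt_linear(2)[OF assms]]
      linear_scale[OF frechet_Jt_linear(2)[OF assms]] linear_add[OF \<omega>_linear[OF assms]] linear_scale[OF \<omega>_linear[OF assms]]
      linear_add[OF Jt_linear[OF assms]] linear_scale[OF Jt_linear[OF assms]] algebra_simps)+

lemma \<Gamma>_linear:
  assumes "y \<in> B" shows "linear (\<lambda>a. \<Gamma> y a u)" "linear (\<lambda>u. \<Gamma> y a u)"
  using linear_compose[OF DJ_linear(1)[OF assms] pr_linear] linear_compose[OF DJ_linear(2)[OF assms] pr_linear]
  by (simp_all add: \<Gamma>_def o_def)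

lemma DJ_smooth: "Cinf_on B (\<lambda>y. DJ y a u)"
  unfolding DJ_def
  by (intro Cinf_on_add Cinf_on_diff open_B Cinf_on_bilinear[OF bounded_bilinear_blinfun_compose] \<omega>_smooth Jt_smooth
      Cinf_on_frechet_derivative)

lemma \<Gamma>_smooth: "Cinf_on B (\<lambda>y. \<Gamma> y a u)"
  unfolding \<Gamma>_def by (rule pr_smooth[OF open_B Cinf_on_id[OF open_B] _ DJ_smooth])

text \<open>The covariant derivative of \<open>J\<^sup>2 = - |u|\<^sup>2\<close> vanishes.\<close>

lemma \<Gamma>_skew:
  assumes "y \<in> B" shows "\<Gamma> y a u \<bullet> u = 0"
proof -
  have d: "((\<lambda>z. Jt z u) has_derivative frechet_derivative (\<lambda>z. Jt z u) (at y)) (at y)" for u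
    by (rule Cinf_on_has_derivative[OF Jt_smooth assms])
  have sq: "Jt z u o\<^sub>L Jt z u = - (u \<bullet> u) *\<^sub>R id_blinfun" if "z \<in> B" for z
    by (simp add: Jt_mult[OF that] linear_0[OF Jt_linear[OF that]])
  let ?D = "frechet_derivative (\<lambda>z. Jt z u) (at y) a"
  have d1: "((\<lambda>z. Jt z u o\<^sub>L Jt z u) has_derivative
      (\<lambda>a. (Jt y u o\<^sub>L frechet_derivative (\<lambda>z. Jt z u) (at y) a) + (frechet_derivative (\<lambda>z. Jt z u) (at y) a o\<^sub>L Jt y u))) (at y)"
    by (rule bounded_bilinear.FDERIV[OF bounded_bilinear_blinfun_compose d d])
  have d2: "((\<lambda>z. Jt z u o\<^sub>L Jt z u) has_derivative (\<lambda>_. 0)) (at y)"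
    by (rule has_derivative_transform_within_open[OF has_derivative_const[of "- (u \<bullet> u) *\<^sub>R id_blinfun"] open_B assms])
      (simp add: sq)
  have D0: "(Jt y u o\<^sub>L ?D) + (?D o\<^sub>L Jt y u) = 0"
    by (rule fun_cong[OF has_derivative_unique[OF d1 d2]])
  have "(DJ y a u o\<^sub>L Jt y u) + (Jt y u o\<^sub>L DJ y a u) = 
     (Jt y u o\<^sub>L ?D) + (?D o\<^sub>L Jt y u) + (\<omega> y a o\<^sub>L (Jt y u o\<^sub>L Jt y u)) - ((Jt y u o\<^sub>L Jt y u) o\<^sub>L \<omega> y a)"
    unfolding DJ_def by (rule blinfun_eqI) (simp add: blinfun.bilinear_simps)
  also have "\<dots> = 0" unfolding D0 sq[OF assms] by (rule blinfun_eqI) (simp add: blinfun.bilinear_simps)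
  finally have "(Jt y (\<Gamma> y a u) o\<^sub>L Jt y u) + (Jt y u o\<^sub>L Jt y (\<Gamma> y a u)) = 0"
    by (simp add: Jt_\<Gamma>[OF assms])
  then have "(- 2 * (\<Gamma> y a u \<bullet> u)) *\<^sub>R (id_blinfun :: 'v \<Rightarrow>\<^sub>L 'v) = 0"
    by (simp only: Jt_anticommutator[OF assms])
  then have "- 2 * (\<Gamma> y a u \<bullet> u) = 0" by (rule scaleR_id_blinfun_eq_0)
  then show ?thesis by simp
qed

end

section \<open>Coordinates on the twistor space\<close>

lemma has_derivative_normalize:
  fixes u :: "'a::real_inner"
  assumes "norm u = 1"
  shows "((\<lambda>u. u /\<^sub>R norm u) has_derivative (\<lambda>h. h - (u \<bullet> h) *\<^sub>R u)) (at u)"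
proof -
  have u: "u \<noteq> 0" using assms by auto
  have n: "(norm has_derivative (\<lambda>h. h \<bullet> u)) (at u)"
    using GDERIV_norm[OF u] by (simp add: gderiv_def sgn_div_norm assms)
  show ?thesis
    using assms u by (auto intro!: derivative_eq_intros n simp: inner_commute)
qed

lemma Cinf_on_fst_compose:
  assumes "open S" "open T" "Cinf_on S f" shows "Cinf_on (S \<times> T) (\<lambda>p. f (fst p))"
proof -
  have o: "open (S \<times> T)" by (intro open_Times assms)
  show ?thesis by (rule Cinf_on_compose[OF o assms(1,3) Cinf_on_fst[OF o Cinf_on_id[OF o]]]) auto
qed

context cr_quat
begin

definition Zpull :: "'m set \<Rightarrow> ('m \<Rightarrow> 'n) \<Rightarrow> ('m \<Rightarrow> quat \<Rightarrow> quat) \<Rightarrow> 'n \<times> (real ^ 3) \<Rightarrow> 'm \<times> ('v \<Rightarrow>\<^sub>L 'v)" where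
  "Zpull U \<phi> \<alpha> p = (inv_into U \<phi> (fst p), \<rho> (inv_into U \<phi> (fst p)) (inv (\<alpha> (inv_into U \<phi> (fst p))) (0, snd p /\<^sub>R norm (snd p))))"

abbreviation FZ :: "('m \<times> ('v \<Rightarrow>\<^sub>L 'v) \<Rightarrow> real) set" where "FZ \<equiv> Z_smooth_functions M A \<rho>"

lemma FZ_iff: "f \<in> FZ \<longleftrightarrow> (\<forall>(U, \<phi>)\<in>M. \<forall>(W, \<alpha>)\<in>A. Cinf_on (\<phi> ` (U \<inter> W) \<times> (- {0})) (\<lambda>p. f (Zpull U \<phi> \<alpha> p)))"
  by (simp add: Z_smooth_functions_def Zpull_def Let_def case_prod_beta')

lemma FZ_I: "(\<And>U \<phi> W \<alpha>. (U, \<phi>) \<in> M \<Longrightarrow> (W, \<alpha>) \<in> A \<Longrightarrow> Cinf_on (\<phi> ` (U \<inter> W) \<times> (- {0})) (\<lambda>p. f (Zpull U \<phi> \<alpha> p))) \<Longrightarrow> f \<in> FZ"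
  unfolding FZ_iff by blast

lemma FZ_D: "f \<in> FZ \<Longrightarrow> (U, \<phi>) \<in> M \<Longrightarrow> (W, \<alpha>) \<in> A \<Longrightarrow> Cinf_on (\<phi> ` (U \<inter> W) \<times> (- {0})) (\<lambda>p. f (Zpull U \<phi> \<alpha> p))"
  unfolding FZ_iff by blast

lemma open_Zpull: "(U, \<phi>) \<in> M \<Longrightarrow> (W, \<alpha>) \<in> A \<Longrightarrow> open (\<phi> ` (U \<inter> W) \<times> (- {0 :: real ^ 3}))"
  by (intro open_Times open_chart_image_Int A_open) (auto simp: open_Compl)

lemma Zpull_Z_space:
  assumes "(U, \<phi>) \<in> M" "(W, \<alpha>) \<in> A" "p \<in> \<phi> ` (U \<inter> W) \<times> (- {0})"
  shows "Zpull U \<phi> \<alpha> p \<in> Z_space \<rho>"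
proof -
  define x where "x = inv_into U \<phi> (fst p)"
  have x: "x \<in> W" using assms by (auto simp: x_def)
  let ?n = "snd p /\<^sub>R norm (snd p)"
  have \<sigma>: "inv (\<alpha> x) \<in> quat_Aut" using A_Aut[OF assms(2) x] quat_Aut_inv by blast
  have "snd p \<noteq> 0" using assms(3) by auto
  then have "norm (snd (inv (\<alpha> x) (0, ?n))) = 1" by (simp add: quat_Aut_Im(2)[OF \<sigma>])
  then have "\<rho> x (0, snd (inv (\<alpha> x) (0, ?n))) \<in> Z_fibre \<rho> x" unfolding Z_fibre_def by blast
  then show ?thesis by (simp add: Zpull_def Z_space_def x_def[symmetric] quat_Aut_Im_eq[OF \<sigma>, symmetric])
qed

sublocale FZ: function_algebra "Z_smooth_functions M A \<rho>" "Z_space \<rho>"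
proof
  show "(\<lambda>_. c) \<in> FZ" for c by (intro FZ_I Cinf_on_const open_Zpull)
  show "(\<lambda>z. f z + g z) \<in> FZ" "(\<lambda>z. f z * g z) \<in> FZ" if "f \<in> FZ" "g \<in> FZ" for f g
    using that by (auto intro!: FZ_I Cinf_on_add Cinf_on_mult open_Zpull intro: FZ_D)
  show "g \<in> FZ" if "f \<in> FZ" "\<And>z. z \<in> Z_space \<rho> \<Longrightarrow> f z = g z" for f g
    using that Zpull_Z_space by (intro FZ_I Cinf_on_cong[OF open_Zpull _ FZ_D[OF that(1)]]) auto
qed

lemma FM_fst_FZ: assumes "g \<in> FM" shows "(\<lambda>z. g (fst z)) \<in> FZ"
proof (rule FZ_I)
  fix U \<phi> W \<alpha> assume *: "(U, \<phi>) \<in> M" "(W, \<alpha>) \<in> A"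
  have "Cinf_on (\<phi> ` (U \<inter> W)) (\<lambda>y. g (inv_into U \<phi> y))"
    by (rule Cinf_on_subset[OF FM_chart[OF assms *(1)]]) auto
  then show "Cinf_on (\<phi> ` (U \<inter> W) \<times> (- {0})) (\<lambda>p. g (fst (Zpull U \<phi> \<alpha> p)))"
    unfolding Zpull_def fst_conv
    by (intro Cinf_on_fst_compose[of _ _ "\<lambda>y. g (inv_into U \<phi> y)"] open_chart_image_Int * A_open[OF *(2)]) (auto simp: open_Compl)
qed

end

context cr_chart
begin

lemma J_eq_iff_V: assumes "x \<in> V" shows "J x u = J x v \<longleftrightarrow> u = v"
proof
  assume "J x u = J x v"
  then have 0: "J x (u - v) = 0" by (simp add: linear_diff[OF J_linear[OF assms]])
  have "- ((u - v) \<bullet> (u - v)) *\<^sub>R (id_blinfun :: 'v \<Rightarrow>\<^sub>L 'v) = 0"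
    using J_mult[OF assms, of "u - v" "u - v"] by (simp add: 0 linear_0[OF J_linear[OF assms]] blinfun_compose_simps)
  then have "- ((u - v) \<bullet> (u - v)) = 0" by (rule scaleR_id_blinfun_eq_0)
  then show "u = v" by simp
qed simp

section \<open>Coordinates on the twistor space\<close>

definition uz :: "'m \<times> ('v \<Rightarrow>\<^sub>L 'v) \<Rightarrow> real ^ 3" where "uz z = (THE u. snd z = J (fst z) u)"

lemma uz_J: "x \<in> V \<Longrightarrow> uz (x, J x u) = u"
  unfolding uz_def by (rule the_equality) (auto simp: J_eq_iff_V)

lemma Z_space_J: assumes "z \<in> Z_space \<rho>" "fst z \<in> V" shows "snd z = J (fst z) (uz z)" "norm (uz z) = 1"
proof -
  obtain u where "snd z = J (fst z) u" "norm u = 1"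
    using assms Z_fibre_J[OF assms(2)] by (auto simp: Z_space_def split_beta)
  then show "snd z = J (fst z) (uz z)" "norm (uz z) = 1"
    using uz_J[OF assms(2), of u] by (metis prod.collapse)+
qed

lemma J_Z_space: "x \<in> V \<Longrightarrow> norm u = 1 \<Longrightarrow> (x, J x u) \<in> Z_space \<rho>"
  using Z_fibre_J[of x] by (auto simp: Z_space_def)

definition cz :: "'m \<times> ('v \<Rightarrow>\<^sub>L 'v) \<Rightarrow> 'n \<times> (real ^ 3)" where "cz z = (\<phi> (fst z), uz z)"

text \<open>Inverse of \<open>cz\<close> on unit vectors, extended constantly along rays. Its domain
  \<open>BZ\<close> is open, so functions on \<open>Z\<close> become functions with Frechet
  derivatives.\<close>

definition zp :: "'n \<times> (real ^ 3) \<Rightarrow> 'm \<times> ('v \<Rightarrow>\<^sub>L 'v)" where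
  "zp p = (\<psi> (fst p), J (\<psi> (fst p)) (snd p /\<^sub>R norm (snd p)))"

definition BZ :: "('n \<times> (real ^ 3)) set" where "BZ = B \<times> (- {0})"

definition ZN :: "('m \<times> ('v \<Rightarrow>\<^sub>L 'v)) set" where "ZN = {z \<in> Z_space \<rho>. fst z \<in> N1}"

lemma open_BZ [simp]: "open BZ" by (simp add: BZ_def open_Times open_Compl)

lemma BZ_D: "p \<in> BZ \<Longrightarrow> fst p \<in> B" "p \<in> BZ \<Longrightarrow> snd p \<noteq> 0" by (auto simp: BZ_def)

lemma ZN_D:
  assumes "z \<in> ZN"
  shows "z \<in> Z_space \<rho>" "fst z \<in> N1" "fst z \<in> V" "norm (uz z) = 1" "z = (fst z, J (fst z) (uz z))" "cz z \<in> BZ" "fst (cz z) \<in> B"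
    "\<psi> (fst (cz z)) = fst z" "snd (cz z) = uz z"
proof -
  show *: "z \<in> Z_space \<rho>" "fst z \<in> N1" "fst z \<in> V" using assms N1_D by (auto simp: ZN_def)
  then show **: "norm (uz z) = 1" "z = (fst z, J (fst z) (uz z))" using Z_space_J[of z] by (auto simp: prod_eq_iff)
  have "fst z \<in> U" "\<phi> (fst z) \<in> B" using * N1_D by auto
  then show "cz z \<in> BZ" "fst (cz z) \<in> B" "\<psi> (fst (cz z)) = fst z" "snd (cz z) = uz z"
    using **(1) by (auto simp: cz_def BZ_def)
qed

lemma zp_cz: assumes "z \<in> ZN" shows "zp (cz z) = z"
proof -
  have "zp (cz z) = (fst z, J (fst z) (uz z))" using ZN_D[OF assms] by (simp add: zp_def)
  then show ?thesis using ZN_D(5)[OF assms] by simp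
qed

lemma zp_ZN: assumes "p \<in> BZ" shows "zp p \<in> ZN" "cz (zp p) = (fst p, snd p /\<^sub>R norm (snd p))"
proof -
  have p: "\<psi> (fst p) \<in> V" "\<psi> (fst p) \<in> N1" "\<phi> (\<psi> (fst p)) = fst p" "snd p \<noteq> 0" using BZ_D[OF assms] by auto
  then show "zp p \<in> ZN" using J_Z_space[OF p(1)] by (simp add: zp_def ZN_def)
  show "cz (zp p) = (fst p, snd p /\<^sub>R norm (snd p))" using p by (simp add: zp_def cz_def uz_J)
qed

lemma zp_eq_Zpull: "zp p = Zpull U \<phi> \<alpha> p"
  by (simp add: zp_def Zpull_def \<psi>_def J_def)

text \<open>Changing the trivialisation of \<open>A\<close> acts linearly on the fibre coordinate,
  with smooth coefficients, and preserves the norm of imaginary quaternions. This makes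
  \<open>cz\<close> smooth in every other trivialisation.\<close>

lemma uz_Zpull:
  assumes "(U2, \<phi>2) \<in> M" "(W2, \<alpha>2) \<in> A" "p \<in> \<phi>2 ` (U2 \<inter> W2 \<inter> V) \<times> (- {0})"
  defines "x \<equiv> inv_into U2 \<phi>2 (fst p)" and "n \<equiv> snd p /\<^sub>R norm (snd p)"
  shows "uz (Zpull U2 \<phi>2 \<alpha>2 p) = (\<Sum>i\<in>Basis. (n \<bullet> i) *\<^sub>R snd (\<alpha> x (inv (\<alpha>2 x) (0, i))))" 
    "norm (uz (Zpull U2 \<phi>2 \<alpha>2 p)) = 1"
proof -
  have x: "x \<in> V" "x \<in> W2" using assms by auto
  have \<sigma>: "inv (\<alpha>2 x) \<in> quat_Aut" using A_Aut[OF assms(2) x(2)] quat_Aut_inv by blast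
  let ?w = "snd (inv (\<alpha>2 x) (0, n))"
  have "\<rho> x (inv (\<alpha>2 x) (0, n)) = J x (snd (\<alpha> x (0, ?w)))"
    using rho_eq_J(1)[OF x(1), of ?w] quat_Aut_Im_eq[OF \<sigma>, of n] by simp
  then have uz: "uz (Zpull U2 \<phi>2 \<alpha>2 p) = snd (\<alpha> x (0, ?w))"
    unfolding Zpull_def x_def[symmetric] n_def[symmetric] by (simp add: uz_J[OF x(1)])
  have "snd p \<noteq> 0" using assms(3) by auto
  then have "norm n = 1" by (simp add: n_def)
  then show "norm (uz (Zpull U2 \<phi>2 \<alpha>2 p)) = 1"
    unfolding uz rho_eq_J(2)[OF x(1)] by (simp add: quat_Aut_Im(2)[OF \<sigma>])
  have "linear (\<lambda>u. (0::real, u::real^3))" by (intro linearI) auto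
  from linear_compose[OF linear_compose[OF linear_compose[OF this quat_Aut_linear[OF \<sigma>]] quat_Aut_linear[OF \<alpha>_Aut(1)[OF x(1)]]] linear_snd]
  have "linear (\<lambda>n. snd (\<alpha> x (inv (\<alpha>2 x) (0, n))))" by (simp add: o_def)
  from linear_sum_Basis[OF this, of n]
  show "uz (Zpull U2 \<phi>2 \<alpha>2 p) = (\<Sum>i\<in>Basis. (n \<bullet> i) *\<^sub>R snd (\<alpha> x (inv (\<alpha>2 x) (0, i))))"
    using uz quat_Aut_Im_eq[OF \<sigma>, of n] by simp
qed

text \<open>The counterpart on \<open>Z\<close> of cutting off a function on \<open>M\<close>. It
  supplies the coordinate functions \<open>coordZ\<close> and the extensions required by
  \<open>tangent_formula\<close>.\<close>

lemma extension_FZ: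
  assumes h: "Cinf_on (\<phi> ` V \<times> (- {0})) h"
  shows "(\<lambda>z. \<kappa> (fst z) * h (cz z)) \<in> FZ"
proof (rule FZ_I, rule Cinf_on_local)
  fix U2 \<phi>2 W2 \<alpha>2 p assume *: "(U2, \<phi>2) \<in> M" "(W2, \<alpha>2) \<in> A" and p: "p \<in> \<phi>2 ` (U2 \<inter> W2) \<times> (- {0 :: real ^ 3})"
  let ?S = "\<phi>2 ` (U2 \<inter> W2) \<times> (- {0 :: real ^ 3})"
  define x where "x = inv_into U2 \<phi>2 (fst p)"
  have x: "x \<in> U2" "x \<in> W2" "fst p = \<phi>2 x" using p * by (auto simp: x_def)
  obtain K where K: "closed K" "K \<subseteq> V" "\<And>z. z \<notin> K \<Longrightarrow> \<kappa> z = 0" using \<kappa>_support by metis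
  let ?f = "\<lambda>p. \<kappa> (fst (Zpull U2 \<phi>2 \<alpha>2 p)) * h (cz (Zpull U2 \<phi>2 \<alpha>2 p))"
  have oS: "open ?S" by (rule open_Zpull[OF *])
  show "\<exists>T. open T \<and> p \<in> T \<and> Cinf_on (?S \<inter> T) ?f"
  proof (cases "x \<in> V")
    case True
    let ?O = "\<phi>2 ` (U2 \<inter> (W2 \<inter> V))"
    let ?T = "?O \<times> (- {0 :: real ^ 3})"
    have oO: "open ?O" by (rule open_chart_image_Int[OF *(1)]) (use A_open[OF *(2)] V(1) in auto)
    have oT: "open ?T" by (intro open_Times oO) auto
    have TS: "?S \<inter> ?T = ?T" by auto
    have O_assoc: "U2 \<inter> (W2 \<inter> V) = U2 \<inter> W2 \<inter> V" by auto
    have in_T: "inv_into U2 \<phi>2 (fst p) \<in> V" if "p \<in> ?T" for p using that * by auto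
    have "smooth_map M (W2 \<inter> V) (\<lambda>x. \<alpha> x (inv (\<alpha>2 x) (0, i)))" for i
      by (rule smooth_map_subset[OF A_transition[OF *(2) W'(1)]]) (use W'(2) in auto)
    then have A: "Cinf_on ?T (\<lambda>p. \<alpha> (inv_into U2 \<phi>2 (fst p)) (inv (\<alpha>2 (inv_into U2 \<phi>2 (fst p))) (0, i)))" for i
      by (intro Cinf_on_fst_compose[of _ _ "\<lambda>y. \<alpha> (inv_into U2 \<phi>2 y) (inv (\<alpha>2 (inv_into U2 \<phi>2 y)) (0, i))"] oO smooth_mapD[OF _ *(1)])
        (auto simp: open_Compl)
    have u: "Cinf_on ?T (\<lambda>p. uz (Zpull U2 \<phi>2 \<alpha>2 p))"
    proof (rule Cinf_on_cong[OF oT])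
      show "Cinf_on ?T (\<lambda>p. \<Sum>i\<in>Basis. ((snd p /\<^sub>R norm (snd p)) \<bullet> i) *\<^sub>R
          snd (\<alpha> (inv_into U2 \<phi>2 (fst p)) (inv (\<alpha>2 (inv_into U2 \<phi>2 (fst p))) (0, i))))"
        by (intro Cinf_on_sum Cinf_on_scaleR Cinf_on_inner Cinf_on_snd A oT Cinf_on_const Cinf_on_inverse_norm Cinf_on_id) auto
    qed (use uz_Zpull(1)[OF *] O_assoc in auto)
    have "smooth_map M (W2 \<inter> V) \<phi>"
      by (rule smooth_map_subset[OF smooth_map_chart[OF U]]) (use V(2) in auto)
    then have ph: "Cinf_on ?T (\<lambda>p. \<phi> (inv_into U2 \<phi>2 (fst p)))"
      by (intro Cinf_on_fst_compose[of _ _ "\<lambda>y. \<phi> (inv_into U2 \<phi>2 y)"] oO smooth_mapD[OF _ *(1)])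
        (auto simp: open_Compl)
    have "smooth_map M (W2 \<inter> V) \<kappa>"
      by (rule smooth_map_subset[OF smooth_\<kappa>_V]) auto
    then have ka: "Cinf_on ?T (\<lambda>p. \<kappa> (inv_into U2 \<phi>2 (fst p)))"
      by (intro Cinf_on_fst_compose[of _ _ "\<lambda>y. \<kappa> (inv_into U2 \<phi>2 y)"] oO smooth_mapD[OF _ *(1)])
        (auto simp: open_Compl)
    have "open (\<phi> ` V)" using open_chart_image_Int[OF U V(1)] V(2) by (simp add: Int_absorb1)
    then have oV: "open (\<phi> ` V \<times> (- {0 :: real ^ 3}))" by (intro open_Times) auto
    have "Cinf_on ?T (\<lambda>p. h (\<phi> (inv_into U2 \<phi>2 (fst p)), uz (Zpull U2 \<phi>2 \<alpha>2 p)))"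
    proof (rule Cinf_on_compose[OF oT oV h Cinf_on_Pair[OF oT ph u]])
      fix p assume p: "p \<in> ?T"
      then have "norm (uz (Zpull U2 \<phi>2 \<alpha>2 p)) = 1" using uz_Zpull(2)[OF *, of p] O_assoc by simp
      then show "(\<phi> (inv_into U2 \<phi>2 (fst p)), uz (Zpull U2 \<phi>2 \<alpha>2 p)) \<in> \<phi> ` V \<times> (- {0})" using in_T[OF p] by auto
    qed
    from Cinf_on_mult[OF oT ka this] have "Cinf_on ?T ?f"
      by (simp add: cz_def Zpull_def)
    then show ?thesis using True x p oT TS by (intro exI[of _ ?T]) (auto simp: mem_Times_iff)
  next
    case False
    let ?T = "\<phi>2 ` (U2 \<inter> - K) \<times> (UNIV :: (real ^ 3) set)"
    have oT: "open ?T" using open_chart_image_Int[OF *(1), of "- K"] K(1) by (intro open_Times) (auto simp: open_Compl)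
    have "Cinf_on (?S \<inter> ?T) ?f"
      by (rule Cinf_on_cong[OF open_Int[OF oS oT] _ Cinf_on_const[OF open_Int[OF oS oT], of 0]])
        (use * K(3) in \<open>auto simp: Zpull_def\<close>)
    then show ?thesis using False x K(2) oT by (intro exI[of _ ?T]) (auto simp: mem_Times_iff)
  qed
qed

definition coordZ :: "'n \<times> (real ^ 3) \<Rightarrow> 'm \<times> ('v \<Rightarrow>\<^sub>L 'v) \<Rightarrow> real" where
  "coordZ b z = \<kappa> (fst z) * (cz z \<bullet> b)"

lemma open_image_V: "open (\<phi> ` V)"
  using open_chart_image_Int[OF U V(1)] V(2) by (simp add: Int_absorb1)

lemma coordZ_FZ: "coordZ b \<in> FZ"
  unfolding coordZ_def[abs_def]
  by (rule extension_FZ, rule Cinf_on_inner) (auto intro!: Cinf_on_id Cinf_on_const open_Times open_image_V)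

definition vecZ :: "('m \<times> ('v \<Rightarrow>\<^sub>L 'v)) tvec \<Rightarrow> 'n \<times> (real ^ 3)" where
  "vecZ X = (\<Sum>b\<in>Basis. X (coordZ b) *\<^sub>R b)"

lemma tangent_formula_Z:
  assumes z: "z \<in> ZN" and X: "X \<in> tangent_space FZ z"
    and f: "f \<in> FZ" "Cinf_on BZ h" "\<And>z. z \<in> ZN \<Longrightarrow> f z = h (cz z)"
  shows "X f = frechet_derivative h (at (cz z)) (vecZ X)"
  unfolding vecZ_def
proof (rule FZ.tangent_formula[OF X, where S = ZN and D = BZ])
  show "(\<lambda>z. if z \<in> ZN then h (cz z) else 0) \<in> FZ"
    if h: "Cinf_on UNIV h" "cball (cz z) s \<subseteq> BZ" "\<And>y. y \<notin> ball (cz z) s \<Longrightarrow> h y = 0" for h s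
  proof (rule FZ.F_cong[OF extension_FZ[OF Cinf_on_subset[OF h(1)]]])
    fix w assume w: "w \<in> Z_space \<rho>"
    show "\<kappa> (fst w) * h (cz w) = (if w \<in> ZN then h (cz w) else 0)"
    proof (cases "w \<in> ZN")
      case True
      then show ?thesis using ZN_D(2) by (simp add: \<kappa>_1)
    next
      case False
      show ?thesis
      proof (cases "fst w \<in> V")
        case True
        then have "cz w \<notin> BZ" using False w N1_iff[of "fst w"] by (auto simp: ZN_def cz_def BZ_def)
        then have "cz w \<notin> ball (cz z) s" using h(2) ball_subset_cball by blast
        then show ?thesis using False h(3) by simp
      qed (use False in \<open>simp add: \<kappa>_0\<close>)
    qed
  qed simp
  show "coordZ b w = cz w \<bullet> b" if "w \<in> ZN" for b w
    using ZN_D(2)[OF that] by (simp add: coordZ_def \<kappa>_1)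
qed (use z f ZN_D coordZ_FZ in auto)

definition fz :: "('m \<times> ('v \<Rightarrow>\<^sub>L 'v) \<Rightarrow> real) \<Rightarrow> 'n \<times> (real ^ 3) \<Rightarrow> real" where "fz f p = f (zp p)"

lemma fz_smooth: assumes "f \<in> FZ" shows "Cinf_on BZ (fz f)"
proof -
  have "Cinf_on (\<phi> ` (U \<inter> W') \<times> (- {0})) (fz f)"
    using FZ_D[OF assms U W'(1)] by (simp add: fz_def[abs_def] zp_eq_Zpull)
  moreover have "B \<subseteq> \<phi> ` (U \<inter> W')" using B_subset V(2) W'(2) by blast
  ultimately show ?thesis by (elim Cinf_on_subset) (auto simp: BZ_def)
qed

lemma fz_has_derivative: "f \<in> FZ \<Longrightarrow> p \<in> BZ \<Longrightarrow> (fz f has_derivative frechet_derivative (fz f) (at p)) (at p)"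
  by (rule Cinf_on_has_derivative[OF fz_smooth])

lemma tangent_Z_apply:
  "z \<in> ZN \<Longrightarrow> X \<in> tangent_space FZ z \<Longrightarrow> f \<in> FZ \<Longrightarrow> X f = frechet_derivative (fz f) (at (cz z)) (vecZ X)"
  by (rule tangent_formula_Z) (assumption | rule fz_smooth | simp add: fz_def zp_cz)+

text \<open>On \<open>Z\<close> the constant 1 is the square of the norm of the fibre coordinate,
  and a derivation kills constants.\<close>

lemma vecZ_perp:
  assumes z: "z \<in> ZN" and X: "X \<in> tangent_space FZ z" shows "uz z \<bullet> snd (vecZ X) = 0"
proof -
  have "0 = frechet_derivative (\<lambda>p. snd p \<bullet> snd p) (at (cz z)) (vecZ X)"
    unfolding FZ.tangent_const[OF X, of 1, symmetric]
  proof (rule tangent_formula_Z[OF z X FZ.F_const])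
    show "Cinf_on BZ (\<lambda>p. snd p \<bullet> snd p)" by (intro Cinf_on_inner Cinf_on_snd Cinf_on_id open_BZ)
    show "1 = snd (cz w) \<bullet> snd (cz w)" if "w \<in> ZN" for w
      using ZN_D(4)[OF that] by (simp add: cz_def norm_eq_1)
  qed
  also have "frechet_derivative (\<lambda>p. snd p \<bullet> snd p) (at (cz z)) = (\<lambda>h. 2 * (snd (cz z) \<bullet> snd h))"
    by (rule frechet_derivative_at[symmetric]) (auto intro!: derivative_eq_intros simp: inner_commute)
  finally show ?thesis by (simp add: cz_def)
qed

definition tvZ :: "'m \<times> ('v \<Rightarrow>\<^sub>L 'v) \<Rightarrow> 'n \<times> (real ^ 3) \<Rightarrow> ('m \<times> ('v \<Rightarrow>\<^sub>L 'v)) tvec" where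
  "tvZ z \<xi> = (\<lambda>f. if f \<in> FZ then frechet_derivative (fz f) (at (cz z)) \<xi> else 0)"

lemma tvZ_tangent: assumes "z \<in> ZN" shows "tvZ z \<xi> \<in> tangent_space FZ z"
proof -
  have d: "fz f differentiable (at (cz z))" if "f \<in> FZ" for f
    using Cinf_on_differentiable[OF fz_smooth[OF that]] ZN_D(6)[OF assms] by blast
  have fz: "fz (\<lambda>q. f q + g q) = (\<lambda>p. fz f p + fz g p)" "fz (\<lambda>q. f q * g q) = (\<lambda>p. fz f p * fz g p)"
    "fz (\<lambda>q. c) = (\<lambda>p. c)" "fz f (cz z) = f z" for f g c
    by (auto simp: fz_def zp_cz[OF assms])
  show ?thesis
    unfolding tangent_space_def tvZ_def
    by (auto simp: FZ.F_add FZ.F_mult FZ.F_cmult fz frechet_derivative_add_mult d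
        frechet_derivative_add_mult(2)[OF differentiable_const d])
qed

lemma tvZ_vecZ: assumes "z \<in> ZN" "X \<in> tangent_space FZ z" shows "tvZ z (vecZ X) = X"
  using tangent_Z_apply[OF assms] FZ.tangent_outside[OF assms(2)] by (auto simp: tvZ_def fun_eq_iff)

lemma vecZ_eqD:
  "z \<in> ZN \<Longrightarrow> X \<in> tangent_space FZ z \<Longrightarrow> Y \<in> tangent_space FZ z \<Longrightarrow> vecZ X = vecZ Y \<Longrightarrow> X = Y"
  using tvZ_vecZ by metis

lemma vecZ_add: "vecZ (\<lambda>f. X f + Y f) = vecZ X + vecZ Y"
  by (simp add: vecZ_def scaleR_left_distrib sum.distrib)

lemma normalize_pair_derivative:
  assumes "norm (snd p) = 1"
  shows "((\<lambda>p :: 'n \<times> (real ^ 3). (fst p, snd p /\<^sub>R norm (snd p))) has_derivative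
    (\<lambda>\<xi>. (fst \<xi>, snd \<xi> - (snd p \<bullet> snd \<xi>) *\<^sub>R snd p))) (at p)"
  using has_derivative_Pair[OF has_derivative_fst[OF has_derivative_ident]
      has_derivative_compose[OF has_derivative_snd[OF has_derivative_ident] has_derivative_normalize[OF assms]]]
  by simp

text \<open>Functions pulled back by \<open>zp\<close> are constant along rays, so
  \<open>tvZ\<close> forgets the radial component of \<open>\<xi>\<close>; only tangent
  \<open>\<xi>\<close> can be recovered.\<close>

lemma vecZ_tvZ: assumes z: "z \<in> ZN" and "uz z \<bullet> snd \<xi> = 0" shows "vecZ (tvZ z \<xi>) = \<xi>"
proof -
  have "tvZ z \<xi> (coordZ b) = \<xi> \<bullet> b" for b
  proof -
    let ?N = "\<lambda>p :: 'n \<times> (real ^ 3). (fst p, snd p /\<^sub>R norm (snd p))"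
    have "frechet_derivative (fz (coordZ b)) (at (cz z)) = frechet_derivative (\<lambda>p. ?N p \<bullet> b) (at (cz z))"
    proof (rule frechet_derivative_cong_open[OF open_BZ ZN_D(6)[OF z]])
      fix p assume p: "p \<in> BZ"
      show "fz (coordZ b) p = ?N p \<bullet> b"
        using zp_ZN[OF p] ZN_D(2)[OF zp_ZN(1)[OF p]] by (simp add: fz_def coordZ_def \<kappa>_1)
    qed
    also have "\<dots> = (\<lambda>\<xi>. (fst \<xi>, snd \<xi> - (snd (cz z) \<bullet> snd \<xi>) *\<^sub>R snd (cz z)) \<bullet> b)"
      by (rule frechet_derivative_at[symmetric, OF has_derivative_inner_left[OF normalize_pair_derivative]])
        (use ZN_D[OF z] in simp)
    finally show ?thesis using assms(2) ZN_D(9)[OF z] by (simp add: tvZ_def coordZ_FZ)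
  qed
  then show ?thesis by (simp add: vecZ_def euclidean_representation)
qed

lemma tangent_Z_fst:
  assumes z: "z \<in> ZN" and X: "X \<in> tangent_space FZ z" and g: "g \<in> FM"
  shows "X (\<lambda>z. g (fst z)) = frechet_derivative (\<lambda>y. g (\<psi> y)) (at (\<phi> (fst z))) (fst (vecZ X))"
proof -
  have d: "((\<lambda>y. g (\<psi> y)) has_derivative frechet_derivative (\<lambda>y. g (\<psi> y)) (at (fst (cz z)))) (at (fst (cz z)))"
    by (rule Cinf_on_has_derivative[OF Cinf_on_FM[OF g] ZN_D(7)[OF z]])
  have "fz (\<lambda>z. g (fst z)) = (\<lambda>p. g (\<psi> (fst p)))" by (simp add: fz_def[abs_def] zp_def)
  moreover have "frechet_derivative (\<lambda>p. g (\<psi> (fst p))) (at (cz z)) =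
      (\<lambda>\<xi>. frechet_derivative (\<lambda>y. g (\<psi> y)) (at (fst (cz z))) (fst \<xi>))"
    by (rule frechet_derivative_at[symmetric]) (rule has_derivative_compose[OF has_derivative_fst[OF has_derivative_ident] d])
  ultimately show ?thesis using tangent_Z_apply[OF z X FM_fst_FZ[OF g]] by (simp add: cz_def)
qed

end

section \<open>The twistor distribution in coordinates\<close>

lemma eigenspace_minus_i_iff:
  "w \<in> eigenspace_minus_i J \<longleftrightarrow> blinfun_apply J (fst w) = snd w \<and> blinfun_apply J (snd w) = - fst w"
  by (auto simp: eigenspace_minus_i_def times_i_def prod_eq_iff)

text \<open>Curves in the eigenspaces are obtained by applying the projections \<open>(1 + i c t) / 2\<close>.\<close>

lemma Grassmannian_velocity_eigenspace:
  fixes c :: "real \<Rightarrow> ('v::euclidean_space \<Rightarrow>\<^sub>L 'v)"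
  assumes c: "(c has_vector_derivative d) (at 0)" and sq: "\<And>t. c t o\<^sub>L c t = - id_blinfun"
  shows "(w, u) \<in> Grassmannian_velocity (\<lambda>t. eigenspace_minus_i (c t)) \<longleftrightarrow>
    w \<in> eigenspace_minus_i (c 0) \<and> blinfun_apply d (fst w) = snd u - blinfun_apply (c 0) (fst u)
      \<and> blinfun_apply d (snd w) = - fst u - blinfun_apply (c 0) (snd u)"
proof
  have sq': "blinfun_apply (c t) (blinfun_apply (c t) v) = - v" for t v
    using sq[of t] by (metis blinfun_apply_blinfun_compose blinfun.minus_left id_blinfun.rep_eq)
  {
    assume "(w, u) \<in> Grassmannian_velocity (\<lambda>t. eigenspace_minus_i (c t))"
    then obtain \<gamma> where g: "w = \<gamma> 0" "\<And>t. \<gamma> t \<in> eigenspace_minus_i (c t)" "(\<gamma> has_vector_derivative u) (at 0)"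
      by (auto simp: Grassmannian_velocity_def)
    have g1: "((\<lambda>t. fst (\<gamma> t)) has_vector_derivative fst u) (at 0)"
      by (rule bounded_linear.has_vector_derivative[OF bounded_linear_fst g(3)])
    have g2: "((\<lambda>t. snd (\<gamma> t)) has_vector_derivative snd u) (at 0)"
      by (rule bounded_linear.has_vector_derivative[OF bounded_linear_snd g(3)])
    have eq: "blinfun_apply (c t) (fst (\<gamma> t)) = snd (\<gamma> t)" "blinfun_apply (c t) (snd (\<gamma> t)) = - fst (\<gamma> t)" for t
      using g(2)[of t] by (auto simp: eigenspace_minus_i_iff)
    have "((\<lambda>t. blinfun_apply (c t) (fst (\<gamma> t))) has_vector_derivative
        blinfun_apply (c 0) (fst u) + blinfun_apply d (fst (\<gamma> 0))) (at 0)"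
      by (rule bounded_bilinear.has_vector_derivative[OF bounded_bilinear_blinfun_apply c g1])
    then have 1: "blinfun_apply (c 0) (fst u) + blinfun_apply d (fst w) = snd u"
      unfolding eq g(1) using g2 by (rule vector_derivative_unique_at)
    have "((\<lambda>t. blinfun_apply (c t) (snd (\<gamma> t))) has_vector_derivative
        blinfun_apply (c 0) (snd u) + blinfun_apply d (snd (\<gamma> 0))) (at 0)"
      by (rule bounded_bilinear.has_vector_derivative[OF bounded_bilinear_blinfun_apply c g2])
    then have 2: "blinfun_apply (c 0) (snd u) + blinfun_apply d (snd w) = - fst u"
      unfolding eq g(1) using has_vector_derivative_minus[OF g1] by (rule vector_derivative_unique_at)
    show "w \<in> eigenspace_minus_i (c 0) \<and> blinfun_apply d (fst w) = snd u - blinfun_apply (c 0) (fst u)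
      \<and> blinfun_apply d (snd w) = - fst u - blinfun_apply (c 0) (snd u)"
      using g(1,2) 1 2 by (simp add: eq_diff_eq add.commute)
  next
    assume a: "w \<in> eigenspace_minus_i (c 0) \<and> blinfun_apply d (fst w) = snd u - blinfun_apply (c 0) (fst u)
      \<and> blinfun_apply d (snd w) = - fst u - blinfun_apply (c 0) (snd u)"
    \<comment> \<open>\<open>g1\<close> and \<open>g2\<close> are the real and imaginary parts of
      that projection applied to the affine curve \<open>w + t u\<close>.\<close>
    define g1 where "g1 t = (1/2) *\<^sub>R (fst w + t *\<^sub>R fst u - blinfun_apply (c t) (snd w + t *\<^sub>R snd u))" for t
    define g2 where "g2 t = (1/2) *\<^sub>R (snd w + t *\<^sub>R snd u + blinfun_apply (c t) (fst w + t *\<^sub>R fst u))" for t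
    have lin: "((\<lambda>t. x + t *\<^sub>R y) has_vector_derivative y) (at 0)" for x y :: 'v
      by (auto intro!: derivative_eq_intros)
    have C: "((\<lambda>t. blinfun_apply (c t) (x + t *\<^sub>R y)) has_vector_derivative (blinfun_apply (c 0) y + blinfun_apply d x)) (at 0)" for x y
      using bounded_bilinear.has_vector_derivative[OF bounded_bilinear_blinfun_apply c lin[of x y]] by simp
    have w: "blinfun_apply (c 0) (fst w) = snd w" "blinfun_apply (c 0) (snd w) = - fst w"
      using a by (auto simp: eigenspace_minus_i_iff)
    have half: "(1 / 2) *\<^sub>R (x + x) = x" for x :: 'v by (simp add: scaleR_2[symmetric])
    have "(g1 has_vector_derivative (1/2) *\<^sub>R (fst u - (blinfun_apply (c 0) (snd u) + blinfun_apply d (snd w)))) (at 0)"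
      unfolding g1_def
      by (rule bounded_linear.has_vector_derivative[OF bounded_linear_scaleR_right has_vector_derivative_diff[OF lin C]])
    moreover have "fst u - (blinfun_apply (c 0) (snd u) + blinfun_apply d (snd w)) = fst u + fst u" using a by simp
    ultimately have d1: "(g1 has_vector_derivative fst u) (at 0)" by (simp only: half)
    have "(g2 has_vector_derivative (1/2) *\<^sub>R (snd u + (blinfun_apply (c 0) (fst u) + blinfun_apply d (fst w)))) (at 0)"
      unfolding g2_def
      by (rule bounded_linear.has_vector_derivative[OF bounded_linear_scaleR_right has_vector_derivative_add[OF lin C]])
    moreover have "snd u + (blinfun_apply (c 0) (fst u) + blinfun_apply d (fst w)) = snd u + snd u" using a by simp
    ultimately have d2: "(g2 has_vector_derivative snd u) (at 0)" by (simp only: half)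
    have d: "((\<lambda>t. (g1 t, g2 t)) has_vector_derivative u) (at 0)"
      using has_vector_derivative_Pair[OF d1 d2] by simp
    have e: "(g1 t, g2 t) \<in> eigenspace_minus_i (c t)" for t
      unfolding eigenspace_minus_i_iff g1_def g2_def fst_conv snd_conv blinfun.scaleR_right blinfun.add_right blinfun.diff_right
      by (simp only: sq' scaleR_minus_right[symmetric]) simp
    have "(g1 0, g2 0) = w"
      unfolding g1_def g2_def by (simp add: w prod_eq_iff scaleR_2[symmetric])
    then show "(w, u) \<in> Grassmannian_velocity (\<lambda>t. eigenspace_minus_i (c t))"
      unfolding Grassmannian_velocity_def using e d by (intro CollectI exI[of _ "\<lambda>t. (g1 t, g2 t)"] exI[of _ u]) auto
  }
qed

text \<open>Multiplying the velocity by i replaces \<open>d\<close> by \<open>i d\<close> on the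
  eigenspace. As \<open>d\<close> anticommutes with \<open>J\<close>, it maps the -i eigenspace to
  the i eigenspace, where multiplication by i is \<open>J\<close>; a real operator is determined by
  its values on the -i eigenspace.\<close>

lemma Grassmannian_velocity_times_i:
  fixes c c' :: "real \<Rightarrow> ('v::euclidean_space \<Rightarrow>\<^sub>L 'v)"
  assumes c: "(c has_vector_derivative d) (at 0)" "\<And>t. c t o\<^sub>L c t = - id_blinfun"
    and c': "(c' has_vector_derivative d') (at 0)" "\<And>t. c' t o\<^sub>L c' t = - id_blinfun"
    and J: "c 0 = J" "c' 0 = J" and dJ: "d o\<^sub>L J = - (J o\<^sub>L d)"
  shows "(\<forall>w u. (w, u) \<in> Grassmannian_velocity (\<lambda>t. eigenspace_minus_i (c t)) \<longleftrightarrow>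
      (w, times_i u) \<in> Grassmannian_velocity (\<lambda>t. eigenspace_minus_i (c' t))) \<longleftrightarrow> d' = J o\<^sub>L d"
    (is "?L \<longleftrightarrow> _")
proof
  have JJ: "blinfun_apply J (blinfun_apply J v) = - v" for v
    using c(2)[of 0] J by (metis blinfun_apply_blinfun_compose blinfun.minus_left id_blinfun.rep_eq)
  have dJ': "blinfun_apply d (blinfun_apply J v) = - blinfun_apply J (blinfun_apply d v)" for v
    using dJ by (metis blinfun_apply_blinfun_compose blinfun.minus_left)
  have half: "(1 / 2) *\<^sub>R x + (1 / 2) *\<^sub>R x = x" for x :: 'v
    by (simp add: scaleR_left_distrib[symmetric])
  have half': "- ((1 / 2) *\<^sub>R x) - (1 / 2) *\<^sub>R x = - x" for x :: 'v
    using half[of x] by (metis minus_add_distrib add_uminus_conv_diff)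
  note iff = Grassmannian_velocity_eigenspace[OF c] Grassmannian_velocity_eigenspace[OF c'] eigenspace_minus_i_iff J times_i_def fst_conv snd_conv
  {
    assume L: ?L
    show "d' = J o\<^sub>L d"
    proof (rule blinfun_eqI)
      fix v
      \<comment> \<open>A velocity over \<open>(v, J v)\<close>: its defining equation asks
        \<open>d v\<close> to equal \<open>snd u - J (fst u)\<close>, and these two terms are both
        half of \<open>d v\<close>.\<close>
      define u where "u = ((1/2) *\<^sub>R blinfun_apply J (blinfun_apply d v), (1/2) *\<^sub>R blinfun_apply d v)"
      let ?w = "(v, blinfun_apply J v)"
      have "(?w, u) \<in> Grassmannian_velocity (\<lambda>t. eigenspace_minus_i (c t))"
        unfolding iff by (simp add: u_def JJ dJ' half half' blinfun.scaleR_right)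
      then have "(?w, times_i u) \<in> Grassmannian_velocity (\<lambda>t. eigenspace_minus_i (c' t))" using L by blast
      then have "blinfun_apply d' v = fst u + blinfun_apply J (snd u)"
        unfolding iff by (simp add: blinfun.minus_right)
      then show "blinfun_apply d' v = blinfun_apply (J o\<^sub>L d) v"
        by (simp add: u_def blinfun.scaleR_right half)
    qed
  next
    assume d': "d' = J o\<^sub>L d"
    have Jeq: "blinfun_apply J x = blinfun_apply J y \<longleftrightarrow> x = y" for x y
      using JJ by (metis neg_equal_iff_equal)
    show ?L
    proof (intro allI)
      fix w u :: "'v \<times> 'v"
      have 1: "blinfun_apply J (blinfun_apply d (fst w)) = fst u + blinfun_apply J (snd u) \<longleftrightarrow>
          blinfun_apply d (fst w) = snd u - blinfun_apply J (fst u)"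
        using Jeq[of "blinfun_apply d (fst w)" "snd u - blinfun_apply J (fst u)"]
        by (simp add: blinfun.diff_right JJ add.commute)
      have 2: "blinfun_apply J (blinfun_apply d (snd w)) = snd u - blinfun_apply J (fst u) \<longleftrightarrow>
          blinfun_apply d (snd w) = - fst u - blinfun_apply J (snd u)"
        using Jeq[of "blinfun_apply d (snd w)" "- fst u - blinfun_apply J (snd u)"]
        by (simp add: blinfun.diff_right blinfun.minus_right JJ)
      show "(w, u) \<in> Grassmannian_velocity (\<lambda>t. eigenspace_minus_i (c t)) \<longleftrightarrow>
        (w, times_i u) \<in> Grassmannian_velocity (\<lambda>t. eigenspace_minus_i (c' t))"
        unfolding iff d' using 1 2 by (simp add: blinfun.minus_right)
    qed
  }
qed

context cr_chart
begin

text \<open>Operator-valued form of \<open>Jt\<close>, so that the product rule applies when base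
  point and argument vary together.\<close>

definition Jb :: "'n \<Rightarrow> (real ^ 3) \<Rightarrow>\<^sub>L ('v \<Rightarrow>\<^sub>L 'v)" where "Jb y = Blinfun (Jt y)"

lemma Jb_apply: "y \<in> B \<Longrightarrow> blinfun_apply (Jb y) u = Jt y u"
  using Jt_linear[of y] by (simp add: Jb_def bounded_linear_Blinfun_apply linear_conv_bounded_linear)

lemma Jb_smooth: "Cinf_on B Jb"
  by (rule Cinf_on_blinfunI[OF open_B], rule Cinf_on_cong[OF open_B _ Jt_smooth]) (simp add: Jb_apply)

lemma frechet_Jb:
  assumes "y \<in> B" shows "blinfun_apply (frechet_derivative Jb (at y) a) u = frechet_derivative (\<lambda>z. Jt z u) (at y) a"
proof -
  have "frechet_derivative (\<lambda>z. Jt z u) (at y) = frechet_derivative (\<lambda>z. blinfun_apply (Jb z) u) (at y)"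
    by (rule frechet_derivative_cong_open[OF open_B assms]) (simp add: Jb_apply)
  also have "\<dots> = (\<lambda>a. blinfun_apply (frechet_derivative Jb (at y) a) u)"
    by (rule frechet_derivative_at[symmetric,
          OF bounded_linear.has_derivative[OF blinfun.bounded_linear_left Cinf_on_has_derivative[OF Jb_smooth assms]]])
  finally show ?thesis by simp
qed

lemma Jt_has_derivative:
  assumes y: "f x \<in> B" and f: "(f has_derivative f') (at x)" and g: "(g has_derivative g') (at x)"
    and ev: "open S" "x \<in> S" "\<And>z. z \<in> S \<Longrightarrow> f z \<in> B"
  shows "((\<lambda>z. Jt (f z) (g z)) has_derivative
    (\<lambda>h. Jt (f x) (g' h) + frechet_derivative (\<lambda>z. Jt z (g x)) (at (f x)) (f' h))) (at x)"
proof -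
  have "((\<lambda>z. Jb (f z)) has_derivative (\<lambda>h. frechet_derivative Jb (at (f x)) (f' h))) (at x)"
    by (rule has_derivative_compose[OF f Cinf_on_has_derivative[OF Jb_smooth y]])
  from bounded_bilinear.FDERIV[OF bounded_bilinear_blinfun_apply this g]
  have "((\<lambda>z. blinfun_apply (Jb (f z)) (g z)) has_derivative
    (\<lambda>h. Jt (f x) (g' h) + frechet_derivative (\<lambda>z. Jt z (g x)) (at (f x)) (f' h))) (at x)"
    by (simp add: Jb_apply[OF y] frechet_Jb[OF y])
  then show ?thesis
    by (rule has_derivative_transform_within_open[OF _ ev(1,2)]) (simp add: Jb_apply ev(3))
qed

definition \<zeta> :: "'n \<times> (real ^ 3) \<Rightarrow> 'n \<times> (real ^ 3) \<Rightarrow> real ^ 3" where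
  "\<zeta> p \<xi> = snd \<xi> + \<Gamma> (fst p) (fst \<xi>) (snd p)"

text \<open>For a local section given by \<open>u\<close>, the covariant derivative along \<open>a\<close> corresponds to
  \<open>u'(a) + \<Gamma>(a) u\<close>.\<close>

lemma parallel_iff:
  assumes y: "y \<in> B" and S: "open S" "\<psi> y \<in> S" "S \<subseteq> N1" "smooth_End_section M E S T"
    and T: "\<And>x. x \<in> S \<Longrightarrow> T x = J x (u (\<phi> x))" and u: "(u has_derivative u') (at y)"
  shows "End_derivative M E nab (\<psi> y) (tv (\<psi> y) a) T 0 \<longleftrightarrow> u' a = - \<Gamma> y a (u y)"
proof -
  have US: "U \<inter> S = S" using S(3) N1_D by auto
  have oS: "open (\<phi> ` S)" using open_chart_image_Int[OF U S(1)] US by simp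
  have yS: "y \<in> \<phi> ` S" using S(2) y by (metis \<psi>_B(2) imageI)
  have eq: "Tr (\<psi> z) (T (\<psi> z)) = Jt z (u z)" if z: "z \<in> \<phi> ` S" for z
  proof -
    obtain x where "x \<in> S" "z = \<phi> x" using z by auto
    then show ?thesis using S(3) N1_D(2)[of x] T[of x] by (auto simp: Jt_def)
  qed
  have "frechet_derivative (\<lambda>z. Tr (\<psi> z) (T (\<psi> z))) (at y) = frechet_derivative (\<lambda>z. Jt z (u z)) (at y)"
    by (rule frechet_derivative_cong_open[OF oS yS eq])
  also have "\<dots> = (\<lambda>h. Jt y (u' h) + frechet_derivative (\<lambda>z. Jt z (u y)) (at y) h)"
    by (rule frechet_derivative_at[symmetric, OF Jt_has_derivative[OF y has_derivative_ident u open_B y]])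
  finally have "End_derivative M E nab (\<psi> y) (tv (\<psi> y) a) T 0 \<longleftrightarrow> Tr (\<psi> y) 0 = Jt y (u' a) + DJ y a (u y)"
    unfolding End_derivative_iff[OF y S(1,2,4)] eq[OF yS] by (simp add: DJ_def algebra_simps)
  also have "Tr (\<psi> y) 0 = 0"
    using Tr_alg(2)[of "\<psi> y" 0 0] y by simp
  also have "Jt y (u' a) + DJ y a (u y) = Jt y (u' a + \<Gamma> y a (u y))"
    by (simp add: linear_add[OF Jt_linear[OF y]] Jt_\<Gamma>[OF y])
  also have "0 = Jt y (u' a + \<Gamma> y a (u y)) \<longleftrightarrow> u' a = - \<Gamma> y a (u y)"
    using Jt_eq_iff[OF y, of 0 "u' a + \<Gamma> y a (u y)"] linear_0[OF Jt_linear[OF y]] by (auto simp: eq_neg_iff_add_eq_0)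
  finally show ?thesis .
qed

text \<open>The section \<open>T\<close> in \<open>horizontal_lift\<close> is the graph of a
  function \<open>u\<close> in coordinates. Being parallel fixes the derivative of \<open>u\<close>
  at the point, so the lift does not depend on the choice of \<open>T\<close>.\<close>

lemma horizontal_lift_vecZ:
  assumes z: "z \<in> ZN" and v: "v \<in> tangent_space FM (fst z)" and X: "horizontal_lift M E A \<rho> nab z v X"
  shows "X \<in> tangent_space FZ z" "vecZ X = (vecM v, - \<Gamma> (\<phi> (fst z)) (vecM v) (uz z))"
proof -
  let ?x = "fst z" and ?y = "\<phi> (fst z)" and ?a = "vecM v"
  have y: "?y \<in> B" "\<psi> ?y = ?x" "?x \<in> N1" "?x \<in> V" using ZN_D[OF z] by (auto simp: cz_def)
  show XT: "X \<in> tangent_space FZ z" using X by (simp add: horizontal_lift_def)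
  obtain S T where T: "open S" "?x \<in> S" "smooth_End_section M E S T" "\<And>y. y \<in> S \<Longrightarrow> T y \<in> Z_fibre \<rho> y"
    "T ?x = snd z" "\<And>w. w \<in> tangent_space FM ?x \<Longrightarrow> End_derivative M E nab ?x w T 0"
    and XT': "\<And>f g. f \<in> FZ \<Longrightarrow> g \<in> FM \<Longrightarrow> \<forall>\<^sub>F y in nhds ?x. g y = f (y, T y) \<Longrightarrow> X f = v g"
    using X unfolding horizontal_lift_def by blast
  define u where "u = (\<lambda>y. pr y (Tr (\<psi> y) (T (\<psi> y))))"
  note sc = section_coordinate[OF T(1,3,4)]
  have Tu: "\<And>x. x \<in> N1 \<inter> S \<Longrightarrow> T x = J x (u (\<phi> x))" "\<And>x. x \<in> N1 \<inter> S \<Longrightarrow> norm (u (\<phi> x)) = 1"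
    unfolding u_def using sc(2) by blast+
  have o: "open (N1 \<inter> S)" using T(1) by auto
  have xS: "?x \<in> N1 \<inter> S" using T(2) y by auto
  have us: "Cinf_on (\<phi> ` (N1 \<inter> S)) u" unfolding u_def by (rule sc(1))
  have yS: "?y \<in> \<phi> ` (N1 \<inter> S)" using xS by auto
  have UN: "N1 \<inter> S \<subseteq> U" "U \<inter> (N1 \<inter> S) = N1 \<inter> S" using N1_D by auto
  have oS: "open (\<phi> ` (N1 \<inter> S))" using open_chart_image_Int[OF U o] UN by simp
  have du: "(u has_derivative frechet_derivative u (at ?y)) (at ?y)" by (rule Cinf_on_has_derivative[OF us yS])
  have u0: "u ?y = uz z"
    using Tu(1)[OF xS] T(5) ZN_D(5)[OF z] J_eq_iff_V[OF y(4)] by (metis snd_conv)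
  have "End_derivative M E nab (\<psi> ?y) (tv (\<psi> ?y) ?a) T 0"
    using T(6)[OF tangent_tv[OF y(3)]] y(2) by simp
  moreover have "smooth_End_section M E (N1 \<inter> S) T"
    using T(3) unfolding smooth_End_section_def by (fast intro: smooth_map_subset)
  ultimately have par: "frechet_derivative u (at ?y) ?a = - \<Gamma> ?y ?a (uz z)"
    using parallel_iff[OF y(1) o _ _ _ Tu(1) du] xS y(2) u0 by simp
  obtain k T' where k: "open T'" "?x \<in> T'" "T' \<subseteq> N1 \<inter> S" "\<And>z. z \<in> T' \<Longrightarrow> k z = 1"
      "\<And>S' (f :: 'm \<Rightarrow> real). open S' \<Longrightarrow> smooth_map M (S' \<inter> (N1 \<inter> S)) f \<Longrightarrow> smooth_map M S' (\<lambda>x. k x *\<^sub>R f x)"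
    by (rule cutoff_exists[OF o xS]) (rule that)
  have "X (coordZ b) = (?a, - \<Gamma> ?y ?a (uz z)) \<bullet> b" for b
  proof -
    \<comment> \<open>A global function with the germ at \<open>fst z\<close> of
      \<open>coordZ b\<close> composed with the section \<open>T\<close>, as
      \<open>horizontal_lift\<close> demands.\<close>
    let ?g = "\<lambda>x. k x *\<^sub>R ((\<phi> x, u (\<phi> x)) \<bullet> b)"
    have "Cinf_on (\<phi> ` (N1 \<inter> S)) (\<lambda>y. (y, u y) \<bullet> b)"
      by (intro Cinf_on_inner Cinf_on_Pair Cinf_on_id Cinf_on_const oS us)
    from smooth_map_of_chart[OF U o UN(1) this] have g: "?g \<in> FM"
      unfolding FM_iff by (intro k(5)) auto
    have ev: "\<forall>\<^sub>F y in nhds ?x. ?g y = coordZ b (y, T y)"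
    proof (rule eventually_mono[OF eventually_nhds_in_open[OF k(1,2)]])
      fix x assume x: "x \<in> T'"
      then have "x \<in> N1 \<inter> S" "x \<in> V" using k(3) N1_D by auto
      then show "?g x = coordZ b (x, T x)"
        using Tu(1)[of x] x by (simp add: k(4) coordZ_def \<kappa>_1 cz_def uz_J)
    qed
    have "X (coordZ b) = v ?g" by (rule XT'[OF coordZ_FZ g ev])
    also have "\<dots> = frechet_derivative (\<lambda>y. ?g (\<psi> y)) (at ?y) ?a"
      using tv_apply[OF g, of ?x ?a] tv_vecM[OF y(3) v] by simp
    also have "frechet_derivative (\<lambda>y. ?g (\<psi> y)) (at ?y) = frechet_derivative (\<lambda>y. (y, u y) \<bullet> b) (at ?y)"
    proof (rule frechet_derivative_cong_open[of "\<phi> ` T'"])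
      show "open (\<phi> ` T')" using open_chart_image_Int[OF U k(1)] k(3) UN by (simp add: Int_absorb1)
      show "?y \<in> \<phi> ` T'" using k(2) by auto
      show "?g (\<psi> y) = (y, u y) \<bullet> b" if "y \<in> \<phi> ` T'" for y using that k(3,4) UN by auto
    qed
    also have "\<dots> = (\<lambda>h. (h, frechet_derivative u (at ?y) h) \<bullet> b)"
      by (rule frechet_derivative_at[symmetric, OF has_derivative_inner_left[OF has_derivative_Pair[OF has_derivative_ident du]]])
    finally show ?thesis using par by simp
  qed
  then show "vecZ X = (?a, - \<Gamma> ?y ?a (uz z))" by (simp add: vecZ_def euclidean_representation)
qed

lemma End_section_J:
  assumes "open S" "S \<subseteq> V" "smooth_map M S u"
  shows "smooth_End_section M E S (\<lambda>x. J x (u x))"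
  unfolding smooth_End_section_def
proof clarify
  fix W2 \<tau>2 w assume W2: "(W2, \<tau>2) \<in> E"
  have o: "open (S \<inter> W2)" using assms(1) E_open[OF W2] by auto
  have "smooth_map M (V \<inter> W2) (\<lambda>x. \<tau>2 x (blinfun_apply (J x i) (inv (\<tau>2 x) w)))" for i
    using J_smooth[of i] W2 unfolding smooth_End_section_def by fast
  then have Ji: "smooth_map M (S \<inter> W2) (\<lambda>x. \<tau>2 x (blinfun_apply (J x i) (inv (\<tau>2 x) w)))" for i
    by (rule smooth_map_subset) (use assms(2) in auto)
  have us: "smooth_map M (S \<inter> W2) u" by (rule smooth_map_subset[OF assms(3)]) auto
  have "smooth_map M (S \<inter> W2) (\<lambda>x. \<Sum>i\<in>Basis. (u x \<bullet> i) *\<^sub>R \<tau>2 x (blinfun_apply (J x i) (inv (\<tau>2 x) w)))"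
    by (intro smooth_map_sum smooth_map_scaleR o Ji smooth_map_bounded_linear[OF bounded_linear_inner_left] us)
  then show "smooth_map M (S \<inter> W2) (\<lambda>x. \<tau>2 x (blinfun_apply (J x (u x)) (inv (\<tau>2 x) w)))"
  proof (rule smooth_map_cong[OF o, rotated])
    fix x assume x: "x \<in> S \<inter> W2"
    have "linear (\<lambda>v. blinfun_apply (J x v) (inv (\<tau>2 x) w))"
      using J_linear[of x] x assms(2) by (intro linearI) (auto simp: linear_add linear_scale blinfun.add_left blinfun.scaleR_left)
    from linear_sum_Basis[OF linear_compose[OF this E_triv(1)[OF W2], unfolded o_def], of x "u x"] x
    show "(\<Sum>i\<in>Basis. (u x \<bullet> i) *\<^sub>R \<tau>2 x (blinfun_apply (J x i) (inv (\<tau>2 x) w)))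
        = \<tau>2 x (blinfun_apply (J x (u x)) (inv (\<tau>2 x) w))" by simp
  qed
qed

lemma horizontal_lift_exists:
  assumes z: "z \<in> ZN" and v: "v \<in> tangent_space FM (fst z)"
  shows "horizontal_lift M E A \<rho> nab z v (tvZ z (vecM v, - \<Gamma> (\<phi> (fst z)) (vecM v) (uz z)))"
proof -
  let ?x = "fst z" and ?y = "\<phi> (fst z)" and ?a = "vecM v" and ?u = "uz z"
  have y: "?y \<in> B" "\<psi> ?y = ?x" "?x \<in> N1" "?x \<in> V" using ZN_D[OF z] by (auto simp: cz_def)
  have N1V: "N1 \<subseteq> V" "N1 \<subseteq> U" using N1_D by auto
  note \<Gamma>l = \<Gamma>_linear(1)[OF y(1), of ?u]
  \<comment> \<open>An affine function with the derivative that parallelism prescribes. By skewness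
    of \<open>\<Gamma>\<close> its inner product with \<open>uz z\<close> is constantly 1, so it
    never vanishes, and normalising it does not change the derivative at the point.\<close>
  define l where "l y' = ?u - \<Gamma> ?y (y' - ?y) ?u" for y'
  define u where "u y' = l y' /\<^sub>R norm (l y')" for y'
  have uu: "?u \<bullet> ?u = 1" using ZN_D(4)[OF z] by (simp add: norm_eq_1)
  have "l y' \<bullet> ?u = 1" for y' by (simp add: l_def inner_diff_left \<Gamma>_skew[OF y(1)] uu)
  then have l0: "l y' \<noteq> 0" for y' by (metis inner_zero_left zero_neq_one)
  have "bounded_linear (\<lambda>a. \<Gamma> ?y a ?u)" using \<Gamma>l by (simp add: linear_conv_bounded_linear)
  then have ls: "Cinf_on UNIV l" unfolding l_def[abs_def]
    by (intro Cinf_on_diff Cinf_on_const Cinf_on_bounded_linear[of "\<lambda>a. \<Gamma> ?y a ?u"] Cinf_on_id open_UNIV)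
  have us: "Cinf_on UNIV u" unfolding u_def[abs_def] by (rule Cinf_on_normalize[OF open_UNIV ls l0])
  have ly: "l ?y = ?u" by (simp add: l_def linear_0[OF \<Gamma>l])
  have uy: "u ?y = ?u" using ZN_D(4)[OF z] by (simp add: u_def ly)
  have dl: "(l has_derivative (\<lambda>h. - \<Gamma> ?y h ?u)) (at ?y)"
  proof -
    have "((\<lambda>y'. y' - ?y) has_derivative (\<lambda>h. h)) (at ?y)" by (auto intro!: derivative_eq_intros)
    from has_derivative_diff[OF has_derivative_const bounded_linear.has_derivative[OF \<open>bounded_linear (\<lambda>a. \<Gamma> ?y a ?u)\<close> this]]
    show ?thesis unfolding l_def[abs_def] by simp
  qed
  have "(u has_derivative (\<lambda>h. - \<Gamma> ?y h ?u - (l ?y \<bullet> - \<Gamma> ?y h ?u) *\<^sub>R l ?y)) (at ?y)"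
    unfolding u_def[abs_def]
    by (rule has_derivative_compose[OF dl has_derivative_normalize]) (use ZN_D(4)[OF z] ly in simp)
  then have du: "(u has_derivative (\<lambda>h. - \<Gamma> ?y h ?u)) (at ?y)"
    by (simp add: ly inner_commute[of ?u] \<Gamma>_skew[OF y(1)])
  define T where "T x = J x (u (\<phi> x))" for x
  have T: "smooth_End_section M E N1 T" unfolding T_def[abs_def]
    by (rule End_section_J[OF open_N1 N1V(1) smooth_map_of_chart[OF U open_N1 N1V(2) Cinf_on_subset[OF us]]]) simp
  have un: "norm (u y') = 1" for y' using l0[of y'] by (simp add: u_def)
  have TZ: "T x \<in> Z_fibre \<rho> x" if "x \<in> N1" for x
    using Z_fibre_J[OF subsetD[OF N1V(1) that]] un by (auto simp: T_def)
  have Tx: "T ?x = snd z" unfolding T_def uy using ZN_D(5)[OF z] by (metis snd_conv)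
  have par: "End_derivative M E nab ?x w T 0" if w: "w \<in> tangent_space FM ?x" for w
    using parallel_iff[OF y(1) open_N1 _ subset_refl T _ du, of "vecM w"] y tv_vecM[OF y(3) w] uy by (simp add: T_def)
  have "tvZ z (?a, - \<Gamma> ?y ?a ?u) f = v g" if f: "f \<in> FZ" and g: "g \<in> FM" and ev: "\<forall>\<^sub>F y in nhds ?x. g y = f (y, T y)" for f g
  proof -
    obtain O' where O: "open O'" "?x \<in> O'" "\<And>z. z \<in> O' \<Longrightarrow> g z = f (z, T z)"
      using ev by (auto simp: eventually_nhds)
    have UO: "U \<inter> (N1 \<inter> O') = N1 \<inter> O'" using N1V by auto
    have oO: "open (\<phi> ` (N1 \<inter> O'))" using open_chart_image_Int[OF U open_Int[OF open_N1 O(1)]] UO by simp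
    have yO: "?y \<in> \<phi> ` (N1 \<inter> O')" using y O(2) by auto
    have eq: "g (\<psi> y') = fz f (y', u y')" if "y' \<in> \<phi> ` (N1 \<inter> O')" for y'
      using that O(3) N1V un by (auto simp: fz_def zp_def T_def)
    have cz: "cz z = (?y, u ?y)" by (simp add: cz_def uy)
    have "v g = frechet_derivative (\<lambda>y. g (\<psi> y)) (at ?y) ?a"
      using tv_apply[OF g, of ?x ?a] tv_vecM[OF y(3) v] by simp
    also have "frechet_derivative (\<lambda>y. g (\<psi> y)) (at ?y) = frechet_derivative (\<lambda>y'. fz f (y', u y')) (at ?y)"
      by (rule frechet_derivative_cong_open[OF oO yO eq])
    also have "\<dots> = (\<lambda>h. frechet_derivative (fz f) (at (cz z)) (h, - \<Gamma> ?y h ?u))"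
      unfolding cz
      by (rule frechet_derivative_at[symmetric, OF has_derivative_compose[OF has_derivative_Pair[OF has_derivative_ident du]
              fz_has_derivative[OF f]]])
        (use ZN_D(6)[OF z] cz in simp)
    finally show ?thesis by (simp add: tvZ_def f)
  qed
  then show ?thesis
    unfolding horizontal_lift_def using tvZ_tangent[OF z] T TZ Tx par y open_N1 by blast
qed

section \<open>Vertical vectors and their complex structure\<close>

lemma vertical_space_iff:
  assumes z: "z \<in> ZN"
  shows "X \<in> vertical_space M A \<rho> z \<longleftrightarrow> X \<in> tangent_space FZ z \<and> fst (vecZ X) = 0"
proof (cases "X \<in> tangent_space FZ z")
  case X: True
  have y: "\<phi> (fst z) \<in> B" "fst z \<in> N1" "\<psi> (\<phi> (fst z)) = fst z" using ZN_D[OF z] by (auto simp: cz_def)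
  note eq = tangent_Z_fst[OF z X]
  show ?thesis
  proof
    assume "X \<in> vertical_space M A \<rho> z"
    then have "frechet_derivative (\<lambda>y. coordM b (\<psi> y)) (at (\<phi> (fst z))) (fst (vecZ X)) = 0" for b
      using eq[OF coordM_FM[of b]] coordM_FM by (simp add: vertical_space_def)
    then have "tv (fst z) (fst (vecZ X)) (coordM b) = 0" for b by (simp add: tv_apply[OF coordM_FM])
    then have "vecM (tv (fst z) (fst (vecZ X))) = 0" by (simp add: vecM_def)
    then show "X \<in> tangent_space FZ z \<and> fst (vecZ X) = 0" using vecM_tv[OF y(2)] X by simp
  next
    assume "X \<in> tangent_space FZ z \<and> fst (vecZ X) = 0"
    moreover have "frechet_derivative (\<lambda>y. g (\<psi> y)) (at (\<phi> (fst z))) 0 = 0" if "g \<in> FM" for g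
      by (intro linear_0 linear_frechet_derivative Cinf_on_differentiable[OF Cinf_on_FM[OF that] y(1)])
    ultimately show "X \<in> vertical_space M A \<rho> z" using eq by (simp add: vertical_space_def)
  qed
qed (simp add: vertical_space_def)

lemma J_unit_square: "x \<in> V \<Longrightarrow> norm u = 1 \<Longrightarrow> J x u o\<^sub>L J x u = - id_blinfun"
  by (simp add: J_mult norm_eq_1 linear_0[OF J_linear])

lemma fibre_curve_velocity_vecZ:
  assumes z: "z \<in> ZN" and X: "fibre_curve_velocity M A \<rho> z c X"
  shows "\<exists>d. (c has_vector_derivative J (fst z) d) (at 0) \<and> vecZ X = (0, d)"
proof -
  let ?x = "fst z" and ?y = "\<phi> (fst z)"
  have y: "?y \<in> B" "?x \<in> N1" "\<psi> ?y = ?x" "?x \<in> V" using ZN_D[OF z] by (auto simp: cz_def)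
  have c: "\<And>t. c t \<in> Z_fibre \<rho> ?x" "c 0 = snd z" "c differentiable (at 0)"
    "\<And>f. f \<in> FZ \<Longrightarrow> ((\<lambda>t. f (?x, c t)) has_real_derivative X f) (at 0)"
    using X by (auto simp: fibre_curve_velocity_def)
  define w where "w t = pr ?y (Tr ?x (c t))" for t
  have cw: "c t = J ?x (w t)" for t
  proof -
    obtain u where "c t = J ?x u" using c(1)[of t] Z_fibre_J[OF y(4)] by auto
    moreover from this have "w t = u" using pr_Jt[OF y(1), of u] by (simp add: w_def Jt_def y)
    ultimately show ?thesis by simp
  qed
  \<comment> \<open>The curve is known to be differentiable at 0 only. Its coordinate
    \<open>w\<close> is a fixed bounded linear function of it and inherits this.\<close>
  have ubl: "bounded_linear (\<lambda>q. pr ?y (Tr ?x q))"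
  proof -
    have t: "bounded_linear (\<lambda>q. Tr ?x q)"
    proof (rule bounded_linear_intro[of _ "norm (Blinfun (\<tau> ?x)) * norm (Blinfun (inv (\<tau> ?x)))"])
      fix q
      have "Tr ?x q = Blinfun (\<tau> ?x) o\<^sub>L q o\<^sub>L Blinfun (inv (\<tau> ?x))"
        by (rule blinfun_eqI) (simp add: Tr_apply[OF y(4)] bounded_linear_Blinfun_apply linear_conv_bounded_linear[symmetric] \<tau>[OF y(4)])
      then have "norm (Tr ?x q) \<le> norm (Blinfun (\<tau> ?x)) * norm q * norm (Blinfun (inv (\<tau> ?x)))"
        using norm_blinfun_compose[of "Blinfun (\<tau> ?x) o\<^sub>L q" "Blinfun (inv (\<tau> ?x))"] norm_blinfun_compose[of "Blinfun (\<tau> ?x)" q]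
        by (smt (verit) mult_right_mono norm_ge_zero)
      then show "norm (Tr ?x q) \<le> norm q * (norm (Blinfun (\<tau> ?x)) * norm (Blinfun (inv (\<tau> ?x))))"
        by (simp add: mult_ac)
    qed (simp_all add: Tr_alg[OF y(4)])
    have p: "bounded_linear (pr ?y)"
      unfolding pr_def trace2_def
      by (intro bounded_linear_sum bounded_linear_scaleR_const bounded_linear_const_mult bounded_linear_inner_left_comp
          bounded_linear_compose[OF blinfun.bounded_linear_left] bounded_linear_add
          bounded_bilinear.bounded_linear_left[OF bounded_bilinear_blinfun_compose]
          bounded_bilinear.bounded_linear_right[OF bounded_bilinear_blinfun_compose])
    show ?thesis by (rule bounded_linear_compose[OF p t])
  qed
  obtain c' where c': "(c has_vector_derivative c') (at 0)"
    using c(3) vector_derivative_works by blast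
  define d where "d = pr ?y (Tr ?x c')"
  have w: "(w has_vector_derivative d) (at 0)"
    unfolding w_def[abs_def] d_def by (rule bounded_linear.has_vector_derivative[OF ubl c'])
  have "bounded_linear (J ?x)" using J_linear[OF y(4)] by (simp add: linear_conv_bounded_linear)
  from bounded_linear.has_vector_derivative[OF this w] have cd: "(c has_vector_derivative J ?x d) (at 0)"
    by (simp add: cw[symmetric])
  have "X (coordZ b) = (0, d) \<bullet> b" for b
  proof -
    have "((\<lambda>t. coordZ b (?x, c t)) has_vector_derivative X (coordZ b)) (at 0)"
      using c(4)[OF coordZ_FZ] by (simp add: has_real_derivative_iff_has_vector_derivative)
    moreover have "(\<lambda>t. coordZ b (?x, c t)) = (\<lambda>t. (?y, w t) \<bullet> b)"
      by (simp add: coordZ_def \<kappa>_1[OF y(2)] cz_def cw uz_J[OF y(4)])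
    moreover have "((\<lambda>t. (?y, w t) \<bullet> b) has_vector_derivative (0, d) \<bullet> b) (at 0)"
      by (rule bounded_linear.has_vector_derivative[OF bounded_linear_inner_left
            has_vector_derivative_Pair[OF has_vector_derivative_const w]])
    ultimately show ?thesis using vector_derivative_unique_at by metis
  qed
  then show ?thesis using cd by (auto simp: vecZ_def euclidean_representation)
qed

lemma fibre_curve_velocity_exists:
  assumes z: "z \<in> ZN" and d: "uz z \<bullet> d = 0"
  shows "\<exists>c. fibre_curve_velocity M A \<rho> z c (tvZ z (0, d)) \<and> (c has_vector_derivative J (fst z) d) (at 0)"
proof -
  let ?x = "fst z" and ?y = "\<phi> (fst z)" and ?u = "uz z"
  have y: "?y \<in> B" "?x \<in> N1" "\<psi> ?y = ?x" "?x \<in> V" using ZN_D[OF z] by (auto simp: cz_def)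
  have uu: "?u \<bullet> ?u = 1" "norm ?u = 1" using ZN_D(4)[OF z] by (auto simp: norm_eq_1)
  \<comment> \<open>A straight line tangent to the sphere at \<open>uz z\<close>, which misses 0;
    normalising keeps its velocity at time 0.\<close>
  define l where "l t = ?u + t *\<^sub>R d" for t
  define w where "w t = l t /\<^sub>R norm (l t)" for t
  have "l t \<bullet> ?u = 1" for t using d by (simp add: l_def inner_add_left uu inner_commute[of d])
  then have l0: "l t \<noteq> 0" for t by (metis inner_zero_left zero_neq_one)
  then have wn: "norm (w t) = 1" for t by (simp add: w_def)
  have dl: "(l has_derivative (\<lambda>h. h *\<^sub>R d)) (at 0)" unfolding l_def[abs_def] by (auto intro!: derivative_eq_intros)
  have l_0: "l 0 = ?u" by (simp add: l_def)
  have "(w has_derivative (\<lambda>h. h *\<^sub>R d - (l 0 \<bullet> h *\<^sub>R d) *\<^sub>R l 0)) (at 0)"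
    unfolding w_def[abs_def] by (rule has_derivative_compose[OF dl has_derivative_normalize]) (simp add: l_0 uu)
  then have dw: "(w has_vector_derivative d) (at 0)" by (simp add: has_vector_derivative_def l_0 d)
  have w0: "w 0 = ?u" by (simp add: w_def l_0 uu)
  define c where "c t = J ?x (w t)" for t
  have "bounded_linear (J ?x)" using J_linear[OF y(4)] by (simp add: linear_conv_bounded_linear)
  from bounded_linear.has_vector_derivative[OF this dw] have dc: "(c has_vector_derivative J ?x d) (at 0)"
    by (simp add: c_def[abs_def])
  have "((\<lambda>t. f (?x, c t)) has_real_derivative tvZ z (0, d) f) (at 0)" if f: "f \<in> FZ" for f
  proof -
    have "((\<lambda>t. (?y, w t)) has_derivative (\<lambda>h. (0, h *\<^sub>R d))) (at 0)"
      by (rule has_derivative_Pair[OF has_derivative_const dw[unfolded has_vector_derivative_def]])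
    moreover have "(fz f has_derivative frechet_derivative (fz f) (at (cz z))) (at (?y, w 0))"
      using fz_has_derivative[OF f ZN_D(6)[OF z]] by (simp add: w0 cz_def)
    ultimately have "((\<lambda>t. fz f (?y, w t)) has_derivative (\<lambda>h. frechet_derivative (fz f) (at (cz z)) (0, h *\<^sub>R d))) (at 0)"
      by (rule has_derivative_compose)
    moreover have "fz f (?y, w t) = f (?x, c t)" for t by (simp add: fz_def zp_def y wn c_def)
    moreover have "frechet_derivative (fz f) (at (cz z)) (0, h *\<^sub>R d) = h *\<^sub>R frechet_derivative (fz f) (at (cz z)) (0, d)" for h
      using linear_scale[OF linear_frechet_derivative[OF Cinf_on_differentiable[OF fz_smooth[OF f] ZN_D(6)[OF z]]], of h "(0, d)"]
      by simp
    ultimately show ?thesis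
      by (simp add: has_real_derivative_iff_has_vector_derivative has_vector_derivative_def tvZ_def f)
  qed
  moreover have "c t \<in> Z_fibre \<rho> ?x" for t using Z_fibre_J[OF y(4)] wn by (auto simp: c_def)
  moreover have "c 0 = snd z" unfolding c_def w0 using ZN_D(5)[OF z] by (metis snd_conv)
  moreover have "c differentiable (at 0)" using dc by (auto simp: has_vector_derivative_def differentiable_def)
  ultimately show ?thesis using dc by (auto simp: fibre_curve_velocity_def)
qed

text \<open>For \<open>d\<close> orthogonal to \<open>u\<close> one has J_u J_d = J_(u x d). So the
  complex structure of the fibre, composition with J_u by
  \<open>Grassmannian_velocity_times_i\<close>, is the cross product with \<open>u\<close>.\<close>

lemma vertical_01_iff:
  assumes z: "z \<in> ZN"
  shows "(Y, Y') \<in> vertical_01 M A \<rho> z \<longleftrightarrow> Y \<in> tangent_space FZ z \<and> Y' \<in> tangent_space FZ z \<and>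
    fst (vecZ Y) = 0 \<and> fst (vecZ Y') = 0 \<and> snd (vecZ Y') = cross3 (uz z) (snd (vecZ Y))"
proof -
  let ?x = "fst z" and ?u = "uz z"
  have x: "?x \<in> V" "snd z = J ?x ?u" using ZN_D[OF z] by (auto simp: prod_eq_iff)
  have J_perp: "J ?x ?u o\<^sub>L J ?x d = J ?x (cross3 ?u d)" "J ?x d o\<^sub>L J ?x ?u = - (J ?x ?u o\<^sub>L J ?x d)" if "?u \<bullet> d = 0" for d
    using that cross_skew[of d ?u] by (simp_all add: J_mult[OF x(1)] inner_commute linear_neg[OF J_linear[OF x(1)]])
  have iff: "(\<forall>w u. (w, u) \<in> Grassmannian_velocity (\<lambda>t. eigenspace_minus_i (c t)) \<longleftrightarrow>
               (w, times_i u) \<in> Grassmannian_velocity (\<lambda>t. eigenspace_minus_i (c' t))) \<longleftrightarrow> d' = cross3 ?u d"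
    if c: "(c has_vector_derivative J ?x d) (at 0)" "fibre_curve_velocity M A \<rho> z c Y"
      and c': "(c' has_vector_derivative J ?x d') (at 0)" "fibre_curve_velocity M A \<rho> z c' Y'"
      and d: "?u \<bullet> d = 0" for c c' d d' Y Y'
  proof -
    have sq: "c t o\<^sub>L c t = - id_blinfun" "c' t o\<^sub>L c' t = - id_blinfun" for t
    proof -
      have "c t \<in> Z_fibre \<rho> ?x" "c' t \<in> Z_fibre \<rho> ?x" using c(2) c'(2) by (auto simp: fibre_curve_velocity_def)
      then obtain u u' where "c t = J ?x u" "norm u = 1" "c' t = J ?x u'" "norm u' = 1"
        using Z_fibre_J[OF x(1)] by auto
      then show "c t o\<^sub>L c t = - id_blinfun" "c' t o\<^sub>L c' t = - id_blinfun" using J_unit_square[OF x(1)] by auto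
    qed
    have "c 0 = J ?x ?u" "c' 0 = J ?x ?u" using c(2) c'(2) x(2) by (auto simp: fibre_curve_velocity_def)
    from Grassmannian_velocity_times_i[OF c(1) sq(1) c'(1) sq(2) this J_perp(2)[OF d]]
    show ?thesis unfolding J_perp(1)[OF d] J_eq_iff_V[OF x(1)] .
  qed
  show ?thesis
  proof
    assume "(Y, Y') \<in> vertical_01 M A \<rho> z"
    then obtain c c' where Y: "Y \<in> vertical_space M A \<rho> z" "Y' \<in> vertical_space M A \<rho> z"
      and c: "fibre_curve_velocity M A \<rho> z c Y" "fibre_curve_velocity M A \<rho> z c' Y'"
      and G: "\<forall>w u. (w, u) \<in> Grassmannian_velocity (\<lambda>t. eigenspace_minus_i (c t)) \<longleftrightarrow>
               (w, times_i u) \<in> Grassmannian_velocity (\<lambda>t. eigenspace_minus_i (c' t))"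
      unfolding vertical_01_def fibre_complex_structure_def by blast
    obtain d where d: "(c has_vector_derivative J ?x d) (at 0)" "vecZ Y = (0, d)"
      using fibre_curve_velocity_vecZ[OF z c(1)] by auto
    obtain d' where d': "(c' has_vector_derivative J ?x d') (at 0)" "vecZ Y' = (0, d')"
      using fibre_curve_velocity_vecZ[OF z c(2)] by auto
    have Y': "Y \<in> tangent_space FZ z" "Y' \<in> tangent_space FZ z" using Y vertical_space_iff[OF z] by auto
    have "?u \<bullet> d = 0" using vecZ_perp[OF z Y'(1)] d(2) by simp
    then have "d' = cross3 ?u d" using iff[OF d(1) c(1) d'(1) c(2)] G by blast
    then show "Y \<in> tangent_space FZ z \<and> Y' \<in> tangent_space FZ z \<and>
      fst (vecZ Y) = 0 \<and> fst (vecZ Y') = 0 \<and> snd (vecZ Y') = cross3 (uz z) (snd (vecZ Y))"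
      using Y' d(2) d'(2) by simp
  next
    assume a: "Y \<in> tangent_space FZ z \<and> Y' \<in> tangent_space FZ z \<and>
      fst (vecZ Y) = 0 \<and> fst (vecZ Y') = 0 \<and> snd (vecZ Y') = cross3 (uz z) (snd (vecZ Y))"
    let ?d = "snd (vecZ Y)" and ?d' = "snd (vecZ Y')"
    have p: "?u \<bullet> ?d = 0" "?u \<bullet> ?d' = 0" using vecZ_perp[OF z, of Y] vecZ_perp[OF z, of Y'] a by blast+
    have v: "vecZ Y = (0, ?d)" "vecZ Y' = (0, ?d')" using a by (simp_all add: prod_eq_iff)
    have Y: "tvZ z (0, ?d) = Y" "tvZ z (0, ?d') = Y'" using tvZ_vecZ[OF z] a v by metis+
    obtain c where c: "fibre_curve_velocity M A \<rho> z c Y" "(c has_vector_derivative J ?x ?d) (at 0)"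
      using fibre_curve_velocity_exists[OF z p(1)] Y by auto
    obtain c' where c': "fibre_curve_velocity M A \<rho> z c' Y'" "(c' has_vector_derivative J ?x ?d') (at 0)"
      using fibre_curve_velocity_exists[OF z p(2)] Y by auto
    have "fibre_complex_structure M A \<rho> z Y Y'"
      unfolding fibre_complex_structure_def
      using iff[OF c(2,1) c'(2,1) p(1)] a c(1) c'(1) vertical_space_iff[OF z] by blast
    then show "(Y, Y') \<in> vertical_01 M A \<rho> z" by (simp add: vertical_01_def)
  qed
qed

lemma twistor_C_iff:
  assumes z: "z \<in> ZN"
  shows "(X1, X2) \<in> twistor_C M E A \<rho> \<iota> nab z \<longleftrightarrow> X1 \<in> tangent_space FZ z \<and> X2 \<in> tangent_space FZ z \<and>
    \<epsilon> (\<phi> (fst z)) (fst (vecZ X2)) = blinfun_apply (Jt (\<phi> (fst z)) (uz z)) (\<epsilon> (\<phi> (fst z)) (fst (vecZ X1))) \<and>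
    \<zeta> (cz z) (vecZ X2) = cross3 (uz z) (\<zeta> (cz z) (vecZ X1))"
proof -
  let ?x = "fst z" and ?y = "\<phi> (fst z)" and ?u = "uz z"
  have y: "?y \<in> B" "?x \<in> N1" "\<psi> ?y = ?x" "?x \<in> V" "snd z = J ?x ?u" using ZN_D[OF z] by (auto simp: cz_def prod_eq_iff)
  have cz: "fst (cz z) = ?y" "snd (cz z) = ?u" by (simp_all add: cz_def)
  have un: "norm ?u = 1" by (rule ZN_D(4)[OF z])
  have eig: "(\<iota> ?x v1, \<iota> ?x v2) \<in> eigenspace_minus_i (snd z) \<longleftrightarrow>
      \<epsilon> ?y (vecM v2) = blinfun_apply (Jt ?y ?u) (\<epsilon> ?y (vecM v1))"
    if v: "v1 \<in> tangent_space FM ?x" "v2 \<in> tangent_space FM ?x" for v1 v2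
  proof -
    have e: "\<epsilon> ?y (vecM v) = \<tau> ?x (\<iota> ?x v)" if "v \<in> tangent_space FM ?x" for v
      by (simp add: \<epsilon>_def y tv_vecM[OF y(2) that])
    \<comment> \<open>Since \<open>J\<close> squares to -1, one of the two real equations defining
      the eigenspace implies the other.\<close>
    have "blinfun_apply (J ?x ?u) (blinfun_apply (J ?x ?u) w) = - w" for w
      using J_unit_square[OF y(4) un] by (metis blinfun_apply_blinfun_compose blinfun.minus_left id_blinfun.rep_eq)
    then have "(\<iota> ?x v1, \<iota> ?x v2) \<in> eigenspace_minus_i (snd z) \<longleftrightarrow> \<iota> ?x v2 = blinfun_apply (J ?x ?u) (\<iota> ?x v1)"
      by (auto simp: eigenspace_minus_i_iff y(5))
    also have "\<dots> \<longleftrightarrow> \<tau> ?x (\<iota> ?x v2) = \<tau> ?x (blinfun_apply (J ?x ?u) (\<iota> ?x v1))"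
      using \<tau>(5)[OF y(4)] by metis
    finally show ?thesis
      by (simp add: e v Jt_def y(3) Tr_apply[OF y(4)] \<tau>(5)[OF y(4)])
  qed
  have skew: "?u \<bullet> \<Gamma> ?y a ?u = 0" for a using \<Gamma>_skew[OF y(1)] by (simp add: inner_commute)
  show ?thesis
  proof
    assume "(X1, X2) \<in> twistor_C M E A \<rho> \<iota> nab z"
    then obtain H1 H2 Y1 Y2 where X: "X1 = (\<lambda>f. H1 f + Y1 f)" "X2 = (\<lambda>f. H2 f + Y2 f)"
      and H: "(H1, H2) \<in> twistor_B M E A \<rho> \<iota> nab z" and Y: "(Y1, Y2) \<in> vertical_01 M A \<rho> z"
      unfolding twistor_C_def by blast
    obtain v1 v2 where v: "v1 \<in> tangent_space FM ?x" "v2 \<in> tangent_space FM ?x"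
      "(\<iota> ?x v1, \<iota> ?x v2) \<in> eigenspace_minus_i (snd z)"
      "horizontal_lift M E A \<rho> nab z v1 H1" "horizontal_lift M E A \<rho> nab z v2 H2"
      using H unfolding twistor_B_def by auto
    note h1 = horizontal_lift_vecZ[OF z v(1,4)] and h2 = horizontal_lift_vecZ[OF z v(2,5)]
    note Y' = Y[unfolded vertical_01_iff[OF z]]
    have "(\<lambda>f. 1 * H1 f + 1 * Y1 f) \<in> tangent_space FZ z" "(\<lambda>f. 1 * H2 f + 1 * Y2 f) \<in> tangent_space FZ z"
      using FZ.tangent_space_lincomb h1(1) h2(1) Y' by blast+
    then have XT: "X1 \<in> tangent_space FZ z" "X2 \<in> tangent_space FZ z" by (simp_all add: X)
    have vec: "fst (vecZ X1) = vecM v1" "fst (vecZ X2) = vecM v2"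
      "\<zeta> (cz z) (vecZ X1) = snd (vecZ Y1)" "\<zeta> (cz z) (vecZ X2) = snd (vecZ Y2)"
      using Y' by (simp_all add: X vecZ_add h1(2) h2(2) \<zeta>_def cz)
    show "X1 \<in> tangent_space FZ z \<and> X2 \<in> tangent_space FZ z \<and>
      \<epsilon> ?y (fst (vecZ X2)) = blinfun_apply (Jt ?y ?u) (\<epsilon> ?y (fst (vecZ X1))) \<and>
      \<zeta> (cz z) (vecZ X2) = cross3 ?u (\<zeta> (cz z) (vecZ X1))"
      unfolding vec using XT eig[OF v(1,2)] v(3) Y' by blast
  next
    assume a: "X1 \<in> tangent_space FZ z \<and> X2 \<in> tangent_space FZ z \<and>
      \<epsilon> ?y (fst (vecZ X2)) = blinfun_apply (Jt ?y ?u) (\<epsilon> ?y (fst (vecZ X1))) \<and>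
      \<zeta> (cz z) (vecZ X2) = cross3 ?u (\<zeta> (cz z) (vecZ X1))"
    \<comment> \<open>The splitting of a tangent vector of \<open>Z\<close>: \<open>H\<close> is the
      horizontal lift of its projection and \<open>Y\<close> the vertical vector with coordinate
      \<open>\<zeta>\<close>. Both are tangent to the sphere by skewness of
      \<open>\<Gamma>\<close>.\<close>
    define H where "H X = tvZ z (fst (vecZ X), - \<Gamma> ?y (fst (vecZ X)) ?u)" for X
    define Y where "Y X = tvZ z (0, \<zeta> (cz z) (vecZ X))" for X
    have HT: "H X \<in> tangent_space FZ z" "vecZ (H X) = (fst (vecZ X), - \<Gamma> ?y (fst (vecZ X)) ?u)" for X
      unfolding H_def by (rule tvZ_tangent[OF z], rule vecZ_tvZ[OF z]) (simp add: skew)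
    have YT: "Y X \<in> tangent_space FZ z" "vecZ (Y X) = (0, \<zeta> (cz z) (vecZ X))" if "X \<in> tangent_space FZ z" for X
      unfolding Y_def using vecZ_perp[OF z that]
      by (intro tvZ_tangent[OF z] vecZ_tvZ[OF z]; simp add: \<zeta>_def cz skew inner_add_right)+
    have split: "X = (\<lambda>f. H X f + Y X f)" if X: "X \<in> tangent_space FZ z" for X
    proof (rule vecZ_eqD[OF z X])
      show "(\<lambda>f. H X f + Y X f) \<in> tangent_space FZ z"
        using FZ.tangent_space_lincomb[OF HT(1) YT(1)[OF X], of 1 X 1] by simp
      show "vecZ X = vecZ (\<lambda>f. H X f + Y X f)"
        by (simp add: vecZ_add HT(2) YT(2)[OF X] prod_eq_iff \<zeta>_def cz)
    qed
    have hl: "horizontal_lift M E A \<rho> nab z (tv ?x (fst (vecZ X))) (H X)" for X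
      using horizontal_lift_exists[OF z tangent_tv[OF y(2)], of "fst (vecZ X)"] by (simp add: vecM_tv[OF y(2)] H_def)
    have "(H X1, H X2) \<in> twistor_B M E A \<rho> \<iota> nab z"
      unfolding twistor_B_def
      using hl tangent_tv[OF y(2)] a eig[OF tangent_tv[OF y(2)] tangent_tv[OF y(2)], of "fst (vecZ X1)" "fst (vecZ X2)"]
      by (auto simp: vecM_tv[OF y(2)])
    moreover have "(Y X1, Y X2) \<in> vertical_01 M A \<rho> z"
      unfolding vertical_01_iff[OF z] using YT a by simp
    moreover have "X1 = (\<lambda>f. H X1 f + Y X1 f)" "X2 = (\<lambda>f. H X2 f + Y X2 f)" using split a by blast+
    ultimately show "(X1, X2) \<in> twistor_C M E A \<rho> \<iota> nab z"
      unfolding twistor_C_def by blast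
  qed
qed

end

section \<open>Curvature\<close>

text \<open>Twice Lagrange's identity: \<open>u\<close> annihilates the double product, hence
  \<open>cross3 v w\<close> equals its projection to \<open>u\<close>. Geometrically, two vectors of
  the plane orthogonal to \<open>u\<close> have product along \<open>u\<close>.\<close>

lemma cross_perp_parallel:
  fixes u v w :: "real ^ 3"
  assumes "norm u = 1" "u \<bullet> v = 0" "u \<bullet> w = 0"
  shows "cross3 v w = (u \<bullet> cross3 v w) *\<^sub>R u"
proof -
  have uu: "u \<bullet> u = 1" using assms(1) by (simp add: norm_eq_1)
  have "cross3 u (cross3 v w) = 0"
    using assms(2,3) by (simp add: Lagrange inner_commute)
  moreover have "cross3 u (cross3 u (cross3 v w)) = (u \<bullet> cross3 v w) *\<^sub>R u - (u \<bullet> u) *\<^sub>R cross3 v w"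
    by (rule Lagrange)
  ultimately show ?thesis by (simp add: uu)
qed

text \<open>The vectors \<open>a\<close> with \<open>J (\<epsilon> a)\<close> in the image of \<open>\<epsilon>\<close> form a space of real dimension
  \<open>2 (2 k - l)\<close>, on which \<open>J\<close> induces a complex structure; its complexification contains the
  \<open>\<epsilon>\<close>-preimage of the eigenspace of \<open>J\<close> as the graph of that structure.  If the dimension is at
  least 6, the first Bianchi identity for a third vector independent of the first two and their
  images under \<open>J\<close> gives the claim; if it is 2, antisymmetry does.\<close>

lemma curvature_type:
  fixes \<epsilon> :: "'n::euclidean_space \<Rightarrow> 'v::euclidean_space" and J :: "real ^ 3 \<Rightarrow> 'v \<Rightarrow>\<^sub>L 'v"
    and R :: "'n \<Rightarrow> 'n \<Rightarrow> 'v \<Rightarrow>\<^sub>L 'v" and g :: "'n \<Rightarrow> 'n \<Rightarrow> real ^ 3" and u :: "real ^ 3"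
  assumes \<epsilon>: "linear \<epsilon>" "inj \<epsilon>" and J: "linear J" "\<And>v w. J v o\<^sub>L J w = - (v \<bullet> w) *\<^sub>R id_blinfun + J (cross3 v w)"
    and u: "norm u = 1" and span: "\<And>w. \<exists>a b. w = \<epsilon> a + blinfun_apply (J u) (\<epsilon> b)"
    and g: "\<And>a. linear (g a)" "\<And>a b. g b a = - g a b" "\<And>a b. u \<bullet> g a b = 0"
    and K: "\<And>a b. (R a b o\<^sub>L J u) - (J u o\<^sub>L R a b) = J (g a b)"
    and Bianchi: "\<And>a b c. blinfun_apply (R a b) (\<epsilon> c) + blinfun_apply (R b c) (\<epsilon> a) + blinfun_apply (R c a) (\<epsilon> b) = 0"
    and dim: "DIM('v) = 4 * k" "DIM('n) = 4 * k - l" "l \<le> 2 * k - 1" "2 * k - l \<noteq> 2"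
    and a: "\<epsilon> a' = blinfun_apply (J u) (\<epsilon> a)" and b: "\<epsilon> b' = blinfun_apply (J u) (\<epsilon> b)"
  shows "g a b' + g a' b = cross3 u (g a b - g a' b')"
proof -
  let ?J = "blinfun_apply (J u)"
  have uu: "u \<bullet> u = 1" using u by (simp add: norm_eq_1)
  have Jmul: "blinfun_apply (J v) (blinfun_apply (J w) x) = - (v \<bullet> w) *\<^sub>R x + blinfun_apply (J (cross3 v w)) x" for v w x
    using J(2)[of v w] by (metis blinfun.add_left blinfun.scaleR_left blinfun_apply_blinfun_compose id_blinfun.rep_eq)
  have JJ: "?J (?J x) = - x" for x using Jmul[of u u x] by (simp add: uu linear_0[OF J(1)])
  have Kx: "blinfun_apply (J (g p q)) x = blinfun_apply (R p q) (?J x) - ?J (blinfun_apply (R p q) x)" for p q x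
    using K[of p q] by (metis blinfun.diff_left blinfun_apply_blinfun_compose)
  note g_add = linear_add[OF g(1)] and g_scale = linear_scale[OF g(1)]
  have gl: "g (p + q) r = g p r + g q r" "g (c *\<^sub>R p) r = c *\<^sub>R g p r" "g p p = 0" for p q r c
  proof -
    show "g (p + q) r = g p r + g q r" by (simp only: g(2)[of "p + q" r] g(2)[of p r] g(2)[of q r] g_add minus_add_distrib)
    show "g (c *\<^sub>R p) r = c *\<^sub>R g p r" by (simp only: g(2)[of "c *\<^sub>R p" r] g(2)[of p r] g_scale scaleR_minus_right)
    have "g p p $ i = - (g p p $ i)" for i using g(2)[of p p] by (metis vector_uminus_component)
    then have "g p p $ i = 0" for i using equal_neg_zero by blast
    then show "g p p = 0" by (simp add: vec_eq_iff)
  qed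
  \<comment> \<open>With X = p + i p' and Y = q + i q', the complex value g(X, Y) is P + i Q. On the
    eigenspace i acts as -J, so J_P + i J_Q agrees there with J_P + J_u J_Q, which is J_h for h = P
    + u x Q. The claim is equivalent to h = 0.\<close>
  define h where "h p p' q q' = (g p q - g p' q') + cross3 u (g p q' + g p' q)" for p p' q q'
  have hperp: "u \<bullet> h p p' q q' = 0" for p p' q q' by (simp add: h_def inner_add_right inner_diff_right g(3) dot_cross_self)
  have Jh: "blinfun_apply (J (h p p' q q')) x = blinfun_apply (J (g p q)) x - blinfun_apply (J (g p' q')) x
      + ?J (blinfun_apply (J (g p q')) x) + ?J (blinfun_apply (J (g p' q)) x)" for p p' q q' x
    by (simp add: h_def Jmul g(3) linear_add[OF J(1)] linear_diff[OF J(1)] cross_add_right blinfun.add_left blinfun.diff_left)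
  \<comment> \<open>The complexified first Bianchi identity, composed with \<open>J\<close> on
    either side and read on real parts.\<close>
  have cyc: "blinfun_apply (J (h p p' q q')) (\<epsilon> s) + blinfun_apply (J (h q q' s s')) (\<epsilon> p) + blinfun_apply (J (h s s' p p')) (\<epsilon> q) = 0"
    if p: "\<epsilon> p' = ?J (\<epsilon> p)" and q: "\<epsilon> q' = ?J (\<epsilon> q)" and s: "\<epsilon> s' = ?J (\<epsilon> s)" for p p' q q' s s'
  proof -
    define W where "W x y z = blinfun_apply (R x y) (\<epsilon> z)" for x y z
    have KW: "blinfun_apply (J (g x y)) (\<epsilon> z) = W x y z' - ?J (W x y z)" if "\<epsilon> z' = ?J (\<epsilon> z)" for x y z z'
      unfolding Kx W_def that ..
    have "blinfun_apply (J (h p p' q q')) (\<epsilon> s) + blinfun_apply (J (h q q' s s')) (\<epsilon> p) + blinfun_apply (J (h s s' p p')) (\<epsilon> q)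
      = (W p q s' + W q s p' + W s p q') + (W p q' s + W q s' p + W s p' q) + (W p' q s + W q' s p + W s' p q)
        - (W p' q' s' + W q' s' p' + W s' p' q')
        - ?J (W p q s + W q s p + W s p q)
        + ?J ((W p' q' s + W q' s' p + W s' p' q) + (W p q' s' + W q s' p' + W s p' q') + (W p' q s' + W q' s p' + W s' p q'))"
      unfolding Jh KW[OF p] KW[OF q] KW[OF s]
      by (simp add: blinfun.add_right blinfun.diff_right JJ algebra_simps)
    \<comment> \<open>Regrouped so that each of the eight ways to place primes on \<open>p\<close>,
      \<open>q\<close>, \<open>s\<close> contributes one full cyclic sum.\<close>
    also have "\<dots> = (W p q s' + W q s' p + W s' p q) + (W p q' s + W q' s p + W s p q') + (W p' q s + W q s p' + W s p' q)
        - (W p' q' s' + W q' s' p' + W s' p' q')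
        - ?J (W p q s + W q s p + W s p q)
        + ?J ((W p' q' s + W q' s p' + W s p' q') + (W p q' s' + W q' s' p + W s' p q') + (W p' q s' + W q s' p' + W s' p' q))"
      by (simp add: algebra_simps)
    also have "\<dots> = 0" using Bianchi by (simp add: W_def)
    finally show ?thesis .
  qed
  have "h a a' b b' = 0"
  proof -
    \<comment> \<open>The real subspace that is identified with the preimage of the eigenspace by
      taking real parts.\<close>
    define H where "H = {p. \<exists>p'. \<epsilon> p' = ?J (\<epsilon> p)}"
    have aH: "a \<in> H" "b \<in> H" "a' \<in> H" "b' \<in> H"
      using a b JJ[of "\<epsilon> a"] JJ[of "\<epsilon> b"] linear_neg[OF \<epsilon>(1), of a] linear_neg[OF \<epsilon>(1), of b]
      by (auto simp: H_def)
    \<comment> \<open>The images of \<open>\<epsilon>\<close> and of \<open>J\<close> after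
      \<open>\<epsilon>\<close> span the fibre, so the dimension formula gives that of their
      intersection. The equation is additive to avoid truncated subtraction.\<close>
    have dimH: "dim H + 4 * k = 2 * (4 * k - l)"
    proof -
      have linJ: "linear ?J" by (rule bounded_linear.linear[OF blinfun.bounded_linear_right])
      have injJ: "inj ?J" using JJ by (metis injI neg_equal_iff_equal)
      have sub: "subspace (range \<epsilon>)" "subspace (?J ` range \<epsilon>)"
        using \<epsilon>(1) linJ by (auto intro!: linear_subspace_image)
      have dims: "dim (range \<epsilon>) = 4 * k - l" "dim (?J ` range \<epsilon>) = 4 * k - l"
        using dim_image_eq[OF \<epsilon>(1), of UNIV] dim_image_eq[OF linJ, of "range \<epsilon>"] \<epsilon>(2) injJ dim(2)
        by (auto intro: inj_on_subset)
      have "\<exists>x y. w = x + y \<and> x \<in> range \<epsilon> \<and> y \<in> ?J ` range \<epsilon>" for w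
        using span[of w] by (metis image_eqI rangeI)
      then have "{x + y | x y. x \<in> range \<epsilon> \<and> y \<in> ?J ` range \<epsilon>} = UNIV" by blast
      then have "4 * k + dim (range \<epsilon> \<inter> ?J ` range \<epsilon>) = 2 * (4 * k - l)"
        using dim_sums_Int[OF sub] dims dim(1) by simp
      moreover have "\<epsilon> ` H = range \<epsilon> \<inter> ?J ` range \<epsilon>"
      proof (intro set_eqI iffI)
        fix x assume "x \<in> \<epsilon> ` H"
        then obtain p p' where p: "x = \<epsilon> p" "\<epsilon> p' = ?J (\<epsilon> p)" by (auto simp: H_def)
        have "x = ?J (\<epsilon> (- p'))" by (simp add: linear_neg[OF \<epsilon>(1)] p blinfun.minus_right JJ)
        then show "x \<in> range \<epsilon> \<inter> ?J ` range \<epsilon>" using p(1) by blast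
      next
        fix x assume x: "x \<in> range \<epsilon> \<inter> ?J ` range \<epsilon>"
        obtain p where p: "x = \<epsilon> p" using x by blast
        obtain q where q: "x = ?J (\<epsilon> q)" using x by blast
        have "\<epsilon> (- q) = ?J (\<epsilon> p)" by (simp only: p[symmetric] q JJ linear_neg[OF \<epsilon>(1)])
        then show "x \<in> \<epsilon> ` H" using p by (auto simp: H_def)
      qed
      moreover have "dim (\<epsilon> ` H) = dim H" by (rule dim_image_eq[OF \<epsilon>(1)]) (rule inj_on_subset[OF \<epsilon>(2)], simp)
      ultimately show ?thesis by simp
    qed
    \<comment> \<open>With natural subtraction, \<open>l \<le> 2 * k - 1\<close> means
      \<open>l < 2 * k\<close> only for positive \<open>k\<close>.\<close>
    have k: "k \<ge> 1" using dim(1) DIM_positive[where 'a = 'v] by linarith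
    let ?S = "span {a, a', b, b'}"
    show ?thesis
    proof (cases "H \<subseteq> ?S")
      case False
      then obtain c c' where c: "c \<notin> ?S" "\<epsilon> c' = ?J (\<epsilon> c)" by (auto simp: H_def)
      let ?h = "h a a' b b'"
      \<comment> \<open>J_h J_w is -(h . w) plus J of h x w, and h x w is a multiple of
        \<open>u\<close>. So it maps the image of \<open>a\<close> or \<open>b\<close> into the
        image of the span of that vector and its partner.\<close>
      have prod: "\<exists>p\<in>?S. blinfun_apply (J ?h) (blinfun_apply (J w) (\<epsilon> q)) = \<epsilon> p"
        if w: "u \<bullet> w = 0" and q: "q \<in> {a, b}" for w q
      proof -
        obtain q' where q': "q' \<in> {a', b'}" "\<epsilon> q' = ?J (\<epsilon> q)" using q a b by auto
        obtain s where s: "cross3 ?h w = s *\<^sub>R u" using cross_perp_parallel[OF u hperp w] by metis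
        have "blinfun_apply (J ?h) (blinfun_apply (J w) (\<epsilon> q)) = \<epsilon> (- (?h \<bullet> w) *\<^sub>R q + s *\<^sub>R q')"
          by (simp add: Jmul s linear_scale[OF J(1)] blinfun.scaleR_left linear_add[OF \<epsilon>(1)] linear_scale[OF \<epsilon>(1)] linear_diff[OF \<epsilon>(1)] q')
        moreover have "- (?h \<bullet> w) *\<^sub>R q + s *\<^sub>R q' \<in> ?S"
          using q q'(1) by (intro span_add span_scale span_base) auto
        ultimately show ?thesis by blast
      qed
      obtain p1 where p1: "p1 \<in> ?S" "blinfun_apply (J ?h) (blinfun_apply (J (h b b' c c')) (\<epsilon> a)) = \<epsilon> p1"
        using prod[OF hperp, of a] by blast
      obtain p2 where p2: "p2 \<in> ?S" "blinfun_apply (J ?h) (blinfun_apply (J (h c c' a a')) (\<epsilon> b)) = \<epsilon> p2"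
        using prod[OF hperp, of b] by blast
      have "blinfun_apply (J ?h) (blinfun_apply (J ?h) (\<epsilon> c) + blinfun_apply (J (h b b' c c')) (\<epsilon> a) + blinfun_apply (J (h c c' a a')) (\<epsilon> b)) = 0"
        using cyc[OF a b c(2)] by simp
      then have "blinfun_apply (J ?h) (blinfun_apply (J ?h) (\<epsilon> c)) + \<epsilon> p1 + \<epsilon> p2 = 0"
        by (simp add: blinfun.add_right p1(2) p2(2))
      moreover have "blinfun_apply (J ?h) (blinfun_apply (J ?h) (\<epsilon> c)) = - (?h \<bullet> ?h) *\<^sub>R \<epsilon> c"
        by (simp add: Jmul linear_0[OF J(1)])
      ultimately have "\<epsilon> ((?h \<bullet> ?h) *\<^sub>R c) = \<epsilon> (p1 + p2)"
        by (simp add: linear_add[OF \<epsilon>(1)] linear_scale[OF \<epsilon>(1)] add_eq_0_iff algebra_simps)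
      \<comment> \<open>J_h applied to the cyclic identity makes the \<open>c\<close> term a
        multiple of \<open>c\<close> by the squared length of h and puts the other two into the
        span. As \<open>c\<close> is outside, h vanishes.\<close>
      then have eq: "(?h \<bullet> ?h) *\<^sub>R c = p1 + p2" using \<epsilon>(2) by (simp add: inj_eq)
      show ?thesis
      proof (rule ccontr)
        assume "?h \<noteq> 0"
        then have "c = (1 / (?h \<bullet> ?h)) *\<^sub>R (p1 + p2)" by (simp add: eq[symmetric])
        then have "c \<in> ?S" using p1(1) p2(1) by (simp add: span_add span_scale)
        then show False using c(1) by blast
      qed
    next
      case True
      have "dim H \<le> card {a, a', b, b'}"
        using dim_subset[OF True] dim_le_card'[of "{a, a', b, b'}"] by (simp add: dim_span)
      also have "\<dots> \<le> 4" by (simp add: card_insert_if)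
      \<comment> \<open>\<open>dim H\<close> is twice \<open>2 * k - l\<close>, a positive number
        different from 2; so the bound 4 leaves only 2.\<close>
      finally have dim2: "dim H = 2" using dimH dim(3,4) k by linarith
      show ?thesis
      proof (cases "a = 0")
        case True
        then have "\<epsilon> a' = \<epsilon> 0" using a by (simp add: linear_0[OF \<epsilon>(1)] blinfun.zero_right)
        then have "a' = 0" using \<epsilon>(2) by (simp add: inj_eq)
        then show ?thesis using True gl(2)[of 0 0 b] gl(2)[of 0 0 b'] by (simp add: h_def)
      next
        case a0: False
        have "\<epsilon> a \<noteq> 0" using a0 \<epsilon> linear_0[OF \<epsilon>(1)] by (metis inj_eq)
        \<comment> \<open>A real eigenvalue of \<open>J\<close> would have square -1.\<close>
        have ind: "a' \<noteq> t *\<^sub>R a" for t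
        proof
          assume "a' = t *\<^sub>R a"
          then have "?J (\<epsilon> a) = t *\<^sub>R \<epsilon> a" using a by (simp add: linear_scale[OF \<epsilon>(1)])
          then have "?J (?J (\<epsilon> a)) = (t * t) *\<^sub>R \<epsilon> a" by (simp add: blinfun.scaleR_right)
          then have "(t * t) *\<^sub>R \<epsilon> a = - \<epsilon> a" by (simp only: JJ)
          then have "(t * t + 1) *\<^sub>R \<epsilon> a = 0" by (simp only: scaleR_left_distrib scaleR_one add.left_inverse)
          moreover have "t * t + 1 > 0" by (simp add: add_nonneg_pos)
          ultimately show False using \<open>\<epsilon> a \<noteq> 0\<close> by simp
        qed
        have "a' \<notin> span {a}" using ind by (auto simp: span_singleton)
        then have indep: "independent {a', a}" using a0 by (simp add: independent_insert dependent_single)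
        have "a' \<noteq> a" using ind[of 1] by simp
        then have "card {a', a} = 2" by simp
        then have "H \<subseteq> span {a', a}"
          using card_ge_dim_independent[OF _ indep, of H] aH dim2 by auto
        then have "b \<in> span {a', a}" using aH by auto
        then obtain t where "b - t *\<^sub>R a' \<in> span {a}" by (auto simp: span_insert)
        then obtain s where "b - t *\<^sub>R a' = s *\<^sub>R a" by (auto simp: span_singleton)
        then have bst: "b = s *\<^sub>R a + t *\<^sub>R a'" by (simp add: algebra_simps)
        have "\<epsilon> b' = \<epsilon> (s *\<^sub>R a' - t *\<^sub>R a)"
          unfolding b bst
          by (simp add: linear_add[OF \<epsilon>(1)] linear_scale[OF \<epsilon>(1)] linear_diff[OF \<epsilon>(1)] blinfun.add_right blinfun.scaleR_right a JJ)
        then have b'st: "b' = s *\<^sub>R a' + (- t) *\<^sub>R a" using \<epsilon>(2) by (simp add: inj_eq)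
        show ?thesis
          unfolding h_def bst b'st using g(2)[of a a'] by (simp add: g_add g_scale linear_diff[OF g(1)] linear_neg[OF g(1)] gl)
      qed
    qed
  qed
  \<comment> \<open>The equation h = 0 multiplied by \<open>u\<close>: on vectors orthogonal to
    \<open>u\<close>, the cross product with \<open>u\<close> squares to -1.\<close>
  then have "cross3 u (g a b - g a' b') + cross3 u (cross3 u (g a b' + g a' b)) = 0"
    by (simp add: h_def cross_add_right[symmetric])
  moreover have "cross3 u (cross3 u (g a b' + g a' b)) = - (g a b' + g a' b)"
    by (simp add: Lagrange uu inner_add_right g(3))
  ultimately show ?thesis by (simp only: eq_neg_iff_add_eq_0 add_uminus_conv_diff right_minus_eq)
qed

text \<open>Reduced to the scalar case by the functionals "evaluate at \<open>t\<close> and pair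
  with \<open>b\<close>", which separate operators and commute with differentiation.\<close>

lemma frechet_derivative_commute_blinfun:
  fixes F :: "'a::euclidean_space \<Rightarrow> ('b::real_normed_vector \<Rightarrow>\<^sub>L 'c::euclidean_space)"
  assumes S: "open S" "p \<in> S" and F: "Cinf_on S F"
  shows "frechet_derivative (\<lambda>x. frechet_derivative F (at x) v) (at p) w
       = frechet_derivative (\<lambda>x. frechet_derivative F (at x) w) (at p) v"
proof (rule blinfun_eqI, rule euclidean_eqI)
  fix t and b :: 'c
  let ?L = "\<lambda>B :: 'b \<Rightarrow>\<^sub>L 'c. blinfun_apply B t \<bullet> b"
  have L: "bounded_linear ?L"
    by (rule bounded_linear_inner_left_comp[OF blinfun.bounded_linear_left])
  have D: "frechet_derivative (\<lambda>x. ?L (G x)) (at x) v = ?L (frechet_derivative G (at x) v)"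
    if "Cinf_on S G" "x \<in> S" for G :: "'a \<Rightarrow> 'b \<Rightarrow>\<^sub>L 'c" and x v
    by (simp add: frechet_derivative_at[symmetric, OF bounded_linear.has_derivative[OF L Cinf_on_has_derivative[OF that]]])
  have D2: "frechet_derivative (\<lambda>x. frechet_derivative (\<lambda>x. ?L (F x)) (at x) v) (at p) w
      = ?L (frechet_derivative (\<lambda>x. frechet_derivative F (at x) v) (at p) w)" for v w
  proof -
    have "frechet_derivative (\<lambda>x. frechet_derivative (\<lambda>x. ?L (F x)) (at x) v) (at p)
      = frechet_derivative (\<lambda>x. ?L (frechet_derivative F (at x) v)) (at p)"
      by (rule frechet_derivative_cong_open[OF S]) (rule D[OF F])
    then show ?thesis by (simp only: D[OF Cinf_on_frechet_derivative[OF F] S(2)])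
  qed
  have "Ck_on 2 S (\<lambda>x. ?L (F x))" using Cinf_on_bounded_linear[OF L S(1) F] by (simp add: Cinf_on_def)
  from frechet_derivative_commute[OF S this, of v w]
  show "?L (frechet_derivative (\<lambda>x. frechet_derivative F (at x) v) (at p) w)
    = ?L (frechet_derivative (\<lambda>x. frechet_derivative F (at x) w) (at p) v)"
    unfolding D2 .
qed

context cr_chart
begin

text \<open>Operator-valued versions of the forms. One derivative in \<open>y\<close> then serves
  all arguments, and products with varying arguments can be differentiated.\<close>

definition \<omega>b :: "'n \<Rightarrow> 'n \<Rightarrow>\<^sub>L ('v \<Rightarrow>\<^sub>L 'v)" where "\<omega>b y = Blinfun (\<omega> y)"
definition \<epsilon>b :: "'n \<Rightarrow> 'n \<Rightarrow>\<^sub>L 'v" where "\<epsilon>b y = Blinfun (\<epsilon> y)"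
definition \<Gamma>b :: "'n \<Rightarrow> 'n \<Rightarrow>\<^sub>L ((real ^ 3) \<Rightarrow>\<^sub>L (real ^ 3))" where "\<Gamma>b y = Blinfun (\<lambda>a. Blinfun (\<Gamma> y a))"

lemma \<omega>b_apply: "y \<in> B \<Longrightarrow> blinfun_apply (\<omega>b y) a = \<omega> y a"
  using \<omega>_linear[of y] by (simp add: \<omega>b_def bounded_linear_Blinfun_apply linear_conv_bounded_linear)

lemma \<epsilon>b_apply: "y \<in> B \<Longrightarrow> blinfun_apply (\<epsilon>b y) a = \<epsilon> y a"
  using \<epsilon>_linear[of y] by (simp add: \<epsilon>b_def bounded_linear_Blinfun_apply linear_conv_bounded_linear)

lemma \<Gamma>b_apply: assumes "y \<in> B" shows "blinfun_apply (blinfun_apply (\<Gamma>b y) a) u = \<Gamma> y a u"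
proof -
  have 1: "blinfun_apply (Blinfun (\<Gamma> y a)) u = \<Gamma> y a u" for a u
    using \<Gamma>_linear(2)[OF assms] by (simp add: bounded_linear_Blinfun_apply linear_conv_bounded_linear)
  have "linear (\<lambda>a. Blinfun (\<Gamma> y a))"
    by (rule linearI; rule blinfun_eqI)
      (simp_all add: 1 blinfun.add_left blinfun.scaleR_left linear_add[OF \<Gamma>_linear(1)[OF assms]] linear_scale[OF \<Gamma>_linear(1)[OF assms]])
  then show ?thesis by (simp add: \<Gamma>b_def bounded_linear_Blinfun_apply linear_conv_bounded_linear 1)
qed

lemma \<omega>b_smooth: "Cinf_on B \<omega>b"
  by (rule Cinf_on_blinfunI[OF open_B], rule Cinf_on_cong[OF open_B _ \<omega>_smooth]) (simp add: \<omega>b_apply)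

lemma \<epsilon>b_smooth: "Cinf_on B \<epsilon>b"
  by (rule Cinf_on_blinfunI[OF open_B], rule Cinf_on_cong[OF open_B _ \<epsilon>_smooth]) (simp add: \<epsilon>b_apply)

lemma \<Gamma>b_smooth: "Cinf_on B \<Gamma>b"
  by (rule Cinf_on_blinfunI[OF open_B], rule Cinf_on_blinfunI[OF open_B], rule Cinf_on_cong[OF open_B _ \<Gamma>_smooth])
    (simp add: \<Gamma>b_apply)

abbreviation d\<omega> :: "'n \<Rightarrow> 'n \<Rightarrow> 'n \<Rightarrow> ('v \<Rightarrow>\<^sub>L 'v)" where
  "d\<omega> y a b \<equiv> blinfun_apply (frechet_derivative \<omega>b (at y) a) b"

abbreviation d\<epsilon> :: "'n \<Rightarrow> 'n \<Rightarrow> 'n \<Rightarrow> 'v" where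
  "d\<epsilon> y a b \<equiv> blinfun_apply (frechet_derivative \<epsilon>b (at y) a) b"

abbreviation d\<Gamma> :: "'n \<Rightarrow> 'n \<Rightarrow> 'n \<Rightarrow> real ^ 3 \<Rightarrow> real ^ 3" where
  "d\<Gamma> y a b u \<equiv> blinfun_apply (blinfun_apply (frechet_derivative \<Gamma>b (at y) a) b) u"

lemma d\<epsilon>_eq: assumes "y \<in> B" shows "frechet_derivative (\<lambda>z. \<epsilon> z b) (at y) a = d\<epsilon> y a b"
proof -
  have "frechet_derivative (\<lambda>z. \<epsilon> z b) (at y) = frechet_derivative (\<lambda>z. blinfun_apply (\<epsilon>b z) b) (at y)"
    by (rule frechet_derivative_cong_open[OF open_B assms]) (simp add: \<epsilon>b_apply)
  also have "\<dots> = (\<lambda>a. d\<epsilon> y a b)"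
    by (rule frechet_derivative_at[symmetric,
          OF bounded_linear.has_derivative[OF blinfun.bounded_linear_left Cinf_on_has_derivative[OF \<epsilon>b_smooth assms]]])
  finally show ?thesis by simp
qed

section \<open>Curvature of E and of Q, and the first Bianchi identity\<close>

definition R\<omega> :: "'n \<Rightarrow> 'n \<Rightarrow> 'n \<Rightarrow> ('v \<Rightarrow>\<^sub>L 'v)" where
  "R\<omega> y a b = d\<omega> y a b - d\<omega> y b a + (\<omega> y a o\<^sub>L \<omega> y b) - (\<omega> y b o\<^sub>L \<omega> y a)"

definition R\<Gamma> :: "'n \<Rightarrow> 'n \<Rightarrow> 'n \<Rightarrow> real ^ 3 \<Rightarrow> real ^ 3" where
  "R\<Gamma> y a b u = d\<Gamma> y a b u - d\<Gamma> y b a u + \<Gamma> y a (\<Gamma> y b u) - \<Gamma> y b (\<Gamma> y a u)"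

lemma torsion': "y \<in> B \<Longrightarrow> d\<epsilon> y a b + blinfun_apply (\<omega> y a) (\<epsilon> y b) = d\<epsilon> y b a + blinfun_apply (\<omega> y b) (\<epsilon> y a)"
  using \<epsilon>_torsion[of y b a] by (simp add: d\<epsilon>_eq)

lemma has_zero_derivative:
  assumes "y \<in> B" "(f has_derivative f') (at y)" "\<And>z. z \<in> B \<Longrightarrow> f z = 0"
  shows "f' h = 0"
proof -
  have "(f has_derivative (\<lambda>_. 0)) (at y)"
    by (rule has_derivative_transform_within_open[OF has_derivative_const[of 0] open_B assms(1)]) (simp add: assms(3))
  from has_derivative_unique[OF assms(2) this] show ?thesis by (rule fun_cong)
qed

text \<open>The derivative of the torsion identity, summed cyclically: second derivatives of
  \<open>\<epsilon>\<close> cancel by symmetry, and the torsion identity itself removes the first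
  derivatives, leaving the curvature of \<open>\<omega>\<close>.\<close>

lemma Bianchi:
  assumes y: "y \<in> B"
  shows "blinfun_apply (R\<omega> y a b) (\<epsilon> y c) + blinfun_apply (R\<omega> y b c) (\<epsilon> y a) + blinfun_apply (R\<omega> y c a) (\<epsilon> y b) = 0"
proof -
  define d2 where "d2 c a b = blinfun_apply (frechet_derivative (\<lambda>z. frechet_derivative \<epsilon>b (at z) a) (at y) c) b" for a b c
  have sym: "d2 c a b = d2 a c b" for a b c
    unfolding d2_def using frechet_derivative_commute_blinfun[OF open_B y \<epsilon>b_smooth, of a c] by simp
  have D\<epsilon>: "((\<lambda>z. d\<epsilon> z a b) has_derivative (\<lambda>c. d2 c a b)) (at y)" for a b
    unfolding d2_def
    by (rule bounded_linear.has_derivative[OF blinfun.bounded_linear_left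
          Cinf_on_has_derivative[OF Cinf_on_frechet_derivative[OF \<epsilon>b_smooth] y]])
  have \<omega>\<epsilon>: "((\<lambda>z. blinfun_apply (blinfun_apply (\<omega>b z) a) (blinfun_apply (\<epsilon>b z) b)) has_derivative
      (\<lambda>c. blinfun_apply (\<omega> y a) (d\<epsilon> y c b) + blinfun_apply (d\<omega> y c a) (\<epsilon> y b))) (at y)" for a b
    using bounded_bilinear.FDERIV[OF bounded_bilinear_blinfun_apply
        bounded_linear.has_derivative[OF blinfun.bounded_linear_left Cinf_on_has_derivative[OF \<omega>b_smooth y]]
        bounded_linear.has_derivative[OF blinfun.bounded_linear_left Cinf_on_has_derivative[OF \<epsilon>b_smooth y]], of a b]
    by (simp add: \<omega>b_apply[OF y] \<epsilon>b_apply[OF y])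
  define T where "T a b c = d2 c a b + (blinfun_apply (\<omega> y a) (d\<epsilon> y c b) + blinfun_apply (d\<omega> y c a) (\<epsilon> y b))
      - (d2 c b a + (blinfun_apply (\<omega> y b) (d\<epsilon> y c a) + blinfun_apply (d\<omega> y c b) (\<epsilon> y a)))" for a b c
  have T0: "T a b c = 0" for a b c unfolding T_def
    by (rule has_zero_derivative[OF y has_derivative_diff[OF has_derivative_add[OF D\<epsilon> \<omega>\<epsilon>] has_derivative_add[OF D\<epsilon> \<omega>\<epsilon>]]])
      (use torsion' in \<open>simp add: \<omega>b_apply \<epsilon>b_apply\<close>)
  have t: "d\<epsilon> y p q = d\<epsilon> y q p + blinfun_apply (\<omega> y q) (\<epsilon> y p) - blinfun_apply (\<omega> y p) (\<epsilon> y q)" for p q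
    using torsion'[OF y, of p q] by (simp add: algebra_simps)
  have "blinfun_apply (R\<omega> y a b) (\<epsilon> y c) + blinfun_apply (R\<omega> y b c) (\<epsilon> y a) + blinfun_apply (R\<omega> y c a) (\<epsilon> y b)
      = T a b c + T b c a + T c a b"
    unfolding T_def t[of b a] t[of c b] t[of a c] R\<omega>_def
    by (simp add: sym[of a b c] sym[of b c a] sym[of c a b] blinfun.bilinear_simps algebra_simps)
  then show ?thesis by (simp add: T0)
qed

lemma \<Gamma>b_bilinear_derivative:
  assumes y: "y \<in> B"
  shows "((\<lambda>z. \<Gamma> z b u) has_derivative (\<lambda>a. d\<Gamma> y a b u)) (at y)"
proof -
  have "((\<lambda>z. blinfun_apply (blinfun_apply (\<Gamma>b z) b) u) has_derivative (\<lambda>a. d\<Gamma> y a b u)) (at y)"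
    by (intro bounded_linear.has_derivative[OF blinfun.bounded_linear_left] Cinf_on_has_derivative[OF \<Gamma>b_smooth y])
  then show ?thesis by (rule has_derivative_transform_within_open[OF _ open_B y]) (simp add: \<Gamma>b_apply)
qed

text \<open>The Ricci identity for J_u: a second covariant derivative of it, computed once from
  \<open>\<omega>\<close> and once from \<open>\<Gamma>\<close>, is antisymmetrised, so that the
  second partial derivatives of J_u cancel.\<close>

lemma curvature_J:
  assumes y: "y \<in> B"
  shows "(R\<omega> y a b o\<^sub>L Jt y u) - (Jt y u o\<^sub>L R\<omega> y a b) = Jt y (R\<Gamma> y a b u)"
proof -
  define j where "j z = Jt z u" for z
  define dj where "dj z a = frechet_derivative j (at z) a" for z a
  define d2 where "d2 a b = frechet_derivative (\<lambda>z. dj z b) (at y) a" for a b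
  have js: "Cinf_on B j" unfolding j_def[abs_def] by (rule Jt_smooth)
  have sym: "d2 a b = d2 b a" for a b
    unfolding d2_def dj_def using frechet_derivative_commute_blinfun[OF open_B y js, of b a] by simp
  have Dj: "(j has_derivative dj y) (at y)" unfolding dj_def[abs_def] by (rule Cinf_on_has_derivative[OF js y])
  have D2: "((\<lambda>z. dj z b) has_derivative (\<lambda>a. d2 a b)) (at y)" for b
    unfolding d2_def dj_def
    by (rule Cinf_on_has_derivative[OF Cinf_on_frechet_derivative[OF js] y])
  have D\<omega>: "((\<lambda>z. \<omega> z b) has_derivative (\<lambda>a. d\<omega> y a b)) (at y)" for b
    by (rule has_derivative_transform_within_open[OF
          bounded_linear.has_derivative[OF blinfun.bounded_linear_left Cinf_on_has_derivative[OF \<omega>b_smooth y]] open_B y])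
      (simp add: \<omega>b_apply)
  have DJu: "DJ z b u = dj z b + (\<omega> z b o\<^sub>L j z) - (j z o\<^sub>L \<omega> z b)" for z b
    by (simp add: DJ_def dj_def j_def[abs_def])
  have key: "Jt y (d\<Gamma> y a b u + \<Gamma> y a (\<Gamma> y b u)) = d2 a b + ((\<omega> y b o\<^sub>L dj y a) + (d\<omega> y a b o\<^sub>L j y)) - ((j y o\<^sub>L d\<omega> y a b) + (dj y a o\<^sub>L \<omega> y b))
      + (\<omega> y a o\<^sub>L (dj y b + (\<omega> y b o\<^sub>L j y) - (j y o\<^sub>L \<omega> y b))) - ((dj y b + (\<omega> y b o\<^sub>L j y) - (j y o\<^sub>L \<omega> y b)) o\<^sub>L \<omega> y a)" for a b
  proof -
    let ?w = "\<Gamma> y b u"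
    have "((\<lambda>z. Jt z (\<Gamma> z b u)) has_derivative (\<lambda>a. Jt y (d\<Gamma> y a b u) + frechet_derivative (\<lambda>z. Jt z ?w) (at y) a)) (at y)"
      by (rule Jt_has_derivative[OF y has_derivative_ident \<Gamma>b_bilinear_derivative[OF y] open_B y])
    moreover have "((\<lambda>z. dj z b + (\<omega> z b o\<^sub>L j z) - (j z o\<^sub>L \<omega> z b)) has_derivative
      (\<lambda>a. d2 a b + ((\<omega> y b o\<^sub>L dj y a) + (d\<omega> y a b o\<^sub>L j y)) - ((j y o\<^sub>L d\<omega> y a b) + (dj y a o\<^sub>L \<omega> y b)))) (at y)"
      by (intro has_derivative_diff has_derivative_add D2 bounded_bilinear.FDERIV[OF bounded_bilinear_blinfun_compose] D\<omega> Dj)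
    ultimately have "Jt y (d\<Gamma> y a b u) + frechet_derivative (\<lambda>z. Jt z ?w) (at y) a
        - (d2 a b + ((\<omega> y b o\<^sub>L dj y a) + (d\<omega> y a b o\<^sub>L j y)) - ((j y o\<^sub>L d\<omega> y a b) + (dj y a o\<^sub>L \<omega> y b))) = 0"
      using has_zero_derivative[OF y has_derivative_diff, of "\<lambda>z. Jt z (\<Gamma> z b u)" _ "\<lambda>z. dj z b + (\<omega> z b o\<^sub>L j z) - (j z o\<^sub>L \<omega> z b)" _ a]
      by (simp add: Jt_\<Gamma> DJu)
    moreover have "frechet_derivative (\<lambda>z. Jt z ?w) (at y) a = Jt y (\<Gamma> y a ?w) - (\<omega> y a o\<^sub>L Jt y ?w) + (Jt y ?w o\<^sub>L \<omega> y a)"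
      by (simp add: Jt_\<Gamma>[OF y, of a ?w] DJ_def)
    moreover have "Jt y ?w = dj y b + (\<omega> y b o\<^sub>L j y) - (j y o\<^sub>L \<omega> y b)" by (simp add: Jt_\<Gamma>[OF y] DJu)
    ultimately show ?thesis by (simp add: linear_add[OF Jt_linear[OF y]] algebra_simps)
  qed
  have "Jt y (R\<Gamma> y a b u) = Jt y (d\<Gamma> y a b u + \<Gamma> y a (\<Gamma> y b u)) - Jt y (d\<Gamma> y b a u + \<Gamma> y b (\<Gamma> y a u))"
    unfolding R\<Gamma>_def by (simp add: linear_diff[OF Jt_linear[OF y], symmetric] algebra_simps)
  also have "\<dots> = (R\<omega> y a b o\<^sub>L j y) - (j y o\<^sub>L R\<omega> y a b)"
    unfolding key R\<omega>_def by (rule blinfun_eqI) (simp add: sym[of a b] blinfun.bilinear_simps algebra_simps)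
  finally show ?thesis by (simp add: j_def)
qed

text \<open>The commutator with the square of J_u, a scalar, vanishes; so J_u anticommutes with its
  own commutator with the curvature.\<close>

lemma R\<Gamma>_perp: assumes y: "y \<in> B" shows "u \<bullet> R\<Gamma> y a b u = 0"
proof -
  have sq: "Jt y u o\<^sub>L Jt y u = (- (u \<bullet> u)) *\<^sub>R id_blinfun"
    by (simp add: Jt_mult[OF y] linear_0[OF Jt_linear[OF y]])
  let ?R = "R\<omega> y a b" and ?J = "Jt y u"
  have "(?J o\<^sub>L Jt y (R\<Gamma> y a b u)) + (Jt y (R\<Gamma> y a b u) o\<^sub>L ?J) = (?R o\<^sub>L (?J o\<^sub>L ?J)) - ((?J o\<^sub>L ?J) o\<^sub>L ?R)"
    unfolding curvature_J[OF y, symmetric] by (rule blinfun_eqI) (simp add: blinfun.bilinear_simps)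
  also have "\<dots> = 0" unfolding sq by (rule blinfun_eqI) (simp add: blinfun.bilinear_simps)
  finally have "(- 2 * (u \<bullet> R\<Gamma> y a b u)) *\<^sub>R (id_blinfun :: 'v \<Rightarrow>\<^sub>L 'v) = 0"
    by (simp only: Jt_anticommutator[OF y])
  then have "- 2 * (u \<bullet> R\<Gamma> y a b u) = 0" by (rule scaleR_id_blinfun_eq_0)
  then show ?thesis by simp
qed

lemma \<Gamma>_skew2: assumes y: "y \<in> B" shows "\<Gamma> y a v \<bullet> w = - (v \<bullet> \<Gamma> y a w)"
  using \<Gamma>_skew[OF y, of a "v + w"] \<Gamma>_skew[OF y, of a v] \<Gamma>_skew[OF y, of a w]
  by (simp add: linear_add[OF \<Gamma>_linear(2)[OF y]] inner_add_left inner_add_right inner_commute[of v])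

text \<open>The connection is a derivation of composition. Differentiating J_v J_w = -(v . w) + J_(v
  x w) covariantly shows that \<open>\<Gamma>\<close> is a derivation of the cross product, as its
  skewness removes the scalar terms.\<close>

lemma \<Gamma>_cross:
  assumes y: "y \<in> B"
  shows "\<Gamma> y a (cross3 v w) = cross3 (\<Gamma> y a v) w + cross3 v (\<Gamma> y a w)"
proof -
  let ?d = "\<lambda>v. frechet_derivative (\<lambda>z. Jt z v) (at y)"
  have d: "((\<lambda>z. Jt z u) has_derivative ?d u) (at y)" for u
    by (rule Cinf_on_has_derivative[OF Jt_smooth y])
  have "((\<lambda>z. (Jt z v o\<^sub>L Jt z w) - Jt z (cross3 v w) - (- (v \<bullet> w) *\<^sub>R id_blinfun)) has_derivative
      (\<lambda>h. (Jt y v o\<^sub>L ?d w h) + (?d v h o\<^sub>L Jt y w) - ?d (cross3 v w) h - 0)) (at y)"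
    by (intro has_derivative_diff bounded_bilinear.FDERIV[OF bounded_bilinear_blinfun_compose d d] d has_derivative_const)
  from has_zero_derivative[OF y this, of a]
  have D: "?d (cross3 v w) a = (Jt y v o\<^sub>L ?d w a) + (?d v a o\<^sub>L Jt y w)"
    by (simp add: Jt_mult)
  let ?\<omega> = "\<omega> y a"
  have m: "Jt y (cross3 v w) = (Jt y v o\<^sub>L Jt y w) + (v \<bullet> w) *\<^sub>R id_blinfun"
    by (simp add: Jt_mult[OF y])
  have "Jt y (\<Gamma> y a (cross3 v w)) = (DJ y a v o\<^sub>L Jt y w) + (Jt y v o\<^sub>L DJ y a w)"
    unfolding Jt_\<Gamma>[OF y] DJ_def D m by (rule blinfun_eqI) (simp add: blinfun.bilinear_simps algebra_simps)
  also have "\<dots> = (- (\<Gamma> y a v \<bullet> w) + - (v \<bullet> \<Gamma> y a w)) *\<^sub>R id_blinfun + (Jt y (cross3 (\<Gamma> y a v) w) + Jt y (cross3 v (\<Gamma> y a w)))"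
    unfolding Jt_\<Gamma>[OF y, symmetric] Jt_mult[OF y] scaleR_left_distrib by (simp only: ac_simps)
  also have "- (\<Gamma> y a v \<bullet> w) + - (v \<bullet> \<Gamma> y a w) = 0" using \<Gamma>_skew2[OF y, of a v w] by simp
  finally have "Jt y (\<Gamma> y a (cross3 v w)) = Jt y (cross3 (\<Gamma> y a v) w + cross3 v (\<Gamma> y a w))"
    by (simp add: linear_add[OF Jt_linear[OF y]])
  then show ?thesis using Jt_eq_iff[OF y] by blast
qed

end

section \<open>Brackets of sections of the twistor distribution\<close>

context cr_chart
begin

text \<open>The radial projection. Coordinates of fields on \<open>Z\<close> are constant along
  rays, so at an arbitrary point of \<open>BZ\<close> the defining relations hold with the
  normalised fibre coordinate; in this form they can be differentiated.\<close>

definition Nrm :: "'n \<times> (real ^ 3) \<Rightarrow> 'n \<times> (real ^ 3)" where "Nrm p = (fst p, snd p /\<^sub>R norm (snd p))"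

context
  fixes p :: "'n \<times> (real ^ 3)" assumes p: "p \<in> BZ" "norm (snd p) = 1"
begin

lemma y_B: "fst p \<in> B" using BZ_D p by blast

lemma Nrm_p: "Nrm p = p" using p by (simp add: Nrm_def)

lemma uu: "snd p \<bullet> snd p = 1" using p by (simp add: norm_eq_1)

section \<open>Covariant derivatives of the defining relations\<close>

lemma \<epsilon>_has_derivative:
  assumes x: "(x has_derivative x') (at p)"
  shows "((\<lambda>p. \<epsilon> (fst p) (fst (x p))) has_derivative (\<lambda>\<xi>. \<epsilon> (fst p) (fst (x' \<xi>)) + d\<epsilon> (fst p) (fst \<xi>) (fst (x p)))) (at p)"
proof -
  have "((\<lambda>p. \<epsilon>b (fst p)) has_derivative (\<lambda>\<xi>. frechet_derivative \<epsilon>b (at (fst p)) (fst \<xi>))) (at p)"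
    by (rule has_derivative_compose[OF has_derivative_fst[OF has_derivative_ident] Cinf_on_has_derivative[OF \<epsilon>b_smooth y_B]])
  from bounded_bilinear.FDERIV[OF bounded_bilinear_blinfun_apply this has_derivative_fst[OF x]]
  have "((\<lambda>p. blinfun_apply (\<epsilon>b (fst p)) (fst (x p))) has_derivative
      (\<lambda>\<xi>. \<epsilon> (fst p) (fst (x' \<xi>)) + d\<epsilon> (fst p) (fst \<xi>) (fst (x p)))) (at p)"
    by (simp add: \<epsilon>b_apply[OF y_B])
  then show ?thesis
    by (rule has_derivative_transform_within_open[OF _ open_BZ p(1)]) (simp add: \<epsilon>b_apply BZ_D)
qed

lemma \<zeta>_has_derivative:
  assumes x: "(x has_derivative x') (at p)"
  shows "((\<lambda>p. \<zeta> (Nrm p) (x p)) has_derivative (\<lambda>\<xi>. snd (x' \<xi>)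
    + (\<Gamma> (fst p) (fst (x p)) (snd \<xi> - (snd p \<bullet> snd \<xi>) *\<^sub>R snd p)
    + (\<Gamma> (fst p) (fst (x' \<xi>)) (snd p) + d\<Gamma> (fst p) (fst \<xi>) (fst (x p)) (snd p))))) (at p)"
proof -
  have n: "((\<lambda>p. snd (Nrm p)) has_derivative (\<lambda>\<xi>. snd \<xi> - (snd p \<bullet> snd \<xi>) *\<^sub>R snd p)) (at p)"
    using has_derivative_snd[OF normalize_pair_derivative[OF p(2)]] by (simp add: Nrm_def[abs_def])
  have "((\<lambda>p. \<Gamma>b (fst p)) has_derivative (\<lambda>\<xi>. frechet_derivative \<Gamma>b (at (fst p)) (fst \<xi>))) (at p)"
    by (rule has_derivative_compose[OF has_derivative_fst[OF has_derivative_ident] Cinf_on_has_derivative[OF \<Gamma>b_smooth y_B]])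
  from bounded_bilinear.FDERIV[OF bounded_bilinear_blinfun_apply this has_derivative_fst[OF x]]
  have "((\<lambda>p. blinfun_apply (\<Gamma>b (fst p)) (fst (x p))) has_derivative (\<lambda>\<xi>. blinfun_apply (\<Gamma>b (fst p)) (fst (x' \<xi>))
      + blinfun_apply (frechet_derivative \<Gamma>b (at (fst p)) (fst \<xi>)) (fst (x p)))) (at p)" .
  from bounded_bilinear.FDERIV[OF bounded_bilinear_blinfun_apply this n]
  have "((\<lambda>p. blinfun_apply (blinfun_apply (\<Gamma>b (fst p)) (fst (x p))) (snd (Nrm p))) has_derivative
    (\<lambda>\<xi>. \<Gamma> (fst p) (fst (x p)) (snd \<xi> - (snd p \<bullet> snd \<xi>) *\<^sub>R snd p)
    + (\<Gamma> (fst p) (fst (x' \<xi>)) (snd p) + d\<Gamma> (fst p) (fst \<xi>) (fst (x p)) (snd p)))) (at p)"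
    by (simp add: \<Gamma>b_apply[OF y_B] Nrm_p blinfun.add_left)
  from has_derivative_add[OF has_derivative_snd[OF x] this]
  show ?thesis
    by (rule has_derivative_transform_within_open[OF _ open_BZ p(1)]) (simp add: \<Gamma>b_apply BZ_D \<zeta>_def Nrm_def)
qed

text \<open>The covariant derivatives, at \<open>p\<close>, of the functions \<open>\<epsilon> (d\<pi> x)\<close> and \<open>\<zeta> x\<close> along \<open>\<xi>\<close>, the second
  one for \<open>\<xi>\<close> tangent to the sphere.\<close>

definition NE :: "('n \<times> (real ^ 3) \<Rightarrow> 'n \<times> (real ^ 3)) \<Rightarrow> ('n \<times> (real ^ 3) \<Rightarrow> 'n \<times> (real ^ 3)) \<Rightarrow> 'n \<times> (real ^ 3) \<Rightarrow> 'v" where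
  "NE x x' \<xi> = \<epsilon> (fst p) (fst (x' \<xi>)) + d\<epsilon> (fst p) (fst \<xi>) (fst (x p)) + blinfun_apply (\<omega> (fst p) (fst \<xi>)) (\<epsilon> (fst p) (fst (x p)))"

definition NF :: "('n \<times> (real ^ 3) \<Rightarrow> 'n \<times> (real ^ 3)) \<Rightarrow> ('n \<times> (real ^ 3) \<Rightarrow> 'n \<times> (real ^ 3)) \<Rightarrow> 'n \<times> (real ^ 3) \<Rightarrow> real ^ 3" where
  "NF x x' \<xi> = snd (x' \<xi>) + \<Gamma> (fst p) (fst (x p)) (snd \<xi>) + \<Gamma> (fst p) (fst (x' \<xi>)) (snd p) + d\<Gamma> (fst p) (fst \<xi>) (fst (x p)) (snd p)
    + \<Gamma> (fst p) (fst \<xi>) (\<zeta> p (x p))"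

lemma has_zero_derivative_BZ:
  assumes "(f has_derivative f') (at p)" "\<And>z. z \<in> BZ \<Longrightarrow> f z = 0"
  shows "f' h = 0"
proof -
  have "(f has_derivative (\<lambda>_. 0)) (at p)"
    by (rule has_derivative_transform_within_open[OF has_derivative_const[of 0] open_BZ p(1)]) (simp add: assms(2))
  from has_derivative_unique[OF assms(1) this] show ?thesis by (rule fun_cong)
qed

text \<open>Vanishing torsion cancels everything except the term that contains the bracket.\<close>

lemma NE_bracket: "NE y y' (x p) - NE x x' (y p) = \<epsilon> (fst p) (fst (y' (x p) - x' (y p)))"
  using torsion'[OF y_B, of "fst (x p)" "fst (y p)"]
  by (simp add: NE_def linear_diff[OF \<epsilon>_linear[OF y_B]] algebra_simps)

text \<open>The structure equation of the connection on \<open>Q\<close>: antisymmetrising the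
  covariant derivative of the vertical part gives the vertical part of the bracket and the
  curvature.\<close>

lemma NF_bracket:
  assumes "snd p \<bullet> snd (x p) = 0" "snd p \<bullet> snd (y p) = 0"
  shows "NF y y' (x p) - NF x x' (y p) = \<zeta> p (y' (x p) - x' (y p)) + R\<Gamma> (fst p) (fst (x p)) (fst (y p)) (snd p)"
  unfolding NF_def R\<Gamma>_def \<zeta>_def
  by (simp add: linear_diff[OF \<Gamma>_linear(1)[OF y_B]] linear_add[OF \<Gamma>_linear(2)[OF y_B]] algebra_simps)

context
  fixes x1 x2 x1' x2' :: "'n \<times> (real ^ 3) \<Rightarrow> 'n \<times> (real ^ 3)"
  assumes x: "(x1 has_derivative x1') (at p)" "(x2 has_derivative x2') (at p)"
    and rel\<epsilon>: "\<And>q. q \<in> BZ \<Longrightarrow> \<epsilon> (fst q) (fst (x2 q)) = blinfun_apply (Jt (fst q) (snd (Nrm q))) (\<epsilon> (fst q) (fst (x1 q)))"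
    and rel\<zeta>: "\<And>q. q \<in> BZ \<Longrightarrow> \<zeta> (Nrm q) (x2 q) = cross3 (snd (Nrm q)) (\<zeta> (Nrm q) (x1 q))"
    and perp: "\<And>q. q \<in> BZ \<Longrightarrow> snd (Nrm q) \<bullet> snd (x1 q) = 0"
begin

text \<open>Along \<open>\<xi>\<close> the covariant derivative of J_u is J of
  \<open>\<zeta> p \<xi>\<close>, the vertical part of \<open>\<xi>\<close>; the rest is the product
  rule.\<close>

lemma NE_relation:
  assumes "snd p \<bullet> snd \<xi> = 0"
  shows "NE x2 x2' \<xi> = blinfun_apply (Jt (fst p) (\<zeta> p \<xi>)) (\<epsilon> (fst p) (fst (x1 p))) + blinfun_apply (Jt (fst p) (snd p)) (NE x1 x1' \<xi>)"
proof -
  let ?y = "fst p" and ?u = "snd p"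
  have n: "((\<lambda>p. snd (Nrm p)) has_derivative (\<lambda>\<xi>. snd \<xi> - (snd p \<bullet> snd \<xi>) *\<^sub>R snd p)) (at p)"
    using has_derivative_snd[OF normalize_pair_derivative[OF p(2)]] by (simp add: Nrm_def[abs_def])
  have "((\<lambda>q. Jt (fst q) (snd (Nrm q))) has_derivative
      (\<lambda>\<xi>. Jt ?y (snd \<xi> - (?u \<bullet> snd \<xi>) *\<^sub>R ?u) + frechet_derivative (\<lambda>z. Jt z ?u) (at ?y) (fst \<xi>))) (at p)"
    using Jt_has_derivative[OF y_B has_derivative_fst[OF has_derivative_ident] n open_BZ p(1) BZ_D(1)] by (simp add: Nrm_p)
  from bounded_bilinear.FDERIV[OF bounded_bilinear_blinfun_apply this \<epsilon>_has_derivative[OF x(1)]]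
  have "((\<lambda>q. blinfun_apply (Jt (fst q) (snd (Nrm q))) (\<epsilon> (fst q) (fst (x1 q)))) has_derivative
      (\<lambda>\<xi>. blinfun_apply (Jt ?y ?u) (\<epsilon> ?y (fst (x1' \<xi>)) + d\<epsilon> ?y (fst \<xi>) (fst (x1 p)))
        + blinfun_apply (Jt ?y (snd \<xi> - (?u \<bullet> snd \<xi>) *\<^sub>R ?u) + frechet_derivative (\<lambda>z. Jt z ?u) (at ?y) (fst \<xi>)) (\<epsilon> ?y (fst (x1 p))))) (at p)"
    by (simp add: Nrm_p)
  from has_zero_derivative_BZ[OF has_derivative_diff[OF \<epsilon>_has_derivative[OF x(2)] this], of \<xi>]
  have 1: "\<epsilon> ?y (fst (x2' \<xi>)) + d\<epsilon> ?y (fst \<xi>) (fst (x2 p))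
      = blinfun_apply (Jt ?y ?u) (\<epsilon> ?y (fst (x1' \<xi>)) + d\<epsilon> ?y (fst \<xi>) (fst (x1 p)))
        + blinfun_apply (Jt ?y (snd \<xi>) + frechet_derivative (\<lambda>z. Jt z ?u) (at ?y) (fst \<xi>)) (\<epsilon> ?y (fst (x1 p)))"
    by (simp add: rel\<epsilon> assms)
  have 2: "Jt ?y (\<zeta> p \<xi>) = Jt ?y (snd \<xi>) + frechet_derivative (\<lambda>z. Jt z ?u) (at ?y) (fst \<xi>)
      + (\<omega> ?y (fst \<xi>) o\<^sub>L Jt ?y ?u) - (Jt ?y ?u o\<^sub>L \<omega> ?y (fst \<xi>))"
    by (simp add: \<zeta>_def linear_add[OF Jt_linear[OF y_B]] Jt_\<Gamma>[OF y_B] DJ_def algebra_simps)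
  have 3: "\<epsilon> ?y (fst (x2 p)) = blinfun_apply (Jt ?y ?u) (\<epsilon> ?y (fst (x1 p)))" using rel\<epsilon>[OF p(1)] by (simp add: Nrm_p)
  show ?thesis unfolding NE_def 1 2 3 by (simp add: blinfun.bilinear_simps)
qed

text \<open>The covariant derivative of \<open>u\<close> along \<open>\<xi>\<close> is
  \<open>\<zeta> p \<xi>\<close>, and by \<open>\<Gamma>_cross\<close> the product rule holds for
  the cross product.\<close>

lemma NF_relation:
  assumes "snd p \<bullet> snd \<xi> = 0"
  shows "NF x2 x2' \<xi> = cross3 (\<zeta> p \<xi>) (\<zeta> p (x1 p)) + cross3 (snd p) (NF x1 x1' \<xi>)"
proof -
  let ?y = "fst p" and ?u = "snd p"
  have n: "((\<lambda>p. snd (Nrm p)) has_derivative (\<lambda>\<xi>. snd \<xi> - (snd p \<bullet> snd \<xi>) *\<^sub>R snd p)) (at p)"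
    using has_derivative_snd[OF normalize_pair_derivative[OF p(2)]] by (simp add: Nrm_def[abs_def])
  have bc: "bounded_bilinear cross3"
    using bilinear_conv_bounded_bilinear bilinear_cross by blast
  from has_zero_derivative_BZ[OF has_derivative_diff[OF \<zeta>_has_derivative[OF x(2)] bounded_bilinear.FDERIV[OF bc n \<zeta>_has_derivative[OF x(1)]]], of \<xi>]
  have 1: "snd (x2' \<xi>) + (\<Gamma> ?y (fst (x2 p)) (snd \<xi>) + (\<Gamma> ?y (fst (x2' \<xi>)) ?u + d\<Gamma> ?y (fst \<xi>) (fst (x2 p)) ?u))
    = cross3 ?u (snd (x1' \<xi>) + (\<Gamma> ?y (fst (x1 p)) (snd \<xi>) + (\<Gamma> ?y (fst (x1' \<xi>)) ?u + d\<Gamma> ?y (fst \<xi>) (fst (x1 p)) ?u)))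
      + cross3 (snd \<xi>) (\<zeta> p (x1 p))"
    by (simp add: rel\<zeta> assms Nrm_p)
  have 2: "\<zeta> p (x2 p) = cross3 ?u (\<zeta> p (x1 p))" using rel\<zeta>[OF p(1)] by (simp add: Nrm_p)
  have "NF x2 x2' \<xi> = snd (x2' \<xi>) + (\<Gamma> ?y (fst (x2 p)) (snd \<xi>) + (\<Gamma> ?y (fst (x2' \<xi>)) ?u + d\<Gamma> ?y (fst \<xi>) (fst (x2 p)) ?u))
     + \<Gamma> ?y (fst \<xi>) (cross3 ?u (\<zeta> p (x1 p)))"
    unfolding NF_def 2 by (simp only: add.assoc)
  also have "\<dots> = cross3 (\<zeta> p \<xi>) (\<zeta> p (x1 p)) + cross3 ?u (NF x1 x1' \<xi>)"
    unfolding 1 \<Gamma>_cross[OF y_B] NF_def \<zeta>_def[of p \<xi>] cross_add_left cross_add_right by (simp only: ac_simps)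
  finally show ?thesis .
qed

lemma \<zeta>_perp: "snd p \<bullet> \<zeta> p (x1 p) = 0" 
  using perp[OF p(1)] \<Gamma>_skew[OF y_B, of "fst (x1 p)" "snd p"] by (simp add: \<zeta>_def inner_add_right Nrm_p inner_commute)

text \<open>The relation that \<open>\<zeta>\<close> is orthogonal to \<open>u\<close>,
  differentiated. It records the radial component that covariant derivatives of tangent vectors
  acquire.\<close>

lemma NF_perp:
  assumes "snd p \<bullet> snd \<xi> = 0"
  shows "\<zeta> p \<xi> \<bullet> \<zeta> p (x1 p) + snd p \<bullet> NF x1 x1' \<xi> = 0"
proof -
  let ?y = "fst p" and ?u = "snd p"
  have n: "((\<lambda>p. snd (Nrm p)) has_derivative (\<lambda>\<xi>. snd \<xi> - (snd p \<bullet> snd \<xi>) *\<^sub>R snd p)) (at p)"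
    using has_derivative_snd[OF normalize_pair_derivative[OF p(2)]] by (simp add: Nrm_def[abs_def])
  have z: "snd (Nrm q) \<bullet> \<zeta> (Nrm q) (x1 q) = 0" if "q \<in> BZ" for q
    using perp[OF that] \<Gamma>_skew[of "fst q" "fst (x1 q)" "snd (Nrm q)"] BZ_D[OF that]
    by (simp add: \<zeta>_def inner_add_right inner_commute Nrm_def)
  from has_zero_derivative_BZ[OF has_derivative_inner[OF n \<zeta>_has_derivative[OF x(1)]] z, of \<xi>]
  have 1: "?u \<bullet> (snd (x1' \<xi>) + (\<Gamma> ?y (fst (x1 p)) (snd \<xi>) + (\<Gamma> ?y (fst (x1' \<xi>)) ?u + d\<Gamma> ?y (fst \<xi>) (fst (x1 p)) ?u)))
      + snd \<xi> \<bullet> \<zeta> p (x1 p) = 0"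
    by (simp add: assms Nrm_p)
  have 2: "?u \<bullet> \<Gamma> ?y (fst \<xi>) (\<zeta> p (x1 p)) = - (\<Gamma> ?y (fst \<xi>) ?u \<bullet> \<zeta> p (x1 p))"
    using \<Gamma>_skew2[OF y_B, of "fst \<xi>" ?u "\<zeta> p (x1 p)"] by simp
  show ?thesis using 1 2 unfolding NF_def \<zeta>_def[of p \<xi>] by (simp add: inner_add_right inner_add_left)
qed

end

text \<open>\<open>z1\<close> and \<open>z2\<close> are the real and imaginary parts of the
  coordinate bracket of \<open>x1 + i x2\<close> and \<open>y1 + i y2\<close>, and the conclusions
  are the two relations defining the distribution.\<close>

lemma bracket_relations:
  assumes x: "(x1 has_derivative x1') (at p)" "(x2 has_derivative x2') (at p)"
    and relx: "\<And>q. q \<in> BZ \<Longrightarrow> \<epsilon> (fst q) (fst (x2 q)) = blinfun_apply (Jt (fst q) (snd (Nrm q))) (\<epsilon> (fst q) (fst (x1 q)))"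
      "\<And>q. q \<in> BZ \<Longrightarrow> \<zeta> (Nrm q) (x2 q) = cross3 (snd (Nrm q)) (\<zeta> (Nrm q) (x1 q))"
    and perpx: "\<And>q. q \<in> BZ \<Longrightarrow> snd (Nrm q) \<bullet> snd (x1 q) = 0" "\<And>q. q \<in> BZ \<Longrightarrow> snd (Nrm q) \<bullet> snd (x2 q) = 0"
    and y: "(y1 has_derivative y1') (at p)" "(y2 has_derivative y2') (at p)"
    and rely: "\<And>q. q \<in> BZ \<Longrightarrow> \<epsilon> (fst q) (fst (y2 q)) = blinfun_apply (Jt (fst q) (snd (Nrm q))) (\<epsilon> (fst q) (fst (y1 q)))"
      "\<And>q. q \<in> BZ \<Longrightarrow> \<zeta> (Nrm q) (y2 q) = cross3 (snd (Nrm q)) (\<zeta> (Nrm q) (y1 q))"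
    and perpy: "\<And>q. q \<in> BZ \<Longrightarrow> snd (Nrm q) \<bullet> snd (y1 q) = 0" "\<And>q. q \<in> BZ \<Longrightarrow> snd (Nrm q) \<bullet> snd (y2 q) = 0"
    and dim: "DIM('v) = 4 * k" "DIM('n) = 4 * k - l" "l \<le> 2 * k - 1" "2 * k - l \<noteq> 2"
  defines "z1 \<equiv> (y1' (x1 p) - x1' (y1 p)) - (y2' (x2 p) - x2' (y2 p))"
    and "z2 \<equiv> (y2' (x1 p) - x1' (y2 p)) + (y1' (x2 p) - x2' (y1 p))"
  shows "\<epsilon> (fst p) (fst z2) = blinfun_apply (Jt (fst p) (snd p)) (\<epsilon> (fst p) (fst z1))"
    and "\<zeta> p z2 = cross3 (snd p) (\<zeta> p z1)"
proof -
  let ?y = "fst p" and ?u = "snd p"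
  let ?J = "blinfun_apply (Jt ?y ?u)"
  define F G where "F = \<zeta> p (x1 p)" and "G = \<zeta> p (y1 p)"
  have F2: "\<zeta> p (x2 p) = cross3 ?u F" and G2: "\<zeta> p (y2 p) = cross3 ?u G"
    using relx(2)[OF p(1)] rely(2)[OF p(1)] by (simp_all add: Nrm_p F_def G_def)
  have perp: "?u \<bullet> snd (x1 p) = 0" "?u \<bullet> snd (x2 p) = 0" "?u \<bullet> snd (y1 p) = 0" "?u \<bullet> snd (y2 p) = 0"
    using perpx[OF p(1)] perpy[OF p(1)] by (simp_all add: Nrm_p)
  have "?u \<bullet> \<zeta> p (x1 p) = 0" by (rule \<zeta>_perp[OF x]) (fact relx perpx(1))+
  moreover have "?u \<bullet> \<zeta> p (y1 p) = 0" by (rule \<zeta>_perp[OF y]) (fact rely perpy(1))+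
  ultimately have FG: "?u \<bullet> F = 0" "?u \<bullet> G = 0" by (simp_all add: F_def G_def)
  have Jmul: "blinfun_apply (Jt ?y v) (blinfun_apply (Jt ?y w) t) = - (v \<bullet> w) *\<^sub>R t + blinfun_apply (Jt ?y (cross3 v w)) t" for v w t
    using Jt_mult[OF y_B, of v w] by (metis blinfun.add_left blinfun.scaleR_left blinfun_apply_blinfun_compose id_blinfun.rep_eq)
  have JJ: "?J (?J t) = - t" for t using Jmul[of ?u ?u t] by (simp add: uu linear_0[OF Jt_linear[OF y_B]])
  have JF: "blinfun_apply (Jt ?y (cross3 ?u H)) t = ?J (blinfun_apply (Jt ?y H) t)" if "?u \<bullet> H = 0" for H t
    using Jmul[of ?u H t] that by simp
  have NEx: "NE x2 x2' \<xi> = blinfun_apply (Jt ?y (\<zeta> p \<xi>)) (\<epsilon> ?y (fst (x1 p))) + ?J (NE x1 x1' \<xi>)"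
    and NFx: "NF x2 x2' \<xi> = cross3 (\<zeta> p \<xi>) (\<zeta> p (x1 p)) + cross3 ?u (NF x1 x1' \<xi>)"
    and NPx: "\<zeta> p \<xi> \<bullet> \<zeta> p (x1 p) + ?u \<bullet> NF x1 x1' \<xi> = 0" if "?u \<bullet> snd \<xi> = 0" for \<xi>
    by (rule NE_relation[OF x _ _ _ that] NF_relation[OF x _ _ _ that] NF_perp[OF x _ _ _ that]; simp add: relx perpx)+
  have NEy: "NE y2 y2' \<xi> = blinfun_apply (Jt ?y (\<zeta> p \<xi>)) (\<epsilon> ?y (fst (y1 p))) + ?J (NE y1 y1' \<xi>)"
    and NFy: "NF y2 y2' \<xi> = cross3 (\<zeta> p \<xi>) (\<zeta> p (y1 p)) + cross3 ?u (NF y1 y1' \<xi>)"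
    and NPy: "\<zeta> p \<xi> \<bullet> \<zeta> p (y1 p) + ?u \<bullet> NF y1 y1' \<xi> = 0" if "?u \<bullet> snd \<xi> = 0" for \<xi>
    by (rule NE_relation[OF y _ _ _ that] NF_relation[OF y _ _ _ that] NF_perp[OF y _ _ _ that]; simp add: rely perpy)+
  \<comment> \<open>The vertical parts of the directions enter through J_F and J_(u x F) = J J_F,
    and likewise for G; since \<open>J\<close> squares to -1, they cancel, together with the
    remaining derivatives.\<close>
  have "\<epsilon> ?y (fst z2) - ?J (\<epsilon> ?y (fst z1)) =
      (NE y2 y2' (x1 p) - NE x1 x1' (y2 p)) + (NE y1 y1' (x2 p) - NE x2 x2' (y1 p))
      - ?J ((NE y1 y1' (x1 p) - NE x1 x1' (y1 p)) - (NE y2 y2' (x2 p) - NE x2 x2' (y2 p)))"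
    unfolding NE_bracket z1_def z2_def fst_add fst_diff
    by (simp add: linear_add[OF \<epsilon>_linear[OF y_B]] linear_diff[OF \<epsilon>_linear[OF y_B]] blinfun.diff_right)
  also have "\<dots> = 0"
    unfolding NEx[OF perp(3)] NEx[OF perp(4)] NEy[OF perp(1)] NEy[OF perp(2)] F2 G2 F_def[symmetric] G_def[symmetric] JF[OF FG(1)] JF[OF FG(2)]
    by (simp add: blinfun.bilinear_simps JJ)
  finally show "\<epsilon> ?y (fst z2) = ?J (\<epsilon> ?y (fst z1))" by simp
  let ?R = "\<lambda>a b. R\<Gamma> ?y a b ?u"
  have lin: "linear (?R a)" for a
    by (rule linearI) (simp_all add: R\<Gamma>_def blinfun.add_right blinfun.scaleR_right blinfun.add_left blinfun.scaleR_left
        linear_add[OF linear_frechet_derivative[OF Cinf_on_differentiable[OF \<Gamma>b_smooth y_B]]]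
        linear_scale[OF linear_frechet_derivative[OF Cinf_on_differentiable[OF \<Gamma>b_smooth y_B]]]
        linear_add[OF \<Gamma>_linear(1)[OF y_B]] linear_scale[OF \<Gamma>_linear(1)[OF y_B]]
        linear_add[OF \<Gamma>_linear(2)[OF y_B]] linear_scale[OF \<Gamma>_linear(2)[OF y_B]] algebra_simps)
  have R: "?R (fst (x1 p)) (fst (y2 p)) + ?R (fst (x2 p)) (fst (y1 p))
      = cross3 ?u (?R (fst (x1 p)) (fst (y1 p)) - ?R (fst (x2 p)) (fst (y2 p)))"
  proof (rule curvature_type[OF \<epsilon>_linear[OF y_B] \<epsilon>_inj[OF y_B] Jt_linear[OF y_B] Jt_mult[OF y_B] p(2) \<epsilon>_span[OF y_B p(2)]
        lin _ R\<Gamma>_perp[OF y_B] curvature_J[OF y_B] Bianchi[OF y_B] dim])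
    show "?R b a = - ?R a b" for a b by (simp add: R\<Gamma>_def)
  qed (use relx(1)[OF p(1)] rely(1)[OF p(1)] in \<open>simp_all add: Nrm_p\<close>)
  define A1 A2 B1 B2 where "A1 = NF y1 y1' (x1 p)" and "A2 = NF y1 y1' (x2 p)" and "B1 = NF x1 x1' (y1 p)" and "B2 = NF x1 x1' (y2 p)"
  have \<zeta>l: "\<zeta> p (s - t) = \<zeta> p s - \<zeta> p t" "\<zeta> p (s + t) = \<zeta> p s + \<zeta> p t" for s t
    by (simp_all add: \<zeta>_def linear_diff[OF \<Gamma>_linear(1)[OF y_B]] linear_add[OF \<Gamma>_linear(1)[OF y_B]])
  have \<zeta>z: "\<zeta> p z1 = \<zeta> p (y1' (x1 p) - x1' (y1 p)) - \<zeta> p (y2' (x2 p) - x2' (y2 p))"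
    "\<zeta> p z2 = \<zeta> p (y2' (x1 p) - x1' (y2 p)) + \<zeta> p (y1' (x2 p) - x2' (y1 p))"
    unfolding z1_def z2_def by (rule \<zeta>l)+
  have br: "\<zeta> p (y1' (x1 p) - x1' (y1 p)) = A1 - B1 - ?R (fst (x1 p)) (fst (y1 p))"
    "\<zeta> p (y2' (x2 p) - x2' (y2 p)) = (cross3 (cross3 ?u F) G + cross3 ?u A2) - (cross3 (cross3 ?u G) F + cross3 ?u B2) - ?R (fst (x2 p)) (fst (y2 p))"
    "\<zeta> p (y2' (x1 p) - x1' (y2 p)) = (cross3 F G + cross3 ?u A1) - B2 - ?R (fst (x1 p)) (fst (y2 p))"
    "\<zeta> p (y1' (x2 p) - x2' (y1 p)) = A2 - (cross3 G F + cross3 ?u B1) - ?R (fst (x2 p)) (fst (y1 p))"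
    using NF_bracket[of x1 y1 y1' x1', OF perp(1,3)] NF_bracket[of x2 y2 y2' x2', OF perp(2,4)]
      NF_bracket[of x1 y2 y2' x1', OF perp(1,4)] NF_bracket[of x2 y1 y1' x2', OF perp(2,3)]
    unfolding NFx[OF perp(3)] NFx[OF perp(4)] NFy[OF perp(1)] NFy[OF perp(2)] F2 G2 F_def[symmetric] G_def[symmetric]
      A1_def A2_def B1_def B2_def
    by (simp_all add: eq_diff_eq)
  \<comment> \<open>\<open>A2\<close> and \<open>B2\<close> need not be orthogonal to
    \<open>u\<close>, and the double product with \<open>u\<close> is minus the identity only on
    orthogonal vectors. So their radial components are needed.\<close>
  have uA2: "?u \<bullet> A2 = - (cross3 ?u F \<bullet> G)" and uB2: "?u \<bullet> B2 = - (cross3 ?u G \<bullet> F)"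
    unfolding A2_def B2_def
    using NPy[OF perp(2)] NPx[OF perp(4)]
    unfolding F2 G2 F_def[symmetric] G_def[symmetric] by (simp_all add: add_eq_0_iff)
  define s where "s = ?u \<bullet> cross3 F G"
  have FGs: "cross3 F G = s *\<^sub>R ?u" unfolding s_def by (rule cross_perp_parallel[OF p(2) FG])
  have GFs: "cross3 G F = - s *\<^sub>R ?u" using cross_skew[of G F] FGs by simp
  have s1: "cross3 ?u F \<bullet> G = s" "cross3 ?u G \<bullet> F = - s"
    using cross_triple[of ?u F G] cross_triple[of ?u G F] FGs GFs uu by (auto simp: inner_commute)
  \<comment> \<open>For \<open>H\<close> and \<open>K\<close> orthogonal to \<open>u\<close>, the
    inner product \<open>(u x H) x K\<close> is parallel to \<open>u\<close>. These products in the
    real part of the bracket therefore do not contribute.\<close>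
  have c: "cross3 ?u (cross3 (cross3 ?u H) K) = 0" if "?u \<bullet> H = 0" "?u \<bullet> K = 0" for H K
  proof -
    have "cross3 (cross3 ?u H) K = - cross3 K (cross3 ?u H)" by (rule cross_skew)
    also have "\<dots> = (K \<bullet> ?u) *\<^sub>R H - (K \<bullet> H) *\<^sub>R ?u" by (simp add: Lagrange)
    finally show ?thesis using that by (simp add: inner_commute cross_minus_right cross_mult_right)
  qed
  have uu2: "cross3 ?u (cross3 ?u A2) = - s *\<^sub>R ?u - A2" "cross3 ?u (cross3 ?u B2) = s *\<^sub>R ?u - B2"
    by (simp_all add: Lagrange uu uA2 uB2 s1)
  have "cross3 ?u (\<zeta> p z1) = cross3 ?u A1 - cross3 ?u B1 - (cross3 ?u (cross3 ?u A2) - cross3 ?u (cross3 ?u B2))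
      - cross3 ?u (?R (fst (x1 p)) (fst (y1 p)) - ?R (fst (x2 p)) (fst (y2 p)))"
    unfolding \<zeta>z(1) br
    by (simp add: cross_add_right Cross3.right_diff_distrib c FG)
  also have "\<dots> = \<zeta> p z2"
    unfolding \<zeta>z(2) br R[symmetric] uu2 FGs GFs by (simp add: algebra_simps)
  finally show "\<zeta> p z2 = cross3 ?u (\<zeta> p z1)" by simp
qed

end

section \<open>Vector fields on Z in coordinates\<close>

definition vz :: "('m \<times> ('v \<Rightarrow>\<^sub>L 'v) \<Rightarrow> ('m \<times> ('v \<Rightarrow>\<^sub>L 'v)) tvec) \<Rightarrow> 'n \<times> (real ^ 3) \<Rightarrow> 'n \<times> (real ^ 3)" where
  "vz X p = vecZ (X (zp p))"

lemma vz_eq: "vz X p = (\<Sum>b\<in>Basis. fz (\<lambda>z. X z (coordZ b)) p *\<^sub>R b)"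
  by (simp add: vz_def vecZ_def fz_def)

lemma vz_has_derivative:
  assumes "X \<in> vector_fields FZ (Z_space \<rho>)" "p \<in> BZ"
  shows "(vz X has_derivative (\<lambda>\<xi>. \<Sum>b\<in>Basis. frechet_derivative (fz (\<lambda>z. X z (coordZ b))) (at p) \<xi> *\<^sub>R b)) (at p)"
proof -
  have "(\<lambda>z. X z (coordZ b)) \<in> FZ" for b using assms(1) coordZ_FZ by (simp add: vector_fields_def)
  then show ?thesis
    unfolding vz_eq[abs_def] by (intro has_derivative_sum has_derivative_scaleR_left fz_has_derivative assms(2))
qed

text \<open>The coordinate formula for the bracket survives the radial extension, because a
  derivation acts on any function of the algebra through the derivative of its extension
  \<open>fz\<close>.\<close>

lemma vecZ_bracket:
  assumes X: "X \<in> vector_fields FZ (Z_space \<rho>)" and Y: "Y \<in> vector_fields FZ (Z_space \<rho>)" and z: "z \<in> ZN"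
  shows "vecZ (bracket FZ X Y z) = frechet_derivative (vz Y) (at (cz z)) (vz X (cz z)) - frechet_derivative (vz X) (at (cz z)) (vz Y (cz z))"
proof -
  note p = ZN_D(6)[OF z]
  have T: "X z \<in> tangent_space FZ z" "Y z \<in> tangent_space FZ z"
    using X Y ZN_D(1)[OF z] by (auto simp: vector_fields_def)
  have F: "(\<lambda>z. X z (coordZ b)) \<in> FZ" "(\<lambda>z. Y z (coordZ b)) \<in> FZ" for b
    using X Y coordZ_FZ by (auto simp: vector_fields_def)
  have "vecZ (bracket FZ X Y z) = (\<Sum>b\<in>Basis. frechet_derivative (fz (\<lambda>z. Y z (coordZ b))) (at (cz z)) (vecZ (X z)) *\<^sub>R b)
      - (\<Sum>b\<in>Basis. frechet_derivative (fz (\<lambda>z. X z (coordZ b))) (at (cz z)) (vecZ (Y z)) *\<^sub>R b)"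
    unfolding vecZ_def[of "bracket FZ X Y z"]
    by (simp add: bracket_def coordZ_FZ tangent_Z_apply[OF z T(1) F(2)] tangent_Z_apply[OF z T(2) F(1)] scaleR_left_diff_distrib sum_subtractf)
  then show ?thesis
    by (simp add: frechet_derivative_at[symmetric, OF vz_has_derivative[OF X p]] frechet_derivative_at[symmetric, OF vz_has_derivative[OF Y p]]
        vz_def zp_cz[OF z])
qed

text \<open>Stated for every \<open>q\<close> in \<open>BZ\<close>, not only for unit vectors,
  because \<open>bracket_relations\<close> differentiates these identities on an open set.\<close>

lemma section_relations:
  assumes X: "X \<in> sections_of FZ (Z_space \<rho>) (twistor_C M E A \<rho> \<iota> nab)" and q: "q \<in> BZ"
  defines "x1 \<equiv> vz (\<lambda>z. fst (X z))" and "x2 \<equiv> vz (\<lambda>z. snd (X z))"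
  shows "\<epsilon> (fst q) (fst (x2 q)) = blinfun_apply (Jt (fst q) (snd (Nrm q))) (\<epsilon> (fst q) (fst (x1 q)))"
    "\<zeta> (Nrm q) (x2 q) = cross3 (snd (Nrm q)) (\<zeta> (Nrm q) (x1 q))"
    "snd (Nrm q) \<bullet> snd (x1 q) = 0" "snd (Nrm q) \<bullet> snd (x2 q) = 0"
proof -
  note z = zp_ZN(1)[OF q]
  have N: "cz (zp q) = Nrm q" using zp_ZN(2)[OF q] by (simp add: Nrm_def)
  then have N': "\<phi> (fst (zp q)) = fst q" "uz (zp q) = snd (Nrm q)" by (simp_all add: cz_def Nrm_def)
  have "X (zp q) \<in> twistor_C M E A \<rho> \<iota> nab (zp q)" using X ZN_D(1)[OF z] by (simp add: sections_of_def)
  then have C: "(fst (X (zp q)), snd (X (zp q))) \<in> twistor_C M E A \<rho> \<iota> nab (zp q)" by simp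
  note C' = C[unfolded twistor_C_iff[OF z] N N']
  show "\<epsilon> (fst q) (fst (x2 q)) = blinfun_apply (Jt (fst q) (snd (Nrm q))) (\<epsilon> (fst q) (fst (x1 q)))"
    "\<zeta> (Nrm q) (x2 q) = cross3 (snd (Nrm q)) (\<zeta> (Nrm q) (x1 q))"
    using C' by (simp_all add: x1_def x2_def vz_def)
  show "snd (Nrm q) \<bullet> snd (x1 q) = 0" "snd (Nrm q) \<bullet> snd (x2 q) = 0"
    using vecZ_perp[OF z] C' by (simp_all add: x1_def x2_def vz_def N')
qed

lemma vecZ_lincomb: "vecZ (\<lambda>f. X f - Y f) = vecZ X - vecZ Y"
  by (simp add: vecZ_def scaleR_left_diff_distrib sum_subtractf)

lemma bracket_in_twistor_C:
  assumes X: "X \<in> sections_of FZ (Z_space \<rho>) (twistor_C M E A \<rho> \<iota> nab)"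
    and Y: "Y \<in> sections_of FZ (Z_space \<rho>) (twistor_C M E A \<rho> \<iota> nab)" and z: "z \<in> ZN"
    and dim: "DIM('v) = 4 * k" "DIM('n) = 4 * k - l" "l \<le> 2 * k - 1" "2 * k - l \<noteq> 2"
  shows "cbracket FZ X Y z \<in> twistor_C M E A \<rho> \<iota> nab z"
proof -
  let ?X1 = "\<lambda>z. fst (X z)" and ?X2 = "\<lambda>z. snd (X z)" and ?Y1 = "\<lambda>z. fst (Y z)" and ?Y2 = "\<lambda>z. snd (Y z)"
  have V: "?X1 \<in> vector_fields FZ (Z_space \<rho>)" "?X2 \<in> vector_fields FZ (Z_space \<rho>)"
    "?Y1 \<in> vector_fields FZ (Z_space \<rho>)" "?Y2 \<in> vector_fields FZ (Z_space \<rho>)"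
    using X Y by (auto simp: sections_of_def)
  let ?p = "cz z"
  have p: "?p \<in> BZ" "norm (snd ?p) = 1" using ZN_D[OF z] by auto
  have d: "(vz X has_derivative frechet_derivative (vz X) (at ?p)) (at ?p)" if "X \<in> vector_fields FZ (Z_space \<rho>)" for X
    using differentiableI[OF vz_has_derivative[OF that p(1)]] by (simp only: frechet_derivative_works)
  let ?D = "\<lambda>P. frechet_derivative (vz P) (at ?p)"
  let ?z1 = "(?D ?Y1 (vz ?X1 ?p) - ?D ?X1 (vz ?Y1 ?p)) - (?D ?Y2 (vz ?X2 ?p) - ?D ?X2 (vz ?Y2 ?p))"
  let ?z2 = "(?D ?Y2 (vz ?X1 ?p) - ?D ?X1 (vz ?Y2 ?p)) + (?D ?Y1 (vz ?X2 ?p) - ?D ?X2 (vz ?Y1 ?p))"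
  have br: "\<epsilon> (fst ?p) (fst ?z2) = blinfun_apply (Jt (fst ?p) (snd ?p)) (\<epsilon> (fst ?p) (fst ?z1))"
    "\<zeta> ?p ?z2 = cross3 (snd ?p) (\<zeta> ?p ?z1)"
    by (rule bracket_relations[OF p d[OF V(1)] d[OF V(2)] _ _ _ _ d[OF V(3)] d[OF V(4)] _ _ _ _ dim];
        rule section_relations[OF X] section_relations[OF Y]; assumption)+
  let ?B1 = "\<lambda>f. bracket FZ ?X1 ?Y1 z f - bracket FZ ?X2 ?Y2 z f"
  let ?B2 = "\<lambda>f. bracket FZ ?X1 ?Y2 z f + bracket FZ ?X2 ?Y1 z f"
  have T: "bracket FZ P Q z \<in> tangent_space FZ z" if "P \<in> vector_fields FZ (Z_space \<rho>)" "Q \<in> vector_fields FZ (Z_space \<rho>)" for P Q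
    using FZ.bracket_vector_fields[OF that] ZN_D(1)[OF z] by (simp add: vector_fields_def)
  have BT: "?B1 \<in> tangent_space FZ z" "?B2 \<in> tangent_space FZ z"
    using FZ.tangent_space_lincomb[OF T[OF V(1,3)] T[OF V(2,4)], of 1 "-1"] FZ.tangent_space_lincomb[OF T[OF V(1,4)] T[OF V(2,3)], of 1 1]
    by simp_all
  have "cbracket FZ X Y z = (?B1, ?B2)" by (simp add: cbracket_def Let_def)
  moreover have "(?B1, ?B2) \<in> twistor_C M E A \<rho> \<iota> nab z"
    unfolding twistor_C_iff[OF z]
    using BT br unfolding vecZ_lincomb vecZ_add vecZ_bracket[OF V(1,3) z] vecZ_bracket[OF V(2,4) z] vecZ_bracket[OF V(1,4) z]
      vecZ_bracket[OF V(2,3) z]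
    by (simp add: cz_def)
  ultimately show ?thesis by simp
qed

end

section \<open>Globalisation\<close>

lemma (in cr_quat) integrable:
  assumes dim: "DIM('v) = 4 * k" "DIM('n) = 4 * k - l" "l \<le> 2 * k - 1" "2 * k - l \<noteq> 2"
  shows "integrable_structure FZ (Z_space \<rho>) (twistor_C M E A \<rho> \<iota> nab)"
  unfolding integrable_structure_def
proof (intro ballI)
  fix X Y assume X: "X \<in> sections_of FZ (Z_space \<rho>) (twistor_C M E A \<rho> \<iota> nab)"
    and Y: "Y \<in> sections_of FZ (Z_space \<rho>) (twistor_C M E A \<rho> \<iota> nab)"
  have V: "(\<lambda>z. fst (X z)) \<in> vector_fields FZ (Z_space \<rho>)" "(\<lambda>z. snd (X z)) \<in> vector_fields FZ (Z_space \<rho>)"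
    "(\<lambda>z. fst (Y z)) \<in> vector_fields FZ (Z_space \<rho>)" "(\<lambda>z. snd (Y z)) \<in> vector_fields FZ (Z_space \<rho>)"
    using X Y by (auto simp: sections_of_def)
  note br = FZ.bracket_vector_fields
  have lin: "(\<lambda>z f. P z f + c * Q z f) \<in> vector_fields FZ (Z_space \<rho>)"
    if "P \<in> vector_fields FZ (Z_space \<rho>)" "Q \<in> vector_fields FZ (Z_space \<rho>)" for P Q c
    using that FZ.tangent_space_lincomb[of "P _" _ "Q _" 1 c] FZ.F_add FZ.F_cmult
    by (auto simp: vector_fields_def)
  \<comment> \<open>Membership in the distribution is checked point by point, so a chart with
    trivialisations around \<open>fst z\<close> is enough.\<close>
  have "cbracket FZ X Y z \<in> twistor_C M E A \<rho> \<iota> nab z" if z: "z \<in> Z_space \<rho>" for z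
  proof -
    obtain U \<phi> where Uz: "(U, \<phi>) \<in> M" "fst z \<in> U" using chart_cover by blast
    obtain W \<tau> where Wz: "(W, \<tau>) \<in> E" "fst z \<in> W" using E_cover by blast
    obtain W' \<alpha> where Wz': "(W', \<alpha>) \<in> A" "fst z \<in> W'" using A_cover by blast
    obtain r where rz: "r > 0" "mfd_chart M U \<phi> (U \<inter> (W \<inter> W')) (\<phi> (fst z)) r"
      using mfd_chart_exists[OF Uz, of "W \<inter> W'"] E_open[OF Wz(1)] A_open[OF Wz'(1)] Wz(2) Wz'(2) by blast
    interpret mfd_chart M U \<phi> "U \<inter> (W \<inter> W')" "\<phi> (fst z)" r by (rule rz(2))
    interpret cr_chart M E A \<rho> \<iota> nab U \<phi> "U \<inter> (W \<inter> W')" "\<phi> (fst z)" r W \<tau> W' \<alpha>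
      by unfold_locales (use Wz(1) Wz'(1) in auto)
    have "z \<in> ZN" using z Uz(2) Wz(2) Wz'(2) rz(1) by (simp add: ZN_def N1_iff B_def)
    then show ?thesis by (rule bracket_in_twistor_C[OF X Y _ dim])
  qed
  then show "cbracket FZ X Y \<in> sections_of FZ (Z_space \<rho>) (twistor_C M E A \<rho> \<iota> nab)"
    using lin[OF br[OF V(1,3)] br[OF V(2,4)], of "-1"] lin[OF br[OF V(1,4)] br[OF V(2,3)], of 1]
    by (simp add: sections_of_def cbracket_def Let_def)
qed

theorem theorem4p6:
  fixes M :: "('m::{t2_space, second_countable_topology}, 'n::euclidean_space) atlas"
    and E :: "('m, 'v::euclidean_space) vbundle"
    and A :: "('m, quat) vbundle"
    and \<rho> :: "'m \<Rightarrow> quat \<Rightarrow> ('v \<Rightarrow>\<^sub>L 'v)"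
    and \<iota> :: "'m \<Rightarrow> 'm tvec \<Rightarrow> 'v"
    and nab :: "'m \<Rightarrow> 'm tvec \<Rightarrow> ('m \<Rightarrow> 'v) \<Rightarrow> 'v"
    and k l :: nat
  assumes "smooth_manifold M"
    and "almost_CR_quaternionic M E A \<rho> \<iota>"
    and "DIM('v) = 4 * k"
    and "DIM('n) = 4 * k - l"
    and "l \<le> 2 * k - 1"
    and "quaternionic_connection M E \<rho> \<iota> nab"
    and "2 * k - l \<noteq> 2"
  shows "integrable_structure (Z_smooth_functions M A \<rho>) (Z_space \<rho>) (twistor_C M E A \<rho> \<iota> nab)"
proof -
  interpret cr_quat M E A \<rho> \<iota> nab using assms(1,2,6) by unfold_locales
  show ?thesis by (rule integrable) (use assms in auto)
qed

end
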